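(* For real $x>0$ let $$f_{7}(x)=\frac{(21x-8)\,\Gamma(x)^6}{8\,\Gamma(2x)^3}.$$ Then the following series converge and $$\sum_{k=1}^\infty f_{7}''(k)=\frac{57}2\zeta(4),\qquad \sum_{k=1}^\infty f_{7}^{(3)}(k)=18\pi^2\zeta(3)-324\zeta(5),$$ $$\sum_{k=1}^\infty f_{7}^{(4)}(k)=\frac{1959}2\zeta(6)-432\zeta(3)^2,\qquad \sum_{k=1}^\infty f_{7}^{(5)}(k)=19440\zeta(2)\zeta(5)-540\zeta(3)\zeta(4)-31860\zeta(7),$$ $$\sum_{k=1}^\infty f_{7}^{(6)}(k)=31104\zeta(5,3)+38880\zeta(2)\zeta(3)^2-77760\zeta(3)\zeta(5)-\frac{84807}4\zeta(8),$$ $$\frac{1}{630}\sum_{k=1}^\infty f_{7}^{(7)}(k)=6372\zeta(2)\zeta(7)-213\zeta(3)\zeta(6)-324\zeta(4)\zeta(5)-288\zeta(3)^3-8812\zeta(9).$$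
   Context: $\Gamma$ is Euler's gamma function and $f^{(m)}$ (also $f''$) is the $m$-th derivative with respect to $x$. $\zeta(s)=\sum_{n\ge1}n^{-s}$ is the Riemann zeta function and $\zeta(5,3)=\sum_{k_1>k_2>0}\frac{1}{k_1^5k_2^3}$. *)

theory Defs
  imports "HOL-Analysis.Analysis"
begin

text \<open>The Dirichlet series converges only for \<open>s > 1\<close>; no analytic continuation is intended.
  The index is shifted so that the series starts at \<open>1\<close>.\<close>

definition zeta :: "real \<Rightarrow> real" where
  "zeta s = (\<Sum>n. real (Suc n) powr (- s))"

text \<open>The larger summation index carries the first exponent, so that the series converges for
  \<open>a \<ge> 2\<close> and \<open>b \<ge> 1\<close>.\<close>

definition double_zeta :: "nat \<Rightarrow> nat \<Rightarrow> real" where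
  "double_zeta a b =
     (\<Sum>\<^sub>\<infinity>(k1, k2)\<in>{(k1, k2). k1 > k2 \<and> k2 > 0}. 1 / (real k1 ^ a * real k2 ^ b))"

text \<open>Only the values at \<open>x > 0\<close> matter, where \<open>f7\<close> is smooth. There the iterates of \<open>deriv\<close> are the
  derivatives of \<open>f7\<close> restricted to the positive reals.\<close>

definition f7 :: "real \<Rightarrow> real" where
  "f7 x = (21 * x - 8) * Gamma x ^ 6 / (8 * Gamma (2 * x) ^ 3)"

end

(*
  Put S(a) = sum_{k>=1} f7(k + a), so that the claimed sums are the numbers n! [a^n] S(a), n = 2,...,7.
  With b(a) = Gamma(1+a)^2 / Gamma(1+2a) and V(a) = sum_{k>=0} (k+1)^-3 prod_{i<=k} (1-a/i)^2 (1+2a/i),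
  the function
    R(a) = b(a)^3 / (3a^2) + (pi / sin(pi a))^2 (1 - 4/3 b(a)^2 (1 + 2 a^3 V(a)))
  satisfies the same difference equation R(a) - R(a+1) = f7(1+a) as S, by a Zeilberger certificate for V.
  Hence S - R is 1-periodic and holomorphic; it grows more slowly than exp(2 pi |Im a|), so it is constant.
  It remains to expand R. The factors 1 - 3a^2/i^2 + 2a^3/i^3 turn the Taylor coefficients of V into multiple
  zeta values with arguments 2 and 3. Those with a single 3 are read off from the same periodicity argument
  applied to sum_k k^-3 prod_{i<k} (1 - z^2/i^2). In weight 6 and 8 the double shuffle relations are used; the
  only genuine triple sum, in weight 8, is reduced to double zeta values by a parity argument.
*)
theory Submission
  imports Defs "HOL-Complex_Analysis.Complex_Analysis"
begin

text \<open>A growth budget shapes the proof. The products in \<open>V\<close> are only bounded by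
  exp(3 pi |a|), above the admissible 2 pi, but in R the term with \<open>V\<close> carries (pi /
  sin(pi a))^2, which decays like exp(-2 pi |Im a|). The factor b grows at most linearly on the
  strip: it is 1 + 2a times a Beta value B(x, x), bounded on vertical strips by the duplication
  formula. The total is pi plus an excess that can be made small. The squared cosecant also has
  period 1, and by the reflection formula the infinite product in the boundary term of the
  certificate is b / (pi a / sin(pi a))^2. Hence multiplying by b^2 and the squared cosecant leaves
  b^3 times a rational function, which b^3 / (3a^2) completes to the summand. The constant S - R is
  never computed: it affects only the coefficient of a^0. The parity argument works because
  1/(k-a)^p and 1/(k+a)^p together form a sum over integers k of both signs, in which the harmonic
  sums cancel. What remains in weight 8 reduces to \<open>zt\<close> and zeta(5,3).\<close>

section \<open>Series of holomorphic functions and exponential bounds for products\<close>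

text \<open>The majorant may depend on a bound for |z| and may skip finitely many terms: in the
  plane the majorants grow with |z|, and on the strip |Re z| < 1 the first terms are unbounded near
  the edge.\<close>

lemma holomorphic_on_suminf:
  fixes f :: "nat \<Rightarrow> complex \<Rightarrow> complex"
  assumes A: "open A" and f: "\<And>n. f n holomorphic_on A"
    and bound: "\<And>R. \<exists>M N. summable M \<and> (\<forall>n\<ge>N. \<forall>z\<in>A. norm z < R \<longrightarrow> norm (f n z) \<le> M n)"
  shows "(\<lambda>z. \<Sum>n. f n z) holomorphic_on A"
proof (rule holomorphic_uniform_sequence[OF A])
  show "(\<lambda>z. \<Sum>i<n. f i z) holomorphic_on A" for n
    by (intro holomorphic_intros f)
  fix z assume "z \<in> A"
  then obtain d where d: "d > 0" "cball z d \<subseteq> A" using A open_contains_cball by blast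
  obtain M N where M: "summable M" "\<And>n w. n \<ge> N \<Longrightarrow> w \<in> A \<Longrightarrow> norm w < norm z + d + 1 \<Longrightarrow> norm (f n w) \<le> M n"
    using bound[of "norm z + d + 1"] by blast
  have "norm w < norm z + d + 1" if "w \<in> cball z d" for w
    using that norm_triangle_ineq2[of w z] by (simp add: dist_norm norm_minus_commute)
  hence "uniform_limit (cball z d) (\<lambda>n x. \<Sum>i<n. f i x) (\<lambda>x. \<Sum>i. f i x) sequentially"
    using d M by (intro Weierstrass_m_test_ev[where M = M] eventually_sequentiallyI[of N]) auto
  thus "\<exists>d>0. cball z d \<subseteq> A \<and> uniform_limit (cball z d) (\<lambda>n z. \<Sum>i<n. f i z) (\<lambda>z. \<Sum>n. f n z) sequentially"
    using d by blast
qed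

text \<open>Uniform limits of holomorphic functions can be differentiated termwise, so a majorant of
  the terms controls the series of all their derivatives.\<close>

lemma sums_higher_deriv:
  fixes f :: "nat \<Rightarrow> complex \<Rightarrow> complex"
  assumes A: "open A" "z \<in> A" and f: "\<And>n. f n holomorphic_on A"
    and bound: "summable M" "\<And>n w. n \<ge> N \<Longrightarrow> w \<in> A \<Longrightarrow> norm (f n w) \<le> M n"
  shows "(\<lambda>n. (deriv ^^ m) (f n) z) sums (deriv ^^ m) (\<lambda>z. \<Sum>n. f n z) z"
proof -
  have "uniform_limit A (\<lambda>n x. \<Sum>i<n. f i x) (\<lambda>x. \<Sum>i. f i x) sequentially"
    using bound by (intro Weierstrass_m_test_ev[where M = M] eventually_sequentiallyI[of N]) auto
  hence "(\<lambda>n. (deriv ^^ m) (\<lambda>x. \<Sum>i<n. f i x) z) \<longlonglongrightarrow> (deriv ^^ m) (\<lambda>x. \<Sum>i. f i x) z"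
    by (rule higher_deriv_complex_uniform_limit) (auto intro!: always_eventually holomorphic_intros f A)
  also have "(\<lambda>n. (deriv ^^ m) (\<lambda>x. \<Sum>i<n. f i x) z) = (\<lambda>n. \<Sum>i<n. (deriv ^^ m) (f i) z)"
  proof
    fix n show "(deriv ^^ m) (\<lambda>x. \<Sum>i<n. f i x) z = (\<Sum>i<n. (deriv ^^ m) (f i) z)"
    proof (induction n)
      case (Suc n)
      have "(deriv ^^ m) (\<lambda>x. (\<Sum>i<n. f i x) + f n x) z =
              (deriv ^^ m) (\<lambda>x. \<Sum>i<n. f i x) z + (deriv ^^ m) (f n) z"
        by (rule higher_deriv_add[of _ A]) (auto intro!: holomorphic_intros f A)
      thus ?case using Suc by simp
    qed (simp add: higher_deriv_const)
  qed
  finally show ?thesis by (simp add: sums_def)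
qed

lemma has_fps_expansion_suminf:
  fixes f :: "nat \<Rightarrow> complex \<Rightarrow> complex"
  assumes A: "open A" "0 \<in> A" and f: "\<And>n. f n holomorphic_on A"
    and bound: "summable M" "\<forall>n. \<forall>w\<in>A. norm (f n w) \<le> M n"
    and F: "\<And>n. f n has_fps_expansion F n"
  shows "(\<lambda>n. fps_nth (F n) m) sums fps_nth (fps_expansion (\<lambda>z. \<Sum>n. f n z) 0) m"
    and "(\<lambda>z. \<Sum>n. f n z) has_fps_expansion fps_expansion (\<lambda>z. \<Sum>n. f n z) 0"
proof -
  show *: "(\<lambda>z. \<Sum>n. f n z) has_fps_expansion fps_expansion (\<lambda>z. \<Sum>n. f n z) 0"
    using A f
  proof (intro has_fps_expansion_fps_expansion[of A] holomorphic_on_suminf)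
    show "\<exists>M N. summable M \<and> (\<forall>n\<ge>N. \<forall>z\<in>A. norm z < R \<longrightarrow> norm (f n z) \<le> M n)" for R
      using bound by blast
  qed
  have "(\<lambda>n. (deriv ^^ m) (f n) 0 / fact m) sums ((deriv ^^ m) (\<lambda>z. \<Sum>n. f n z) 0 / fact m)"
    using bound by (intro sums_divide sums_higher_deriv[OF A f bound(1)]) auto
  thus "(\<lambda>n. fps_nth (F n) m) sums fps_nth (fps_expansion (\<lambda>z. \<Sum>n. f n z) 0) m"
    by (simp add: fps_nth_fps_expansion[OF *] fps_nth_fps_expansion[OF F])
qed

lemma sinh_le_mult_exp:
  fixes x :: real assumes "x \<ge> 0" shows "sinh x \<le> x * exp x"
proof -
  have "1 - 2 * x \<le> exp (-2 * x)" using exp_ge_add_one_self[of "-2*x"] by simp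
  hence "exp x * (1 - exp (-2 * x)) \<le> exp x * (2 * x)" by (intro mult_left_mono) auto
  also have "exp x * (1 - exp (-2 * x)) = 2 * sinh x"
    by (simp add: sinh_def right_diff_distrib exp_add[symmetric])
  finally show ?thesis by (simp add: mult_ac)
qed

text \<open>The products increase to sinh(pi r) / (pi r), the sine product at the imaginary point i
  r. The bound is uniform in n and yields the exponential types of \<open>Qp\<close> and
  \<open>Pp\<close>.\<close>

lemma prod_one_plus_sq_le:
  fixes r :: real assumes "r \<ge> 0"
  shows "(\<Prod>i=1..n. 1 + r\<^sup>2 / real i ^ 2) \<le> exp (pi * r)"
proof (cases "r = 0")
  case False
  hence r: "r > 0" using assms by auto
  define p where "p = (\<lambda>n. \<Prod>i=1..n. 1 + r\<^sup>2 / real i ^ 2)"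
  have "incseq p"
  proof (rule incseq_SucI)
    fix n show "p n \<le> p (Suc n)"
      using prod_nonneg[of "{1..n}" "\<lambda>i. 1 + r\<^sup>2 / real i ^ 2"]
      by (simp add: p_def mult_left_mono algebra_simps)
  qed
  have "(\<lambda>n. of_real pi * (\<i> * of_real r) * (\<Prod>k=1..n. 1 - (\<i> * of_real r)^2 / of_nat k^2))
      \<longlonglongrightarrow> sin (of_real pi * (\<i> * of_real r))" by (rule sin_product_formula_complex)
  also have "(\<lambda>n. of_real pi * (\<i> * of_real r) * (\<Prod>k=1..n. 1 - (\<i> * of_real r)^2 / of_nat k^2))
      = (\<lambda>n. \<i> * of_real (pi * r * p n))"
    by (simp add: p_def power_mult_distrib mult_ac)
  also have "sin (of_real pi * (\<i> * of_real r)) = \<i> * of_real (sinh (pi * r))"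
  proof -
    have "\<i> * (of_real pi * (\<i> * of_real r)) = complex_of_real (- (pi * r))" by (simp add: complex_eq_iff)
    hence *: "sin (of_real pi * (\<i> * of_real r)) =
             (of_real (exp (- (pi * r))) - of_real (exp (pi * r))) / (2 * \<i>)"
      unfolding sin_exp_eq by (simp only: exp_of_real minus_mult_right of_real_minus[symmetric]) simp
    show ?thesis unfolding * by (simp add: sinh_def field_simps)
  qed
  finally have "(\<lambda>n. Im (\<i> * of_real (pi * r * p n))) \<longlonglongrightarrow> Im (\<i> * of_real (sinh (pi * r)))"
    by (rule tendsto_Im)
  hence "(\<lambda>n. pi * r * p n) \<longlonglongrightarrow> sinh (pi * r)" by simp
  moreover have "incseq (\<lambda>n. pi * r * p n)"
    using \<open>incseq p\<close> r by (auto simp: incseq_def intro!: mult_left_mono)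
  ultimately have "pi * r * p n \<le> sinh (pi * r)" by (rule incseq_le[rotated])
  also have "\<dots> \<le> pi * r * exp (pi * r)" using r by (intro sinh_le_mult_exp) auto
  finally show ?thesis using r by (simp add: p_def)
qed auto

lemma norm_sin_le: "norm (sin z) \<le> exp \<bar>Im z\<bar>" for z :: complex
proof -
  have "norm (exp (\<i> * z) - exp (- (\<i> * z))) \<le> exp (- Im z) + exp (Im z)"
    using norm_triangle_ineq4[of "exp (\<i> * z)" "exp (- (\<i> * z))"] by simp
  also have "\<dots> \<le> 2 * exp \<bar>Im z\<bar>" by (cases "Im z \<ge> 0") auto
  finally show ?thesis by (simp add: sin_exp_eq norm_divide norm_mult)
qed

lemma norm_strip_le:
  fixes z :: complex
  assumes "\<bar>Re z\<bar> \<le> 1/2"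
  shows "norm z \<le> \<bar>Im z\<bar> + 1/2"
  using cmod_le[of z] assms by linarith

lemma summable_inverse_power_Suc:
  "p \<ge> 2 \<Longrightarrow> summable (\<lambda>n. 1 / real (Suc n) ^ p)"
  using inverse_power_summable[of p, where 'a = real]
  by (subst summable_Suc_iff) (simp add: field_simps)

text \<open>Common treatment of \<open>V0\<close> and \<open>V\<close>, whose finite products both
  have an exponential type that is uniform in k.\<close>

lemma series_over_cubes:
  fixes P :: "complex \<Rightarrow> nat \<Rightarrow> complex"
  assumes P: "\<And>z k. norm (P z k) \<le> exp (c * norm z)" "c \<ge> 0" "\<And>k. (\<lambda>z. P z k) holomorphic_on UNIV"
  shows "summable (\<lambda>k. P z k / of_nat (Suc k) ^ 3)"
    and "(\<lambda>z. \<Sum>k. P z k / of_nat (Suc k) ^ 3) holomorphic_on UNIV"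
    and "norm (\<Sum>k. P z k / of_nat (Suc k) ^ 3) \<le> exp (c * norm z) * (\<Sum>k. 1 / real (Suc k) ^ 3)"
    and "(\<And>k. (\<lambda>z. P z k) has_fps_expansion F k) \<Longrightarrow>
      (\<lambda>k. fps_nth (F k) n / of_nat (Suc k) ^ 3) sums fps_nth (fps_expansion (\<lambda>z. \<Sum>k. P z k / of_nat (Suc k) ^ 3) 0) n"
proof -
  have bd: "norm (P z k / of_nat (Suc k) ^ 3) \<le> exp (c * R) * (1 / real (Suc k) ^ 3)" if "norm z \<le> R" for z k R
  proof -
    have "norm (P z k) \<le> exp (c * R)"
      using P(1)[of z k] mult_left_mono[OF that P(2)] by (meson exp_le_cancel_iff order_trans)
    thus ?thesis by (simp add: norm_divide norm_power divide_right_mono del: of_nat_Suc)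
  qed
  have sm: "summable (\<lambda>k. exp (c * R) * (1 / real (Suc k) ^ 3))" for R
    by (intro summable_mult summable_inverse_power_Suc) auto
  have hol: "(\<lambda>z. P z k / of_nat (Suc k) ^ 3) holomorphic_on A" for k A
    by (intro holomorphic_intros holomorphic_on_subset[OF P(3)]) (auto simp del: of_nat_Suc)
  show "summable (\<lambda>k. P z k / of_nat (Suc k) ^ 3)"
    by (rule summable_comparison_test'[OF sm bd[OF order.refl]])
  show "(\<lambda>z. \<Sum>k. P z k / of_nat (Suc k) ^ 3) holomorphic_on UNIV"
    by (rule holomorphic_on_suminf[OF open_UNIV hol]) (use sm bd in \<open>meson less_imp_le\<close>)
  have "norm (\<Sum>k. P z k / of_nat (Suc k) ^ 3) \<le> (\<Sum>k. exp (c * norm z) * (1 / real (Suc k) ^ 3))"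
    by (intro norm_suminf_le bd sm) auto
  thus "norm (\<Sum>k. P z k / of_nat (Suc k) ^ 3) \<le> exp (c * norm z) * (\<Sum>k. 1 / real (Suc k) ^ 3)"
    by (subst (asm) suminf_mult) (auto intro: summable_inverse_power_Suc simp del: of_nat_Suc)
  assume F: "\<And>k. (\<lambda>z. P z k) has_fps_expansion F k"
  have T: "(\<lambda>z. P z k / of_nat (Suc k) ^ 3) has_fps_expansion fps_const (1 / of_nat (Suc k) ^ 3) * F k" for k
    using has_fps_expansion_cmult_left[OF F, of "1 / of_nat (Suc k) ^ 3" k] by simp
  have 0: "0 \<in> ball (0::complex) 1" by simp
  have "\<forall>k. \<forall>w\<in>ball 0 1. norm (P w k / of_nat (Suc k) ^ 3) \<le> exp (c * 1) * (1 / real (Suc k) ^ 3)"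
    by (intro allI ballI bd) auto
  from has_fps_expansion_suminf(1)[OF open_ball 0 hol sm this T]
  show "(\<lambda>k. fps_nth (F k) n / of_nat (Suc k) ^ 3) sums fps_nth (fps_expansion (\<lambda>z. \<Sum>k. P z k / of_nat (Suc k) ^ 3) 0) n"
    by simp
qed

section \<open>Periodic functions on a vertical strip\<close>

lemma open_strip: "open {z. \<bar>Re z\<bar> < 1}"
proof -
  have "{z. \<bar>Re z\<bar> < 1} = {z. Re z < 1} \<inter> {z. Re z > -1}" by auto
  thus ?thesis by (simp add: open_Int open_halfspace_Re_lt open_halfspace_Re_gt)
qed

text \<open>In the coordinate \<open>w = exp (2\<pi>iz)\<close> the function becomes holomorphic on the punctured plane, and
  \<open>c < 2\<pi>\<close> makes it \<open>o(1/|w|)\<close> at \<open>0\<close> and \<open>o(|w|)\<close> at infinity, so that Liouville applies.\<close>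

lemma periodic_strip_constant:
  fixes f :: "complex \<Rightarrow> complex"
  assumes holo: "f holomorphic_on {z. \<bar>Re z\<bar> < 1}"
    and per: "\<And>z. -1 < Re z \<Longrightarrow> Re z < 0 \<Longrightarrow> f (z + 1) = f z"
    and bound: "\<And>z. \<bar>Re z\<bar> \<le> 1/2 \<Longrightarrow> norm (f z) \<le> C * exp (c * \<bar>Im z\<bar>)"
    and c: "0 \<le> c" "c < 2 * pi"
    and z: "\<bar>Re z\<bar> < 1"
  shows "f z = f 0"
proof -
  define g where "g = (\<lambda>w. f (Ln w / (2 * pi * \<i>)))"
  have opn: "open {z::complex. Re z < 0}" "open (- \<real>\<^sub>\<le>\<^sub>0 :: complex set)"
    by (auto simp: open_halfspace_Re_lt)
  have Re_div: "Re (w / (2 * pi * \<i>)) = Im w / (2 * pi)"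
    and Im_div: "Im (w / (2 * pi * \<i>)) = - Re w / (2 * pi)" for w
    by (simp_all add: Re_divide Im_divide field_simps power2_eq_square)
  have g1: "g holomorphic_on (- \<real>\<^sub>\<le>\<^sub>0)"
  proof -
    have "(f \<circ> (\<lambda>w. Ln w / (2 * pi * \<i>))) holomorphic_on (- \<real>\<^sub>\<le>\<^sub>0)"
    proof (rule holomorphic_on_compose_gen[OF _ holo])
      show "(\<lambda>w. Ln w / (2 * pi * \<i>)) holomorphic_on - \<real>\<^sub>\<le>\<^sub>0"
        by (intro holomorphic_intros) auto
      show "(\<lambda>w. Ln w / (2 * pi * \<i>)) ` (- \<real>\<^sub>\<le>\<^sub>0) \<subseteq> {z. \<bar>Re z\<bar> < 1}"
      proof clarify
        fix w :: complex assume "w \<notin> \<real>\<^sub>\<le>\<^sub>0"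
        hence "w \<noteq> 0" by auto
        hence "\<bar>Im (Ln w)\<bar> \<le> pi"
          using mpi_less_Im_Ln[of w] Im_Ln_le_pi[of w] by linarith
        hence "\<bar>Im (Ln w)\<bar> < 2 * pi" using pi_gt_zero by linarith
        thus "\<bar>Re (Ln w / (2 * pi * \<i>))\<bar> < 1"
          unfolding Re_div by (simp add: abs_divide)
      qed
    qed
    thus ?thesis by (simp add: g_def o_def)
  qed
  \<comment> \<open>Across the cut of \<open>Ln\<close>: the branch \<open>l\<close> is continuous
    there with real part strictly between 0 and 1. Below the cut it exceeds the principal branch by
    1, which \<open>per\<close> absorbs.\<close>
  have g2: "g holomorphic_on {w. Re w < 0}"
  proof -
    define l where "l = (\<lambda>w. Ln (-w) / (2 * pi * \<i>) + 1/2)"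
    have Re_l: "0 < Re (l w) \<and> Re (l w) < 1" if "Re w < 0" for w
    proof -
      have "\<bar>Im (Ln (-w))\<bar> < pi / 2" using that Re_Ln_pos_lt[of "-w"] by (cases "w = 0") auto
      hence "-(pi/2) < Im (Ln (-w))" "Im (Ln (-w)) < pi/2" by linarith+
      thus ?thesis using pi_gt_zero unfolding l_def plus_complex.sel Re_div by (auto simp: field_simps)
    qed
    have "(f \<circ> l) holomorphic_on {w. Re w < 0}"
    proof (rule holomorphic_on_compose_gen[OF _ holo])
      show "l holomorphic_on {w. Re w < 0}" unfolding l_def
        by (intro holomorphic_intros) (auto simp: complex_nonpos_Reals_iff)
      show "l ` {w. Re w < 0} \<subseteq> {z. \<bar>Re z\<bar> < 1}" using Re_l by force
    qed
    also have "?this \<longleftrightarrow> ?thesis"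
    proof (rule holomorphic_cong)
      fix w assume "w \<in> {w. Re w < 0}"
      hence w: "Re w < 0" by simp
      hence w0: "-w \<noteq> 0" by auto
      show "(f \<circ> l) w = g w"
      proof (cases "Im w < 0")
        case True
        have "Ln w = Ln (-w) - \<i> * pi"
          using Ln_minus[OF w0] True w by auto
        hence "Ln w / (2 * pi * \<i>) = l w - 1"
          by (simp add: l_def field_simps)
        moreover have "f (l w - 1 + 1) = f (l w - 1)"
          using Re_l[OF w] by (intro per) auto
        ultimately show ?thesis by (simp add: g_def)
      next
        case False
        have "Ln w = Ln (-w) + \<i> * pi"
          using Ln_minus[OF w0] False w by auto
        hence "Ln w / (2 * pi * \<i>) = l w"
          by (simp add: l_def field_simps)
        thus ?thesis by (simp add: g_def)
      qed
    qed auto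
    finally show ?thesis .
  qed
  have "g holomorphic_on (- \<real>\<^sub>\<le>\<^sub>0 \<union> {w. Re w < 0})"
    using g1 g2 opn by (intro holomorphic_on_Un) auto
  also have "- \<real>\<^sub>\<le>\<^sub>0 \<union> {w. Re w < 0} = UNIV - {0::complex}"
    by (auto simp: complex_nonpos_Reals_iff complex_eq_iff)
  finally have gh: "g holomorphic_on UNIV - {0}" .
  \<comment> \<open>|g w| is at most C |w|^(-\<theta>) inside the unit disc and C |w|^\<theta>
    outside; \<theta> < 1 makes 0 removable and the growth sublinear.\<close>
  define \<theta> where "\<theta> = c / (2 * pi)"
  have \<theta>: "0 \<le> \<theta>" "\<theta> < 1" using c by (auto simp: \<theta>_def)
  have C: "C \<ge> 0" using bound[of 0] norm_ge_zero[of "f 0"] by (simp del: norm_ge_zero)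
  have gb: "norm (g w) \<le> C * exp (\<theta> * \<bar>ln (norm w)\<bar>)" if "w \<noteq> 0" for w
  proof -
    have "\<bar>Im (Ln w)\<bar> \<le> pi" using that mpi_less_Im_Ln[of w] Im_Ln_le_pi[of w] by linarith
    hence "\<bar>Re (Ln w / (2 * pi * \<i>))\<bar> \<le> 1/2" unfolding Re_div by (simp add: abs_divide)
    from bound[OF this] show ?thesis unfolding Im_div using that
      by (simp add: g_def \<theta>_def abs_divide)
  qed
  have "((\<lambda>w. C * norm w powr (1 - \<theta>)) \<longlongrightarrow> C * 0) (at 0)"
    using \<theta> by (intro tendsto_intros tendsto_zero_powrI[where b = "1-\<theta>"]) (auto intro!: tendsto_eq_intros)
  hence "((\<lambda>w. C * norm (w::complex) powr (1 - \<theta>)) \<longlongrightarrow> 0) (at 0)"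
    by simp
  hence lim1: "((\<lambda>w. (w - 0) * g w) \<longlongrightarrow> 0) (at 0)"
  proof (rule Lim_null_comparison[rotated])
    have "eventually (\<lambda>w::complex. w \<in> ball 0 1 - {0}) (at 0)"
      by (intro eventually_at_in_open) auto
    thus "\<forall>\<^sub>F w in at 0. norm ((w - 0) * g w) \<le> C * norm w powr (1 - \<theta>)"
    proof eventually_elim
      case (elim w)
      hence w: "w \<noteq> 0" "norm w < 1" by auto
      hence "norm ((w - 0) * g w) \<le> norm w * (C * exp (\<theta> * \<bar>ln (norm w)\<bar>))"
        using gb[of w] by (simp add: norm_mult mult_left_mono)
      also have "\<dots> = C * norm w powr (1 - \<theta>)"
        using w by (simp add: powr_def abs_if exp_add[symmetric] left_diff_distrib exp_diff exp_minus field_simps)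
      finally show ?case .
    qed
  qed
  obtain G where G: "G holomorphic_on UNIV" "\<And>w. w \<noteq> 0 \<Longrightarrow> G w = g w"
    using holomorphic_on_extend_lim[of g UNIV 0] gh lim1 by auto
  have "G w = G 0" for w
  proof -
    \<comment> \<open>\<open>G\<close> itself need not tend to a limit at infinity, but its
      difference quotient at 0 is entire and tends to 0 there.\<close>
    define H where "H = (\<lambda>w. if w = 0 then deriv G 0 else (G w - G 0) / (w - 0))"
    have H: "H holomorphic_on UNIV" unfolding H_def
      by (rule pole_lemma_open[OF G(1)]) auto
    have lim: "(H \<longlongrightarrow> 0) at_infinity"
    proof (rule Lim_null_comparison)
      show "\<forall>\<^sub>F w in at_infinity. norm (H w) \<le> C * norm w powr (\<theta> - 1) + norm (G 0) / norm w"
        unfolding eventually_at_infinity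
      proof (intro exI[of _ 1] allI impI)
        fix w :: complex assume w1: "1 \<le> norm w"
        hence w0: "w \<noteq> 0" by auto
        have "norm (H w) \<le> (norm (g w) + norm (G 0)) / norm w"
          using w0 G(2)[OF w0] norm_triangle_ineq4[of "g w" "G 0"] by (simp add: H_def norm_divide divide_right_mono)
        also have "\<dots> \<le> (C * exp (\<theta> * \<bar>ln (norm w)\<bar>) + norm (G 0)) / norm w"
          using gb[OF w0] by (intro divide_right_mono add_right_mono) auto
        also have "\<dots> = C * norm w powr (\<theta> - 1) + norm (G 0) / norm w"
          using w1 w0 by (simp add: powr_def abs_if left_diff_distrib exp_diff add_divide_distrib)
        finally show "norm (H w) \<le> C * norm w powr (\<theta> - 1) + norm (G 0) / norm w" .
      qed
      have "((\<lambda>w. C * norm w powr (\<theta> - 1) + norm (G 0) * inverse (norm w)) \<longlongrightarrow> C * 0 + norm (G 0) * 0)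
              (at_infinity :: complex filter)"
        using \<theta> by (intro tendsto_intros tendsto_neg_powr filterlim_norm_at_top
            tendsto_inverse_0_at_top) auto
      thus "((\<lambda>w. C * norm w powr (\<theta> - 1) + norm (G 0) / norm w) \<longlongrightarrow> 0) (at_infinity :: complex filter)"
        by (simp add: divide_inverse)
    qed
    have "H w = 0" using Liouville_weak_0[OF H lim] .
    thus ?thesis by (cases "w = 0") (auto simp: H_def)
  qed
  hence const: "g w = g 1" if "w \<noteq> 0" for w
    using G(2)[OF that] G(2)[of 1] by (metis zero_neq_one)
  \<comment> \<open>Exactly on this half-open strip \<open>Ln\<close> inverts the exponential; the
    remaining points are reached by one shift.\<close>
  have half: "f z = f 0" if "-1/2 < Re z" "Re z \<le> 1/2" for z
  proof -
    have "-1 < Re z * 2" "Re z * 2 \<le> 1" using that by auto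
    hence "-pi < Im (2 * pi * \<i> * z)" "Im (2 * pi * \<i> * z) \<le> pi"
      using mult_strict_left_mono[of "-1" "Re z * 2" pi] mult_left_mono[of "Re z * 2" 1 pi]
      by (auto simp: mult_ac)
    hence "Ln (exp (2 * pi * \<i> * z)) = 2 * pi * \<i> * z"
      by (rule Ln_exp)
    hence "g (exp (2 * pi * \<i> * z)) = f z" by (simp add: g_def)
    thus ?thesis using const[of "exp (2 * pi * \<i> * z)"] by (simp add: g_def)
  qed
  consider "-1/2 < Re z \<and> Re z \<le> 1/2" | "Re z \<le> -1/2" | "Re z > 1/2" by linarith
  thus ?thesis
  proof cases
    case 1 thus ?thesis using half by blast
  next
    case 2
    have "f (z + 1) = f 0" using 2 z by (intro half) auto
    thus ?thesis using per[of z] 2 z by simp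
  next
    case 3
    have "f (z - 1) = f 0" using 3 z by (intro half) auto
    thus ?thesis using per[of "z - 1"] 3 z by simp
  qed
qed

text \<open>A filter ignores bounded parts of the strip, where 1/a^2 and the cosecant have
  poles.\<close>

definition strip_at_infinity :: "complex filter" where
  "strip_at_infinity = inf (principal {z. \<bar>Re z\<bar> \<le> 1/2}) (filtercomap (\<lambda>z. \<bar>Im z\<bar>) at_top)"

text \<open>Under products the exponents add, so growth estimates become arithmetic; negative
  exponents, as for the cosecant, are allowed.\<close>

definition strip_exp_bounded :: "real \<Rightarrow> (complex \<Rightarrow> complex) \<Rightarrow> bool" where
  "strip_exp_bounded c f \<longleftrightarrow> f \<in> O[strip_at_infinity](\<lambda>z. of_real (exp (c * \<bar>Im z\<bar>)))"

lemma eventually_strip_at_infinity: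
  "eventually P strip_at_infinity \<longleftrightarrow> (\<exists>y. \<forall>z. \<bar>Re z\<bar> \<le> 1/2 \<longrightarrow> y \<le> \<bar>Im z\<bar> \<longrightarrow> P z)"
proof -
  have "eventually P strip_at_infinity \<longleftrightarrow> (\<exists>Q. (\<exists>y. \<forall>t\<ge>y. Q t) \<and> (\<forall>z. Q \<bar>Im z\<bar> \<longrightarrow> \<bar>Re z\<bar> \<le> 1/2 \<longrightarrow> P z))"
    by (simp add: strip_at_infinity_def inf.commute[of "principal _"] eventually_inf_principal
        eventually_filtercomap eventually_at_top_linorder)
  also have "\<dots> \<longleftrightarrow> (\<exists>y. \<forall>z. \<bar>Re z\<bar> \<le> 1/2 \<longrightarrow> y \<le> \<bar>Im z\<bar> \<longrightarrow> P z)"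
    by (metis (no_types, lifting))
  finally show ?thesis .
qed

lemma strip_exp_boundedI:
  assumes "\<And>z. \<bar>Re z\<bar> \<le> 1/2 \<Longrightarrow> \<bar>Im z\<bar> \<ge> 1 \<Longrightarrow> norm (f z) \<le> C * exp (c * \<bar>Im z\<bar>)"
  shows "strip_exp_bounded c f"
  unfolding strip_exp_bounded_def
  by (rule bigoI[of _ C]) (use assms in \<open>auto simp: eventually_strip_at_infinity intro!: exI[of _ 1]\<close>)

lemma strip_exp_bounded_mono:
  "strip_exp_bounded c f \<Longrightarrow> c \<le> d \<Longrightarrow> strip_exp_bounded d f"
  unfolding strip_exp_bounded_def
  by (erule landau_o.big_trans, rule bigoI[of _ 1]) (auto intro!: always_eventually mult_right_mono)

lemma strip_exp_bounded_const: "strip_exp_bounded 0 (\<lambda>_. a)"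
  by (rule strip_exp_boundedI[where C = "norm a"]) simp

lemma strip_exp_bounded_add:
  "strip_exp_bounded c f \<Longrightarrow> strip_exp_bounded c g \<Longrightarrow> strip_exp_bounded c (\<lambda>z. f z + g z)"
  unfolding strip_exp_bounded_def by (rule sum_in_bigo)

lemma strip_exp_bounded_mult:
  assumes "strip_exp_bounded c f" "strip_exp_bounded d g" shows "strip_exp_bounded (c + d) (\<lambda>z. f z * g z)"
  using landau_o.big.mult[OF assms[unfolded strip_exp_bounded_def]]
  by (simp add: strip_exp_bounded_def distrib_right exp_add)

lemma strip_exp_bounded_power:
  assumes "strip_exp_bounded c f" shows "strip_exp_bounded (real n * c) (\<lambda>z. f z ^ n)"
  using landau_o.big_power[OF assms[unfolded strip_exp_bounded_def], of n]
  by (simp add: strip_exp_bounded_def exp_of_nat_mult[symmetric] mult.assoc flip: of_real_power)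

text \<open>A linear factor costs an arbitrarily small exponent, because t <= exp(e t) / e.\<close>

lemma strip_exp_bounded_linear:
  assumes "\<And>z. \<bar>Re z\<bar> \<le> 1/2 \<Longrightarrow> norm (f z) \<le> (1 + 2 * norm z) * B" "B \<ge> 0" "e > 0"
  shows "strip_exp_bounded e f"
proof (rule strip_exp_boundedI)
  fix z :: complex assume z: "\<bar>Re z\<bar> \<le> 1/2" "\<bar>Im z\<bar> \<ge> 1"
  have "e * \<bar>Im z\<bar> \<le> exp (e * \<bar>Im z\<bar>)" using exp_ge_add_one_self[of "e * \<bar>Im z\<bar>"] by linarith
  hence "4 * \<bar>Im z\<bar> \<le> 4 / e * exp (e * \<bar>Im z\<bar>)" using assms(3) by (simp add: field_simps)
  hence "1 + 2 * norm z \<le> 4 / e * exp (e * \<bar>Im z\<bar>)" using norm_strip_le[OF z(1)] z(2) by linarith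
  hence "(1 + 2 * norm z) * B \<le> 4 / e * exp (e * \<bar>Im z\<bar>) * B" using assms(2) by (rule mult_right_mono)
  thus "norm (f z) \<le> 4 / e * B * exp (e * \<bar>Im z\<bar>)" using assms(1)[OF z(1)] by (simp add: mult_ac)
qed

lemma strip_exp_bounded_exp_norm:
  assumes "\<And>z. norm (f z) \<le> exp (c * norm z) * B" "c \<ge> 0"
  shows "strip_exp_bounded c f"
proof (rule strip_exp_boundedI)
  fix z :: complex assume z: "\<bar>Re z\<bar> \<le> 1/2"
  have "B \<ge> 0" using order.trans[OF norm_ge_zero assms(1)[of 0]] by simp
  moreover have "exp (c * norm z) \<le> exp (c * (\<bar>Im z\<bar> + 1/2))"
    using mult_left_mono[OF norm_strip_le[OF z] assms(2)] by simp
  ultimately have "exp (c * norm z) * B \<le> exp (c * (\<bar>Im z\<bar> + 1/2)) * B" by (rule mult_right_mono[rotated])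
  thus "norm (f z) \<le> exp (c / 2) * B * exp (c * \<bar>Im z\<bar>)"
    using assms(1)[of z] by (simp add: distrib_left exp_add mult_ac)
qed

lemma strip_exp_bounded_id: "e > 0 \<Longrightarrow> strip_exp_bounded e (\<lambda>z. z)"
  by (rule strip_exp_bounded_linear[where B = 1]) auto

text \<open>On the compact part of the strip continuity gives a bound, so control at infinity is
  enough for \<open>periodic_strip_constant\<close>.\<close>

lemma periodic_strip_exp_bounded_constant:
  fixes f :: "complex \<Rightarrow> complex"
  assumes holo: "f holomorphic_on {z. \<bar>Re z\<bar> < 1}"
    and per: "\<And>z. -1 < Re z \<Longrightarrow> Re z < 0 \<Longrightarrow> f (z + 1) = f z"
    and bound: "strip_exp_bounded c f" and c: "0 \<le> c" "c < 2 * pi"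
    and z: "\<bar>Re z\<bar> < 1"
  shows "f z = f 0"
proof -
  obtain C y where C: "C > 0" "\<And>z. \<bar>Re z\<bar> \<le> 1/2 \<Longrightarrow> y \<le> \<bar>Im z\<bar> \<Longrightarrow> norm (f z) \<le> C * exp (c * \<bar>Im z\<bar>)"
    using bound unfolding strip_exp_bounded_def by (elim landau_o.bigE) (auto simp: eventually_strip_at_infinity)
  let ?K = "cbox (Complex (-1/2) (-\<bar>y\<bar>)) (Complex (1/2) \<bar>y\<bar>)"
  have "compact (f ` ?K)"
    by (intro compact_continuous_image continuous_on_subset[OF holomorphic_on_imp_continuous_on[OF holo]])
       (auto simp: in_cbox_complex_iff)
  then obtain M where M: "\<And>z. z \<in> ?K \<Longrightarrow> norm (f z) \<le> M"
    using compact_imp_bounded by (force simp: bounded_iff)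
  have "norm (f w) \<le> max M C * exp (c * \<bar>Im w\<bar>)" if w: "\<bar>Re w\<bar> \<le> 1/2" for w
  proof (cases "y \<le> \<bar>Im w\<bar>")
    case True
    have "C * exp (c * \<bar>Im w\<bar>) \<le> max M C * exp (c * \<bar>Im w\<bar>)" by (intro mult_right_mono) auto
    thus ?thesis using C(2)[OF w True] by linarith
  next
    case False
    have "norm (f w) \<le> M" using w False by (intro M) (auto simp: in_cbox_complex_iff)
    also have "M \<le> max M C * 1" by simp
    also have "\<dots> \<le> max M C * exp (c * \<bar>Im w\<bar>)" using C(1) c(1) by (intro mult_left_mono) auto
    finally show ?thesis .
  qed
  thus ?thesis using periodic_strip_constant[OF holo per _ c z] by blast
qed

section \<open>The generating function of \<open>\<zeta>(3,2,\<dots>,2)\<close>\<close>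

definition Qp :: "complex \<Rightarrow> nat \<Rightarrow> complex" where
  "Qp z n = (\<Prod>i=1..n. 1 - z\<^sup>2 / of_nat i ^ 2)"

lemma Qp_0 [simp]: "Qp z 0 = 1" by (simp add: Qp_def)

lemma Qp_Suc: "Qp z (Suc n) = Qp z n * (1 - z\<^sup>2 / of_nat (Suc n) ^ 2)"
  by (simp add: Qp_def)

lemma norm_Qp_le: "norm (Qp z n) \<le> exp (pi * norm z)"
proof -
  have "norm (Qp z n) \<le> (\<Prod>i=1..n. 1 + (norm z)\<^sup>2 / real i ^ 2)"
    unfolding Qp_def prod_norm[symmetric]
  proof (rule prod_mono, safe)
    fix i show "norm (1 - z\<^sup>2 / of_nat i ^ 2) \<le> 1 + (norm z)\<^sup>2 / real i ^ 2"
      using norm_triangle_ineq4[of 1 "z\<^sup>2 / of_nat i ^ 2"] by (simp add: norm_divide norm_power)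
  qed auto
  also have "\<dots> \<le> exp (pi * norm z)" by (rule prod_one_plus_sq_le) auto
  finally show ?thesis .
qed

lemma holomorphic_Qp [holomorphic_intros]: "(\<lambda>z. Qp z n) holomorphic_on A"
  unfolding Qp_def by (intro holomorphic_intros) auto

lemma Qp_LIMSEQ:
  fixes z :: complex
  shows "z \<noteq> 0 \<Longrightarrow> Qp z \<longlonglongrightarrow> sin (pi * z) / (pi * z)"
  using tendsto_divide[OF sin_product_formula_complex[of z] tendsto_const[of "of_real pi * z"]]
  by (simp add: Qp_def[abs_def])

text \<open>\<open>Qp z n\<close> is the product of (i - z)(i + z) / i^2. The shift moves the two
  families of factors in opposite directions, so only one factor at each end changes.\<close>

lemma Qp_shift:
  assumes "z + 1 \<noteq> 0" "\<And>k::nat. z \<noteq> of_nat k"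
  shows "Qp (z + 1) n * (of_nat n - z) * (z + 1) = Qp z n * (- z) * (z + of_nat n + 1)"
proof (induction n)
  case (Suc n)
  have nz: "of_nat n - z \<noteq> 0" using assms(2)[of n] by auto
  have n1: "(1 + of_nat n :: complex) \<noteq> 0" using of_nat_neq_0[of n] by (simp del: of_nat_Suc add: of_nat_Suc[symmetric])
  have IH: "Qp (z + 1) n = Qp z n * (- z) * (z + of_nat n + 1) / ((of_nat n - z) * (z + 1))"
    using Suc nz assms(1) by (subst nonzero_eq_divide_eq) (auto simp: mult.assoc)
  show ?case unfolding Qp_Suc IH using nz assms(1) n1
    by (simp add: divide_simps) (simp add: algebra_simps power2_eq_square power3_eq_cube)
qed auto

text \<open>The product stops strictly below the base k + 1 of the cube. Hence the coefficient of
  z^(2m) is, up to sign, zeta(3,2,...,2) with m twos and the largest index first.\<close>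

definition V0 :: "complex \<Rightarrow> complex" where
  "V0 z = (\<Sum>k. Qp z k / of_nat (Suc k) ^ 3)"

lemma summable_V0: "summable (\<lambda>k. Qp z k / of_nat (Suc k) ^ 3)"
  by (rule series_over_cubes(1)[OF norm_Qp_le _ holomorphic_Qp]) simp

lemma holomorphic_V0: "V0 holomorphic_on UNIV"
  unfolding V0_def[abs_def] by (rule series_over_cubes(2)[OF norm_Qp_le _ holomorphic_Qp]) simp

lemma norm_V0_le: "norm (V0 z) \<le> exp (pi * norm z) * (\<Sum>k. 1 / real (Suc k) ^ 3)"
  unfolding V0_def by (rule series_over_cubes(3)[OF norm_Qp_le _ holomorphic_Qp]) simp

text \<open>With the weights z^2 the combined summand telescopes in k. The sine comes from the limit
  of \<open>G\<close>, the rational terms from \<open>G 0\<close>; \<open>g0\<close> and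
  \<open>E0\<close> are made to solve the two parts separately.\<close>

lemma V0_shift:
  fixes z :: complex
  assumes z: "-1 < Re z" "Re z < 0"
  shows "- (z + 1)\<^sup>2 * V0 (z + 1) + z\<^sup>2 * V0 z =
           sin (pi * z) / pi * (1 / z\<^sup>2 - 1 / (z + 1)\<^sup>2) - 1 / z - 1 / (z + 1)"
proof -
  have z0: "z \<noteq> 0" and z1: "z + 1 \<noteq> 0" using z by (auto simp: complex_eq_iff)
  have zn: "z \<noteq> of_nat k" for k :: nat using z by (auto simp: complex_eq_iff)
  have nzk: "of_nat k - z \<noteq> 0" for k :: nat using zn[of k] by auto
  have k1: "(1 + of_nat k :: complex) \<noteq> 0" for k
    using of_nat_neq_0[of k] by (simp del: of_nat_Suc add: of_nat_Suc[symmetric])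
  \<comment> \<open>\<open>G\<close> is a Gosper antidifference of the combined summand; \<open>\<alpha>\<close> and \<open>\<beta>\<close> come from an ansatz with a simple pole at \<open>k = z\<close>.\<close>
  define \<alpha> where "\<alpha> = - z * (2 * z + 1) / (1 + z)\<^sup>2"
  define \<beta> where "\<beta> = (2 * z + 1) / (z * (1 + z)\<^sup>2)"
  define G where "G = (\<lambda>k::nat. Qp z k * (\<alpha> / (of_nat k - z) + \<beta>))"
  have step: "- (z + 1)\<^sup>2 * (Qp (z + 1) k / of_nat (Suc k) ^ 3) + z\<^sup>2 * (Qp z k / of_nat (Suc k) ^ 3) = G (Suc k) - G k" for k
  proof -
    have Q1: "Qp (z + 1) k = Qp z k * (- z) * (z + of_nat k + 1) / ((of_nat k - z) * (z + 1))"
      using Qp_shift[OF z1 zn, of k] nzk[of k] z1 by (subst nonzero_eq_divide_eq) (auto simp: mult.assoc)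
    have nz': "1 + of_nat k - z \<noteq> 0" using nzk[of "Suc k"] by simp
    have zz1: "1 + z \<noteq> 0" using z1 by (simp add: add.commute)
    define q where "q = Qp z k"
    define n where "n = (of_nat k :: complex)"
    have nn: "n - z \<noteq> 0" "1 + n - z \<noteq> 0" "1 + n \<noteq> 0" using nzk[of k] nz' k1[of k] by (auto simp: n_def)
    have "- (z + 1)\<^sup>2 * (q * (- z) * (z + n + 1) / ((n - z) * (z + 1)) / (1 + n) ^ 3) + z\<^sup>2 * (q / (1 + n) ^ 3) =
       q * z * (2 * z + 1) / ((1 + n)\<^sup>2 * (n - z))"
      using nn z1 by (simp add: divide_simps) (simp add: algebra_simps power2_eq_square power3_eq_cube)
    also have "\<dots> = q * (1 - z\<^sup>2 / (1 + n)\<^sup>2) * (\<alpha> / (1 + n - z) + \<beta>) - q * (\<alpha> / (n - z) + \<beta>)"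
      unfolding \<alpha>_def \<beta>_def using nn zz1 z0 by (simp add: divide_simps) (simp add: algebra_simps power2_eq_square power3_eq_cube)
    finally show ?thesis by (simp add: G_def Q1 Qp_Suc q_def n_def)
  qed
  have lim: "G \<longlonglongrightarrow> sin (pi * z) / (pi * z) * (0 + \<beta>)"
    unfolding G_def
  proof (intro tendsto_intros Qp_LIMSEQ z0)
    have "filterlim (\<lambda>k. of_nat k - z) at_infinity sequentially"
      using tendsto_add_filterlim_at_infinity'[OF tendsto_of_nat tendsto_const[of "-z"]] by simp
    thus "(\<lambda>k. \<alpha> / (of_nat k - z)) \<longlonglongrightarrow> 0"
      by (rule tendsto_divide_0[OF tendsto_const])
  qed
  have "(\<lambda>k. - (z + 1)\<^sup>2 * (Qp (z + 1) k / of_nat (Suc k) ^ 3) + z\<^sup>2 * (Qp z k / of_nat (Suc k) ^ 3))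
          sums (- (z + 1)\<^sup>2 * V0 (z + 1) + z\<^sup>2 * V0 z)"
    unfolding V0_def by (intro sums_add sums_mult summable_sums summable_V0)
  moreover have "(\<lambda>k. - (z + 1)\<^sup>2 * (Qp (z + 1) k / of_nat (Suc k) ^ 3) + z\<^sup>2 * (Qp z k / of_nat (Suc k) ^ 3))
          sums (sin (pi * z) / (pi * z) * (0 + \<beta>) - G 0)"
    using telescope_sums[OF lim] by (simp only: step)
  ultimately have "- (z + 1)\<^sup>2 * V0 (z + 1) + z\<^sup>2 * V0 z = sin (pi * z) / (pi * z) * (0 + \<beta>) - G 0"
    by (rule sums_unique2)
  also have "\<dots> = sin (pi * z) / pi * (1 / z\<^sup>2 - 1 / (z + 1)\<^sup>2) - 1 / z - 1 / (z + 1)"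
  proof -
    have "1 + z \<noteq> 0" using z1 by (simp add: add.commute)
    thus ?thesis using z0 z1 unfolding \<beta>_def \<alpha>_def G_def
      by (simp add: divide_simps) (simp add: algebra_simps power2_eq_square power3_eq_cube)
  qed
  finally show ?thesis .
qed

section \<open>Partial fraction series solving the shift equation of \<open>V0\<close>\<close>

lemma norm_sq_diff_ge:
  fixes z :: complex
  assumes "2 * \<bar>Re z\<bar> \<le> real n"
  shows "real n ^ 2 / 4 \<le> norm (of_nat n ^ 2 - z\<^sup>2)"
proof -
  have a: "real n / 2 \<le> norm (of_nat n - z)"
    using complex_Re_le_cmod[of "of_nat n - z"] assms by simp
  have b: "real n / 2 \<le> norm (of_nat n + z)"
    using complex_Re_le_cmod[of "of_nat n + z"] assms by simp
  have "(real n / 2) * (real n / 2) \<le> norm (of_nat n - z) * norm (of_nat n + z)"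
    using a b by (intro mult_mono) auto
  also have "\<dots> = norm (of_nat n ^ 2 - z\<^sup>2)"
    by (simp add: norm_mult[symmetric] power2_eq_square algebra_simps)
  finally show ?thesis by (simp add: power2_eq_square)
qed

text \<open>Since 2 z^2 / (n (n^2 - z^2)) = 1/(n-z) + 1/(n+z) - 2/n, the function z^2 E0(z) is minus
  psi(1+z) + psi(1-z) + 2 gamma, with psi the digamma function.\<close>

definition E0 :: "complex \<Rightarrow> complex" where
  "E0 z = (\<Sum>k. 2 / (of_nat (Suc k) * (of_nat (Suc k) ^ 2 - z\<^sup>2)))"

text \<open>Here 4 z n / (n^2 - z^2)^2 = 1/(n-z)^2 - 1/(n+z)^2. The alternating sign makes z g0(z)
  change sign under the shift, up to elementary terms, just as sin(pi z) does.\<close>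

definition g0 :: "complex \<Rightarrow> complex" where
  "g0 z = (\<Sum>k. (-1) ^ k * of_nat (Suc k) / (of_nat (Suc k) ^ 2 - z\<^sup>2) ^ 2)"

lemma norm_E0_term:
  assumes "2 * \<bar>Re z\<bar> \<le> real (Suc k)"
  shows "norm (2 / (of_nat (Suc k) * (of_nat (Suc k) ^ 2 - z\<^sup>2))) \<le> 8 * (1 / real (Suc k) ^ 3)"
proof -
  define n where "n = Suc k"
  have n: "n > 0" by (simp add: n_def)
  have ge: "real n ^ 2 / 4 \<le> norm (of_nat n ^ 2 - z\<^sup>2)"
    using norm_sq_diff_ge[of z n] assms by (simp add: n_def)
  have "norm (2 / (of_nat n * (of_nat n ^ 2 - z\<^sup>2))) = 2 / (real n * norm (of_nat n ^ 2 - z\<^sup>2))"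
    by (simp add: norm_divide norm_mult)
  also have "\<dots> \<le> 2 / (real n * (real n ^ 2 / 4))"
    using ge n by (intro divide_left_mono mult_left_mono mult_pos_pos) (auto intro: order.strict_trans2[OF _ ge])
  also have "\<dots> = 8 * (1 / real n ^ 3)" by (simp add: power3_eq_cube power2_eq_square)
  finally show ?thesis unfolding n_def .
qed

lemma norm_g0_term:
  assumes "2 * \<bar>Re z\<bar> \<le> real (Suc k)"
  shows "norm ((-1) ^ k * of_nat (Suc k) / (of_nat (Suc k) ^ 2 - z\<^sup>2) ^ 2) \<le> 16 * (1 / real (Suc k) ^ 3)"
proof -
  define n where "n = Suc k"
  have n: "n > 0" by (simp add: n_def)
  have ge: "real n ^ 2 / 4 \<le> norm (of_nat n ^ 2 - z\<^sup>2)"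
    using norm_sq_diff_ge[of z n] assms by (simp add: n_def)
  have "norm ((-1) ^ k * of_nat n / (of_nat n ^ 2 - z\<^sup>2) ^ 2) = real n / norm (of_nat n ^ 2 - z\<^sup>2) ^ 2"
    by (simp add: norm_divide norm_mult norm_power)
  also have "\<dots> \<le> real n / (real n ^ 2 / 4) ^ 2"
    using ge n by (intro divide_left_mono power_mono mult_pos_pos zero_less_power) (auto intro: order.strict_trans2[OF _ ge])
  also have "\<dots> = 16 * (1 / real n ^ 3)" using n by (simp add: power3_eq_cube power2_eq_square)
  finally show ?thesis unfolding n_def .
qed

lemma two_abs_Re_le_Suc: "\<bar>Re z\<bar> < 1 \<Longrightarrow> k \<ge> 1 \<Longrightarrow> 2 * \<bar>Re z\<bar> \<le> real (Suc k)"
  by linarith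

lemma strip_nz:
  assumes "\<bar>Re z\<bar> < 1" shows "of_nat (Suc k) ^ 2 - z\<^sup>2 \<noteq> 0"
proof
  assume "of_nat (Suc k) ^ 2 - z\<^sup>2 = 0"
  hence "(of_nat (Suc k) - z) * (of_nat (Suc k) + z) = 0" by (simp add: power2_eq_square algebra_simps)
  hence "z = of_nat (Suc k) \<or> z = - of_nat (Suc k)"
    by (auto simp: add_eq_0_iff2 simp del: of_nat_Suc)
  thus False using assms by auto
qed

lemma summable_E0: "\<bar>Re z\<bar> < 1 \<Longrightarrow> summable (\<lambda>k. 2 / (of_nat (Suc k) * (of_nat (Suc k) ^ 2 - z\<^sup>2)))"
  by (rule summable_comparison_test'[OF summable_mult[OF summable_inverse_power_Suc[of 3]] norm_E0_term[OF two_abs_Re_le_Suc], where N = 1])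
     auto

lemma summable_g0: "\<bar>Re z\<bar> < 1 \<Longrightarrow> summable (\<lambda>k. (-1) ^ k * of_nat (Suc k) / (of_nat (Suc k) ^ 2 - z\<^sup>2) ^ 2)"
  by (rule summable_comparison_test'[OF summable_mult[OF summable_inverse_power_Suc[of 3]] norm_g0_term[OF two_abs_Re_le_Suc], where N = 1])
     auto

lemma holomorphic_E0: "E0 holomorphic_on {z. \<bar>Re z\<bar> < 1}"
  unfolding E0_def[abs_def]
proof (rule holomorphic_on_suminf[OF open_strip])
  show "(\<lambda>z. 2 / (of_nat (Suc n) * (of_nat (Suc n) ^ 2 - z\<^sup>2))) holomorphic_on {z. \<bar>Re z\<bar> < 1}" for n
    using strip_nz by (intro holomorphic_intros) (auto simp del: of_nat_Suc)
  show "\<exists>M N. summable M \<and> (\<forall>n\<ge>N. \<forall>z\<in>{z. \<bar>Re z\<bar> < 1}. norm z < R \<longrightarrow>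
          norm (2 / (of_nat (Suc n) * (of_nat (Suc n) ^ 2 - z\<^sup>2))) \<le> M n)" for R
    by (intro exI[of _ "\<lambda>k. 8 * (1 / real (Suc k) ^ 3)"] exI[of _ 1] conjI allI impI ballI
          norm_E0_term two_abs_Re_le_Suc summable_mult summable_inverse_power_Suc) auto
qed

lemma holomorphic_g0: "g0 holomorphic_on {z. \<bar>Re z\<bar> < 1}"
  unfolding g0_def[abs_def]
proof (rule holomorphic_on_suminf[OF open_strip])
  show "(\<lambda>z. (-1) ^ n * of_nat (Suc n) / (of_nat (Suc n) ^ 2 - z\<^sup>2) ^ 2) holomorphic_on {z. \<bar>Re z\<bar> < 1}" for n
    using strip_nz by (intro holomorphic_intros) (auto simp del: of_nat_Suc)
  show "\<exists>M N. summable M \<and> (\<forall>n\<ge>N. \<forall>z\<in>{z. \<bar>Re z\<bar> < 1}. norm z < R \<longrightarrow>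
          norm ((-1) ^ n * of_nat (Suc n) / (of_nat (Suc n) ^ 2 - z\<^sup>2) ^ 2) \<le> M n)" for R
    by (intro exI[of _ "\<lambda>k. 16 * (1 / real (Suc k) ^ 3)"] exI[of _ 1] conjI allI impI ballI
          norm_g0_term two_abs_Re_le_Suc summable_mult summable_inverse_power_Suc) auto
qed

lemma tendsto_inverse_of_nat_add: "(\<lambda>k. 1 / (of_nat k + c :: complex)) \<longlonglongrightarrow> 0"
proof -
  have "filterlim (\<lambda>k. of_nat k + c) at_infinity sequentially"
    by (rule tendsto_add_filterlim_at_infinity'[OF tendsto_of_nat tendsto_const])
  thus ?thesis by (rule tendsto_divide_0[OF tendsto_const])
qed

lemma strip_add_of_nat_nz:
  assumes z: "-1 < Re z" "Re z < 0"
  shows "of_nat k + z \<noteq> 0" "- of_nat k + z \<noteq> 0"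
proof -
  have "Re (- of_nat k + z) < 0" "Re (of_nat k + z) \<noteq> 0" using z by (cases k; simp)+
  thus "of_nat k + z \<noteq> 0" "- of_nat k + z \<noteq> 0" by (metis less_irrefl zero_complex.sel(1))+
qed

text \<open>The shift moves the poles at n and at -n by one step, in opposite directions of n, so
  one boundary term of each family survives.\<close>

lemma E0_shift:
  fixes z :: complex
  assumes z: "-1 < Re z" "Re z < 0"
  shows "(z + 1)\<^sup>2 * E0 (z + 1) - z\<^sup>2 * E0 z = - 1 / z - 1 / (z + 1)"
proof -
  define F where "F = (\<lambda>k::nat. 1 / (of_nat k + (1 + z)) + 1 / (- of_nat k + z))"
  note zn = strip_add_of_nat_nz[OF z]
  have "F \<longlonglongrightarrow> 0 + (- 0)"
  proof -
    have "(\<lambda>k. - (1 / (of_nat k + (- z)))) \<longlonglongrightarrow> - 0"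
      by (intro tendsto_minus tendsto_inverse_of_nat_add)
    also have "(\<lambda>k. - (1 / (of_nat k + (- z)))) = (\<lambda>k. 1 / (- of_nat k + z))"
      by (auto simp: divide_simps)
    finally show ?thesis unfolding F_def by (intro tendsto_add tendsto_inverse_of_nat_add)
  qed
  from telescope_sums[OF this] have "(\<lambda>k. F (Suc k) - F k) sums (- F 0)" by simp
  also have "(\<lambda>k. F (Suc k) - F k) = (\<lambda>k. (z + 1)\<^sup>2 * (2 / (of_nat (Suc k) * (of_nat (Suc k) ^ 2 - (z + 1)\<^sup>2)))
                 - z\<^sup>2 * (2 / (of_nat (Suc k) * (of_nat (Suc k) ^ 2 - z\<^sup>2))))"
  proof
    fix k :: nat
    define n where "n = (of_nat k :: complex)"
    have nz: "n - z \<noteq> 0" "n + z + 2 \<noteq> 0" "n + 1 - z \<noteq> 0" "n + 1 + z \<noteq> 0" "n + 1 \<noteq> 0"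
      using zn[of k] zn[of "Suc k"] zn[of "Suc (Suc k)"] of_nat_neq_0[of k]
      by (auto simp: n_def algebra_simps)
    have e1: "(n + 1)\<^sup>2 - (z + 1)\<^sup>2 = (n - z) * (n + z + 2)"
     and e2: "(n + 1)\<^sup>2 - z\<^sup>2 = (n + 1 - z) * (n + 1 + z)"
      by (simp_all add: power2_eq_square algebra_simps)
    have A1: "(z + 1)\<^sup>2 * (2 / ((n + 1) * ((n + 1)\<^sup>2 - (z + 1)\<^sup>2))) = 1 / (n - z) + 1 / (n + z + 2) - 2 / (n + 1)"
      unfolding e1 using nz by (simp add: divide_simps) (simp add: power2_eq_square algebra_simps)
    have A2: "z\<^sup>2 * (2 / ((n + 1) * ((n + 1)\<^sup>2 - z\<^sup>2))) = 1 / (n + 1 - z) + 1 / (n + 1 + z) - 2 / (n + 1)"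
      unfolding e2 using nz by (simp add: divide_simps) (simp add: power2_eq_square algebra_simps)
    have neg: "1 / (- a + b) = - (1 / (a - b))" for a b :: complex
      by (metis minus_diff_eq minus_divide_right uminus_add_conv_diff)
    have nn: "of_nat (Suc k) = n + 1" by (simp add: n_def)
    have s: "n + 1 + (1 + z) = n + z + 2" "n + (1 + z) = n + 1 + z" by simp_all
    show "F (Suc k) - F k = (z + 1)\<^sup>2 * (2 / (of_nat (Suc k) * (of_nat (Suc k) ^ 2 - (z + 1)\<^sup>2)))
                 - z\<^sup>2 * (2 / (of_nat (Suc k) * (of_nat (Suc k) ^ 2 - z\<^sup>2)))"
      unfolding F_def nn A1 A2 neg n_def[symmetric] s by simp
  qed
  finally have 1: "\<dots> sums (- F 0)" .
  have "(\<lambda>k. (z + 1)\<^sup>2 * (2 / (of_nat (Suc k) * (of_nat (Suc k) ^ 2 - (z + 1)\<^sup>2)))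
                 - z\<^sup>2 * (2 / (of_nat (Suc k) * (of_nat (Suc k) ^ 2 - z\<^sup>2)))) sums
         ((z + 1)\<^sup>2 * E0 (z + 1) - z\<^sup>2 * E0 z)"
    unfolding E0_def using z by (intro sums_diff sums_mult summable_sums summable_E0) auto
  from sums_unique2[OF this 1] show ?thesis by (simp add: F_def add.commute)
qed

lemma g0_shift:
  fixes z :: complex
  assumes z: "-1 < Re z" "Re z < 0"
  shows "- 4 * (z + 1) * g0 (z + 1) - 4 * z * g0 z = 1 / (z + 1)\<^sup>2 - 1 / z\<^sup>2"
proof -
  define F where "F = (\<lambda>k::nat. (-1) ^ k * (1 / (of_nat k + (- z)) ^ 2 - 1 / (of_nat k + (1 + z)) ^ 2))"
  note zn = strip_add_of_nat_nz[OF z]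
  have "F \<longlonglongrightarrow> 0"
  proof (rule Lim_null_comparison[OF always_eventually])
    show "\<forall>k. norm (F k) \<le> norm ((1 / (of_nat k + (- z))) ^ 2 - (1 / (of_nat k + (1 + z))) ^ 2)"
      by (simp add: F_def norm_mult norm_power power_divide)
    have "(\<lambda>k. norm ((1 / (of_nat k + (- z))) ^ 2 - (1 / (of_nat k + (1 + z))) ^ 2)) \<longlonglongrightarrow> norm (0 ^ 2 - (0::complex) ^ 2)"
      by (intro tendsto_norm tendsto_diff tendsto_power tendsto_inverse_of_nat_add)
    thus "(\<lambda>k. norm ((1 / (of_nat k + (- z))) ^ 2 - (1 / (of_nat k + (1 + z))) ^ 2)) \<longlonglongrightarrow> 0" by simp
  qed
  from telescope_sums[OF this] have "(\<lambda>k. F (Suc k) - F k) sums (- F 0)" by simp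
  also have "(\<lambda>k. F (Suc k) - F k) = (\<lambda>k. - 4 * (z + 1) * ((-1) ^ k * of_nat (Suc k) / (of_nat (Suc k) ^ 2 - (z + 1)\<^sup>2) ^ 2)
                 - 4 * z * ((-1) ^ k * of_nat (Suc k) / (of_nat (Suc k) ^ 2 - z\<^sup>2) ^ 2))"
  proof
    fix k :: nat
    define n where "n = (of_nat k :: complex)"
    have nz: "n - z \<noteq> 0" "n + z + 2 \<noteq> 0" "n + 1 - z \<noteq> 0" "n + 1 + z \<noteq> 0"
      using zn[of k] zn[of "Suc k"] zn[of "Suc (Suc k)"]
      by (auto simp: n_def algebra_simps)
    have e1: "(n + 1)\<^sup>2 - (z + 1)\<^sup>2 = (n - z) * (n + z + 2)"
     and e2: "(n + 1)\<^sup>2 - z\<^sup>2 = (n + 1 - z) * (n + 1 + z)"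
      by (simp_all add: power2_eq_square algebra_simps)
    have 1: "- 4 * (z + 1) * ((n + 1) / ((n + 1)\<^sup>2 - (z + 1)\<^sup>2) ^ 2) = 1 / (n + z + 2)\<^sup>2 - 1 / (n - z)\<^sup>2"
      unfolding e1 using nz by (simp add: divide_simps) (simp add: power2_eq_square algebra_simps)
    have 2: "- 4 * z * ((n + 1) / ((n + 1)\<^sup>2 - z\<^sup>2) ^ 2) = 1 / (n + 1 + z)\<^sup>2 - 1 / (n + 1 - z)\<^sup>2"
      unfolding e2 using nz by (simp add: divide_simps) (simp add: power2_eq_square algebra_simps)
    have "- 4 * (z + 1) * ((-1) ^ k * (n + 1) / ((n + 1)\<^sup>2 - (z + 1)\<^sup>2) ^ 2) - 4 * z * ((-1) ^ k * (n + 1) / ((n + 1)\<^sup>2 - z\<^sup>2) ^ 2)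
       = (-1) ^ k * ((- 4 * (z + 1) * ((n + 1) / ((n + 1)\<^sup>2 - (z + 1)\<^sup>2) ^ 2)) + (- 4 * z * ((n + 1) / ((n + 1)\<^sup>2 - z\<^sup>2) ^ 2)))"
      by (simp add: divide_inverse algebra_simps)
    also have "\<dots> = (-1) ^ k * (1 / (n + z + 2)\<^sup>2 - 1 / (n - z)\<^sup>2 + (1 / (n + 1 + z)\<^sup>2 - 1 / (n + 1 - z)\<^sup>2))"
      unfolding 1 2 ..
    finally show "F (Suc k) - F k = - 4 * (z + 1) * ((-1) ^ k * of_nat (Suc k) / (of_nat (Suc k) ^ 2 - (z + 1)\<^sup>2) ^ 2)
                 - 4 * z * ((-1) ^ k * of_nat (Suc k) / (of_nat (Suc k) ^ 2 - z\<^sup>2) ^ 2)"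
      by (simp add: F_def n_def algebra_simps)
  qed
  finally have 1: "\<dots> sums (- F 0)" .
  have "(\<lambda>k. - 4 * (z + 1) * ((-1) ^ k * of_nat (Suc k) / (of_nat (Suc k) ^ 2 - (z + 1)\<^sup>2) ^ 2)
                 - 4 * z * ((-1) ^ k * of_nat (Suc k) / (of_nat (Suc k) ^ 2 - z\<^sup>2) ^ 2)) sums
         (- 4 * (z + 1) * g0 (z + 1) - 4 * z * g0 z)"
    unfolding g0_def using z by (intro sums_diff sums_mult summable_sums summable_g0) auto
  from sums_unique2[OF this 1] show ?thesis by (simp add: F_def add.commute)
qed

text \<open>By the three shift lemmas \<open>D\<close> has period 1. Its exponent 2 + pi, with 2
  paying for z^2, is below 2 pi, so \<open>D\<close> equals its value 0 at the origin.\<close>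

lemma V0_eq:
  fixes z :: complex
  assumes z: "\<bar>Re z\<bar> < 1"
  shows "z\<^sup>2 * V0 z = 4 * z * sin (pi * z) / pi * g0 z - z\<^sup>2 * E0 z"
proof -
  define D where "D = (\<lambda>z::complex. z\<^sup>2 * V0 z + z\<^sup>2 * E0 z + sin (pi * z) / pi * (- 4 * z * g0 z))"
  define K where "K = (\<Sum>k. 1 / real (Suc k) ^ 3)"
  have K: "K \<ge> 0" unfolding K_def by (intro suminf_nonneg summable_inverse_power_Suc) auto
  have "D z = D 0"
  proof (rule periodic_strip_exp_bounded_constant[where c = "2 + pi"])
    show "D holomorphic_on {z. \<bar>Re z\<bar> < 1}" unfolding D_def
      by (intro holomorphic_intros holomorphic_on_subset[OF holomorphic_V0] holomorphic_E0 holomorphic_g0) auto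
    show "D (z + 1) = D z" if "-1 < Re z" "Re z < 0" for z
    proof -
      have s: "sin (pi * (z + 1)) = - sin (pi * z)"
        by (simp add: distrib_left sin_add cos_of_real[of pi] sin_of_real[of pi])
      have "D (z + 1) - D z = - (- (z + 1)\<^sup>2 * V0 (z + 1) + z\<^sup>2 * V0 z) + ((z + 1)\<^sup>2 * E0 (z + 1) - z\<^sup>2 * E0 z)
            - sin (pi * z) / pi * (- 4 * (z + 1) * g0 (z + 1) - 4 * z * g0 z)"
        unfolding D_def s by (simp add: algebra_simps)
      also have "\<dots> = 0" unfolding V0_shift[OF that] E0_shift[OF that] g0_shift[OF that]
        by (simp add: algebra_simps)
      finally show ?thesis by simp
    qed
    have ww: "2 * \<bar>Re w\<bar> \<le> real (Suc k)" if "\<bar>Re w\<bar> \<le> 1/2" for w k using that by simp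
    have sm: "suminf (\<lambda>k. C * (1 / real (Suc k) ^ 3)) = C * K" for C
      unfolding K_def by (rule suminf_mult) (auto intro!: summable_inverse_power_Suc simp del: of_nat_Suc)
    have "strip_exp_bounded 0 E0"
    proof (rule strip_exp_boundedI)
      fix w :: complex assume w: "\<bar>Re w\<bar> \<le> 1/2"
      have "norm (E0 w) \<le> (\<Sum>k. 8 * (1 / real (Suc k) ^ 3))"
        unfolding E0_def by (intro norm_suminf_le norm_E0_term ww w summable_mult summable_inverse_power_Suc) auto
      thus "norm (E0 w) \<le> 8 * K * exp (0 * \<bar>Im w\<bar>)" unfolding sm by simp
    qed
    hence E: "strip_exp_bounded pi E0" by (rule strip_exp_bounded_mono) simp
    have g: "strip_exp_bounded 0 g0"
    proof (rule strip_exp_boundedI)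
      fix w :: complex assume w: "\<bar>Re w\<bar> \<le> 1/2"
      have "norm (g0 w) \<le> (\<Sum>k. 16 * (1 / real (Suc k) ^ 3))"
        unfolding g0_def by (intro norm_suminf_le norm_g0_term ww w summable_mult summable_inverse_power_Suc) auto
      thus "norm (g0 w) \<le> 16 * K * exp (0 * \<bar>Im w\<bar>)" unfolding sm by simp
    qed
    have V: "strip_exp_bounded pi V0"
      by (rule strip_exp_bounded_exp_norm[OF norm_V0_le]) simp
    have s: "strip_exp_bounded pi (\<lambda>w. sin (of_real pi * w))"
    proof (rule strip_exp_boundedI)
      fix w :: complex show "norm (sin (of_real pi * w)) \<le> 1 * exp (pi * \<bar>Im w\<bar>)"
        using norm_sin_le[of "of_real pi * w"] by (simp add: abs_mult)
    qed
    note id = strip_exp_bounded_id[of 1, simplified]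
    have sq: "strip_exp_bounded 2 (\<lambda>w. w\<^sup>2)" using strip_exp_bounded_power[OF id, of 2] by simp
    have "strip_exp_bounded (2 + pi) (\<lambda>w. - 4 / of_real pi * w * (sin (of_real pi * w) * g0 w))"
      using strip_exp_bounded_mult[OF strip_exp_bounded_mult[OF strip_exp_bounded_const id] strip_exp_bounded_mult[OF s g]]
      by (rule strip_exp_bounded_mono) simp
    hence "strip_exp_bounded (2 + pi) (\<lambda>w. w\<^sup>2 * V0 w + w\<^sup>2 * E0 w + - 4 / of_real pi * w * (sin (of_real pi * w) * g0 w))"
      by (rule strip_exp_bounded_add[OF strip_exp_bounded_add[OF strip_exp_bounded_mult[OF sq V] strip_exp_bounded_mult[OF sq E]]])
    also have "(\<lambda>w. w\<^sup>2 * V0 w + w\<^sup>2 * E0 w + - 4 / of_real pi * w * (sin (of_real pi * w) * g0 w)) = D"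
      by (simp add: D_def fun_eq_iff)
    finally show "strip_exp_bounded (2 + pi) D" .
  qed (use z pi_gt3 in auto)
  also have "D 0 = 0" by (simp add: D_def)
  finally show ?thesis by (simp add: D_def algebra_simps)
qed

section \<open>A difference equation for the sum of \<open>f7\<close>\<close>

definition Pp :: "complex \<Rightarrow> nat \<Rightarrow> complex" where
  "Pp a n = (\<Prod>i=1..n. (1 - a / of_nat i) ^ 2 * (1 + 2 * a / of_nat i))"

lemma Pp_0 [simp]: "Pp a 0 = 1" by (simp add: Pp_def)

lemma Pp_Suc: "Pp a (Suc n) = Pp a n * ((1 - a / of_nat (Suc n)) ^ 2 * (1 + 2 * a / of_nat (Suc n)))"
  by (simp add: Pp_def)

text \<open>The linear terms cancel. This gives convergence of the product and makes 2 and 3 the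
  only arguments in the expansion of \<open>V\<close>.\<close>

lemma Pp_factor: "(1 - a / of_nat i) ^ 2 * (1 + 2 * a / of_nat i) = 1 - 3 * a\<^sup>2 / of_nat i ^ 2 + 2 * a ^ 3 / of_nat i ^ 3"
  for a :: complex
  by (cases "i = 0") (simp_all add: field_simps power2_eq_square power3_eq_cube)

text \<open>By 2 t^3 <= t^2 + t^4 each factor is at most the square of 1 + (3t/2)^2, so the sinh
  product at 3r/2 applies twice. The resulting type 3 pi stays below 4 pi, the most that the squared
  cosecant can compensate.\<close>

lemma norm_Pp_le: "norm (Pp a n) \<le> exp (3 * pi * norm a)"
proof -
  define r where "r = norm a"
  have r: "r \<ge> 0" by (simp add: r_def)
  have "norm (Pp a n) \<le> (\<Prod>i=1..n. (1 + (3/2 * r)\<^sup>2 / real i ^ 2) ^ 2)"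
    unfolding Pp_def prod_norm[symmetric]
  proof (rule prod_mono, safe)
    fix i assume i: "i \<in> {1..n}"
    define t where "t = r / real i"
    have t: "t \<ge> 0" using r by (simp add: t_def)
    have "norm (1 - 3 * a\<^sup>2 / of_nat i ^ 2 + 2 * a ^ 3 / of_nat i ^ 3) \<le>
            norm (1 - 3 * a\<^sup>2 / of_nat i ^ 2) + norm (2 * a ^ 3 / of_nat i ^ 3)"
      by (rule norm_triangle_ineq)
    also have "\<dots> \<le> norm (1::complex) + norm (3 * a\<^sup>2 / of_nat i ^ 2) + norm (2 * a ^ 3 / of_nat i ^ 3)"
      by (intro add_right_mono norm_triangle_ineq4)
    also have "\<dots> = 1 + 3 * t\<^sup>2 + 2 * t ^ 3"
      by (simp add: norm_divide norm_mult norm_power t_def r_def power_divide)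
    also have "\<dots> \<le> 1 + 4 * t\<^sup>2 + t ^ 4"
      using zero_le_power2[of "t * (t - 1)"] by (simp add: power2_eq_square power3_eq_cube power4_eq_xxxx algebra_simps)
    also have "\<dots> \<le> (1 + (3/2 * t)\<^sup>2) ^ 2"
    proof -
      have "(1 + (3/2 * t)\<^sup>2) ^ 2 - (1 + 4 * t\<^sup>2 + t ^ 4) = t\<^sup>2 / 2 + 65 / 16 * t ^ 4"
        by (simp add: power2_eq_square power4_eq_xxxx field_simps)
      moreover have "t\<^sup>2 \<ge> 0" "t ^ 4 \<ge> 0" using t by auto
      ultimately show ?thesis by linarith
    qed
    finally show "norm ((1 - a / of_nat i) ^ 2 * (1 + 2 * a / of_nat i)) \<le> (1 + (3/2 * r)\<^sup>2 / real i ^ 2) ^ 2"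
      unfolding Pp_factor by (simp add: t_def power_divide power_mult_distrib)
  qed auto
  also have "\<dots> = (\<Prod>i=1..n. 1 + (3/2 * r)\<^sup>2 / real i ^ 2) ^ 2" by (rule prod_power_distrib[symmetric])
  also have "\<dots> \<le> exp (pi * (3/2 * r)) ^ 2"
    using r by (intro power_mono prod_one_plus_sq_le prod_nonneg) auto
  also have "\<dots> = exp (3 * pi * norm a)" by (simp add: exp_double[symmetric] r_def)
  finally show ?thesis .
qed

lemma holomorphic_Pp [holomorphic_intros]: "(\<lambda>a. Pp a n) holomorphic_on A"
  unfolding Pp_def by (intro holomorphic_intros) auto

definition V :: "complex \<Rightarrow> complex" where
  "V a = (\<Sum>k. Pp a k / of_nat (Suc k) ^ 3)"

lemma summable_V: "summable (\<lambda>k. Pp a k / of_nat (Suc k) ^ 3)"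
  by (rule series_over_cubes(1)[OF norm_Pp_le _ holomorphic_Pp]) simp

lemma holomorphic_V: "V holomorphic_on UNIV"
  unfolding V_def[abs_def] by (rule series_over_cubes(2)[OF norm_Pp_le _ holomorphic_Pp]) simp

lemma norm_V_le: "norm (V a) \<le> exp (3 * pi * norm a) * (\<Sum>k. 1 / real (Suc k) ^ 3)"
  unfolding V_def by (rule series_over_cubes(3)[OF norm_Pp_le _ holomorphic_Pp]) simp

text \<open>Interpolates the inverse central binomial coefficients. With \<open>rGamma\<close> the denominator is entire, so no
  poles of \<open>\<Gamma>(1+2a)\<close> have to be excluded.\<close>

definition bq :: "complex \<Rightarrow> complex" where
  "bq a = Gamma (1 + a) ^ 2 * rGamma (1 + 2 * a)"

lemma Re_pos_not_nonpos_Int: "Re z > 0 \<Longrightarrow> z \<notin> \<int>\<^sub>\<le>\<^sub>0"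
  by (auto elim!: nonpos_Ints_cases)

lemma strip_not_nonpos_Int:
  assumes "\<bar>Re a\<bar> < 1" shows "1 + a \<notin> \<int>\<^sub>\<le>\<^sub>0" "1 - a \<notin> \<int>\<^sub>\<le>\<^sub>0"
proof -
  have "Re (1 + a) > 0" "Re (1 - a) > 0" using assms by auto
  thus "1 + a \<notin> \<int>\<^sub>\<le>\<^sub>0" "1 - a \<notin> \<int>\<^sub>\<le>\<^sub>0" by (blast dest: Re_pos_not_nonpos_Int)+
qed

lemma holomorphic_bq: "bq holomorphic_on {a. \<bar>Re a\<bar> < 1}"
  unfolding bq_def[abs_def] using strip_not_nonpos_Int by (intro holomorphic_intros) auto

lemma Gamma_reflection_strip:
  fixes a :: complex
  shows "a \<noteq> 0 \<Longrightarrow> Gamma (1 + a) * Gamma (1 - a) = pi * a / sin (pi * a)"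
proof -
  assume a: "a \<noteq> 0"
  have r: "rGamma a = a * rGamma (1 + a)"
    using rGamma_plus1[of a] by (simp add: add.commute)
  have "Gamma (1 + a) = a * Gamma a"
    using a by (simp add: Gamma_def r)
  thus ?thesis using Gamma_reflection_complex[of a] by (simp add: mult_ac)
qed

text \<open>In Pochhammer symbols \<open>Pp a n\<close> is (1-a)_n^2 (1+2a)_n / n!^3. The shift
  changes each of the first two by one factor at either end, the third by two.\<close>

lemma Pp_shift:
  assumes "\<And>k::nat. a \<noteq> of_nat k" "1 + 2 * a \<noteq> 0" "1 + a \<noteq> 0"
  shows "Pp (a + 1) n * ((of_nat n - a) ^ 2 * (1 + 2 * a) * (2 + 2 * a)) =
         Pp a n * (a ^ 2 * (2 * a + of_nat n + 1) * (2 * a + of_nat n + 2))"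
proof (induction n)
  case (Suc n)
  define m where "m = (of_nat n :: complex)"
  have nz: "m - a \<noteq> 0" using assms(1)[of n] by (auto simp: m_def)
  have m1: "m + 1 \<noteq> 0" using of_nat_neq_0[of n] by (simp add: m_def add.commute)
  define d where "d = (m - a) ^ 2 * (1 + 2 * a) * (2 + 2 * a)"
  have d: "d \<noteq> 0" using nz assms by (auto simp: d_def) (metis distrib_left mult_eq_0_iff mult.right_neutral zero_neq_numeral)
  have IH: "Pp (a + 1) n = Pp a n * (a ^ 2 * (2 * a + m + 1) * (2 * a + m + 2)) / d"
    using Suc d by (subst nonzero_eq_divide_eq) (auto simp: d_def m_def)
  have S: "of_nat (Suc n) = m + 1" by (simp add: m_def)
  have f1: "(1 - (a + 1) / (m + 1)) ^ 2 * (1 + 2 * (a + 1) / (m + 1)) = (m - a)^2 * (m + 3 + 2 * a) / (m + 1) ^ 3"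
   and f2: "(1 - a / (m + 1)) ^ 2 * (1 + 2 * a / (m + 1)) = (m + 1 - a)^2 * (m + 1 + 2 * a) / (m + 1) ^ 3"
    using m1 by (simp_all add: divide_simps) (simp_all add: power2_eq_square power3_eq_cube algebra_simps)
  have "Pp (a + 1) (Suc n) * ((m + 1 - a) ^ 2 * (1 + 2 * a) * (2 + 2 * a)) =
     Pp a n * (a ^ 2 * (2 * a + m + 1) * (2 * a + m + 2)) * ((m - a)^2 * (m + 3 + 2 * a)) * ((m + 1 - a) ^ 2 * (1 + 2 * a) * (2 + 2 * a)) / ((m+1)^3 * d)"
    unfolding Pp_Suc S f1 IH by simp
  also have "\<dots> = Pp a n * (a ^ 2 * (2 * a + m + 1) * (2 * a + m + 2)) * ((m + 3 + 2 * a)) * ((m + 1 - a) ^ 2) / (m+1)^3 * (d / d)"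
    by (simp add: d_def mult_ac)
  also have "\<dots> = Pp a (Suc n) * (a ^ 2 * (2 * a + (m + 1) + 1) * (2 * a + (m + 1) + 2))"
    unfolding Pp_Suc S f2 using d by (simp add: add_ac mult_ac)
  finally show ?case by (simp only: S)
qed (simp add: algebra_simps)

text \<open>The numerator of the Zeilberger certificate for the shift \<open>a \<mapsto> a + 1\<close> of \<open>V\<close>.\<close>

definition Np :: "complex \<Rightarrow> complex \<Rightarrow> complex" where
  "Np a k = ((1+6*a+7*a^2)*k^2 - a*(2+15*a+32*a^2+21*a^3)*k + a^2*(3+20*a+43*a^2+30*a^3)) / (4*(1+2*a)^3)"

text \<open>The telescoping relation of \<open>V_shift\<close> divided by
  \<open>Pp a n / (n + 1) ^ 3\<close>; with denominators cleared it is a polynomial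
  identity.\<close>

lemma Np_identity:
  fixes a n :: complex
  assumes "n - a \<noteq> 0" "1 + 2 * a \<noteq> 0"
  shows "2*a^3 - (1+a)^4*a^2*(2*a+n+1)*(2*a+n+2) / (4*(1+2*a)^3*(n-a)^2) =
           (n+1+2*a) * Np a (n+1) - (n+1)^3 * Np a n / (n-a)^2"
proof -
  define d where "d = 4*(1+2*a)^3"
  have d: "d \<noteq> 0" using assms by (simp add: d_def)
  define M where "M = (\<lambda>k. (1+6*a+7*a^2)*k^2 - a*(2+15*a+32*a^2+21*a^3)*k + a^2*(3+20*a+43*a^2+30*a^3))"
  have key: "2*a^3 * (4*(1+2*a)^3) * (n-a)^2 - (1+a)^4*a^2*(2*a+n+1)*(2*a+n+2)
     = (n+1+2*a) * M (n+1) * (n-a)^2 - (n+1)^3 * M n"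
    unfolding M_def by algebra
  have Np: "Np a k = M k / d" for k by (simp add: Np_def M_def d_def)
  have "2*a^3 - (1+a)^4*a^2*(2*a+n+1)*(2*a+n+2) / (d*(n-a)^2) =
     (2*a^3 * d * (n-a)^2 - (1+a)^4*a^2*(2*a+n+1)*(2*a+n+2)) / (d * (n-a)^2)"
    using d assms by (simp add: diff_divide_distrib)
  also have "\<dots> = ((n+1+2*a) * M (n+1) * (n-a)^2 - (n+1)^3 * M n) / (d * (n-a)^2)"
    using key by (simp add: d_def)
  also have "\<dots> = (n+1+2*a) * Np a (n+1) - (n+1)^3 * Np a n / (n-a)^2"
    using d assms by (simp add: Np diff_divide_distrib)
  finally show ?thesis by (simp add: d_def)
qed

definition Pinf :: "complex \<Rightarrow> complex" where
  "Pinf a = rGamma (1 - a) ^ 2 * rGamma (1 + 2 * a)"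

text \<open>Gauss's limit at -a, -a and 2a: the powers of n cancel since the three arguments add up
  to 0. The factor 2a^3 comes from shifting each argument by 1.\<close>

lemma Pp_LIMSEQ:
  assumes a: "a \<noteq> 0"
  shows "Pp a \<longlonglongrightarrow> Pinf a"
proof -
  have "(\<lambda>n. rGamma_series (-a) n ^ 2 * rGamma_series (2 * a) n / (2 * a ^ 3)) \<longlonglongrightarrow>
          rGamma (-a) ^ 2 * rGamma (2 * a) / (2 * a ^ 3)"
    using a by (intro tendsto_intros rGamma_series_LIMSEQ) auto
  also have "rGamma (-a) ^ 2 * rGamma (2 * a) / (2 * a ^ 3) = Pinf a"
  proof -
    have "rGamma (-a) = - a * rGamma (1 - a)" "rGamma (2 * a) = 2 * a * rGamma (1 + 2 * a)"
      using rGamma_plus1[of "-a"] rGamma_plus1[of "2 * a"] by (simp_all add: add.commute)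
    thus ?thesis using a by (simp add: Pinf_def power2_eq_square power3_eq_cube)
  qed
  finally have 1: "(\<lambda>n. rGamma_series (-a) n ^ 2 * rGamma_series (2 * a) n / (2 * a ^ 3)) \<longlonglongrightarrow> Pinf a" .
  have P: "pochhammer (1 - a) n ^ 2 * pochhammer (1 + 2 * a) n = Pp a n * fact n ^ 3" for n
  proof (induction n)
    case (Suc n)
    define m where "m = (of_nat n :: complex)"
    have m: "m + 1 \<noteq> 0" using of_nat_neq_0[of n] by (simp add: m_def add.commute)
    have S: "of_nat (Suc n) = m + 1" "fact (Suc n) = (m + 1) * (fact n :: complex)"
      by (simp_all add: m_def)
    have "(1 - a / (m + 1)) ^ 2 * (1 + 2 * a / (m + 1)) * (m + 1) ^ 3 = (1 - a + m)^2 * (1 + 2 * a + m)"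
      using m by (simp add: divide_simps) (simp add: power2_eq_square power3_eq_cube algebra_simps)
    hence "Pp a (Suc n) * fact (Suc n) ^ 3 = Pp a n * fact n ^ 3 * ((1 - a + m)^2 * (1 + 2 * a + m))"
      unfolding Pp_Suc S by (simp add: power_mult_distrib mult_ac)
    also have "\<dots> = pochhammer (1 - a) (Suc n) ^ 2 * pochhammer (1 + 2 * a) (Suc n)"
      unfolding Suc[symmetric] by (simp add: pochhammer_Suc m_def power_mult_distrib mult_ac)
    finally show ?case ..
  qed auto
  have "\<forall>\<^sub>F n in sequentially. rGamma_series (-a) n ^ 2 * rGamma_series (2 * a) n / (2 * a ^ 3) = Pp a n"
    using eventually_gt_at_top[of 0]
  proof eventually_elim
    case (elim n)
    define e where "e = exp (a * of_real (ln (of_nat n)))"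
    have e: "exp (- a * of_real (ln (of_nat n))) = 1 / e" "exp (2 * a * of_real (ln (of_nat n))) = e ^ 2" "e \<noteq> 0"
      by (simp_all add: e_def exp_minus exp_double[symmetric] mult.assoc inverse_eq_divide)
    have p: "pochhammer (-a) (n + 1) = - a * pochhammer (1 - a) n"
            "pochhammer (2 * a) (n + 1) = 2 * a * pochhammer (1 + 2 * a) n"
      by (simp_all add: pochhammer_rec add.commute)
    have "rGamma_series (-a) n ^ 2 * rGamma_series (2 * a) n =
       (- a * pochhammer (1 - a) n / (fact n * (1 / e))) ^ 2 * (2 * a * pochhammer (1 + 2 * a) n / (fact n * e ^ 2))"
      unfolding rGamma_series_def p e ..
    also have "\<dots> = 2 * a ^ 3 * (pochhammer (1 - a) n ^ 2 * pochhammer (1 + 2 * a) n) / fact n ^ 3"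
      using e(3) by (simp add: power2_eq_square power3_eq_cube mult_ac)
    also have "\<dots> = 2 * a ^ 3 * Pp a n" unfolding P by simp
    finally show ?case using a by simp
  qed
  from Lim_transform_eventually[OF 1 this] show ?thesis .
qed

text \<open>The coefficient of the second term is the square of bq(a+1) / bq(a), so multiplying by
  \<open>bq a ^ 2\<close> yields a true difference. The 1 beside 2 a^3 V(a) absorbs the boundary
  value \<open>G 0 = 1 - c\<close>; the right side is the limit of \<open>G\<close>.\<close>

lemma V_shift:
  assumes a: "-1 < Re a" "Re a < 0" and half: "1 + 2 * a \<noteq> 0"
  shows "(1 + 2 * a ^ 3 * V a) - (1 + a)^2 / (4 * (1 + 2 * a)^2) * (1 + 2 * (a + 1) ^ 3 * V (a + 1)) =
           Pinf a * ((1 + 6 * a + 7 * a^2) / (4 * (1 + 2 * a)^3))"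
proof -
  have a0: "a \<noteq> 0" and a1: "1 + a \<noteq> 0" using a by (auto simp: complex_eq_iff)
  have an: "a \<noteq> of_nat k" for k :: nat using a by (auto simp: complex_eq_iff)
  have nzk: "of_nat k - a \<noteq> 0" for k :: nat using an[of k] by auto
  define G where "G = (\<lambda>k::nat. Pp a k * (Np a (of_nat k) / (of_nat k - a) ^ 2))"
  define c where "c = (1 + a)^2 / (4 * (1 + 2 * a)^2)"
  have step: "2 * a ^ 3 * (Pp a k / of_nat (Suc k) ^ 3) - c * (2 * (a + 1) ^ 3) * (Pp (a + 1) k / of_nat (Suc k) ^ 3)
      = G (Suc k) - G k" for k
  proof -
    define m where "m = (of_nat k :: complex)"
    have m1: "m + 1 \<noteq> 0" using of_nat_neq_0[of k] by (simp add: m_def add.commute)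
    have S: "of_nat (Suc k) = m + 1" by (simp add: m_def)
    have ma: "m - a \<noteq> 0" "m + 1 - a \<noteq> 0" using nzk[of k] nzk[of "Suc k"] by (auto simp: m_def add_ac)
    have d: "(m - a) ^ 2 * (1 + 2 * a) * (2 + 2 * a) \<noteq> 0"
    proof -
      have "2 + 2 * a \<noteq> 0"
      proof
        assume "2 + 2 * a = 0"
        hence "2 * (1 + a) = 0" by (simp only: distrib_left mult_1_right)
        thus False using a1 by (simp only: mult_eq_0_iff) auto
      qed
      thus ?thesis using ma half by simp
    qed
    have Q1: "Pp (a + 1) k = Pp a k * (a ^ 2 * (2 * a + m + 1) * (2 * a + m + 2)) / ((m - a) ^ 2 * (1 + 2 * a) * (2 + 2 * a))"
      using Pp_shift[OF an half a1, of k] d unfolding m_def[symmetric]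
      by (subst nonzero_eq_divide_eq) auto
    define h where "h = 1 + 2 * a"
    define s where "s = 1 + a"
    define u where "u = m - a"
    have hs: "h \<noteq> 0" "s \<noteq> 0" "u \<noteq> 0" using half a1 ma by (auto simp: h_def s_def u_def)
    have e2: "2 + 2 * a = 2 * s" by (simp add: s_def)
    have e1: "a + 1 = s" by (simp add: s_def)
    have "c * (2 * (a + 1) ^ 3) * (Pp (a + 1) k / (m + 1) ^ 3) =
       s^2 / (4 * h^2) * (2 * s^3) * (Pp a k * (a ^ 2 * (2 * a + m + 1) * (2 * a + m + 2)) / (u^2 * h * (2 * s)) / (m + 1) ^ 3)"
      unfolding Q1 unfolding c_def h_def[symmetric] e2 e1 u_def[symmetric] s_def[symmetric] ..
    also have "\<dots> = Pp a k / (m + 1) ^ 3 * (s^4 * a^2 * (2 * a + m + 1) * (2 * a + m + 2) / (4 * h^3 * u^2))"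
      using hs by (simp add: divide_simps) (simp add: eval_nat_numeral)
    finally have "2 * a ^ 3 * (Pp a k / (m + 1) ^ 3) - c * (2 * (a + 1) ^ 3) * (Pp (a + 1) k / (m + 1) ^ 3) =
       Pp a k / (m + 1) ^ 3 * (2 * a ^ 3 - s^4 * a^2 * (2 * a + m + 1) * (2 * a + m + 2) / (4 * h^3 * u^2))"
      by (simp add: algebra_simps)
    also have "\<dots> = Pp a k / (m + 1) ^ 3 * ((m+1+2*a) * Np a (m+1) - (m+1)^3 * Np a m / (m-a)^2)"
      using Np_identity[OF ma(1) half] by (simp only: h_def s_def u_def)
    also have "\<dots> = Pp a k * ((m+1+2*a) * Np a (m+1) / (m + 1) ^ 3) - Pp a k * (Np a m / (m-a)^2)"
      using m1 by (simp add: right_diff_distrib)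
    also have "Pp a k * ((m+1+2*a) * Np a (m+1) / (m + 1) ^ 3) = Pp a k * ((m+1+2*a) / (m + 1) ^ 3 * Np a (m+1))"
      by simp
    also have "(m+1+2*a) / (m + 1) ^ 3 = (1 - a / (m + 1)) ^ 2 * (1 + 2 * a / (m + 1)) / (m + 1 - a) ^ 2"
      using m1 ma by (simp add: divide_simps) (simp add: power2_eq_square power3_eq_cube algebra_simps)
    also have "Pp a k * ((1 - a / (m + 1)) ^ 2 * (1 + 2 * a / (m + 1)) / (m + 1 - a) ^ 2 * Np a (m+1))
        = Pp a (Suc k) * (Np a (m+1) / (m + 1 - a) ^ 2)"
      unfolding Pp_Suc S by simp
    finally show ?thesis by (simp only: G_def S m_def)
  qed
  have lim: "G \<longlonglongrightarrow> Pinf a * ((1 + 6 * a + 7 * a^2) / (4 * (1 + 2 * a)^3))"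
    unfolding G_def
  proof (intro tendsto_mult Pp_LIMSEQ a0)
    \<comment> \<open>In v = 1/(k - a) the quotient \<open>Np a k / (k - a)^2\<close> is a
      polynomial, so its limit is its value at v = 0.\<close>
    define v where "v = (\<lambda>k::nat. 1 / (of_nat k - a))"
    have v: "v \<longlonglongrightarrow> 0"
    proof -
      have "filterlim (\<lambda>k. of_nat k - a) at_infinity sequentially"
        using tendsto_add_filterlim_at_infinity'[OF tendsto_of_nat tendsto_const[of "-a"]] by simp
      thus ?thesis unfolding v_def by (rule tendsto_divide_0[OF tendsto_const])
    qed
    define c0 where "c0 = a^2*(3+20*a+43*a^2+30*a^3)"
    define c1 where "c1 = a*(2+15*a+32*a^2+21*a^3)"
    define c2 where "c2 = 1+6*a+7*a^2"
    define d where "d = 4*(1+2*a)^3"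
    have d: "d \<noteq> 0" using half by (simp add: d_def)
    have "(\<lambda>k. (c2 * (1 + a * v k)^2 - c1 * (v k + a * v k ^ 2) + c0 * v k ^ 2) / d) \<longlonglongrightarrow> (c2 * (1 + a * 0)^2 - c1 * (0 + a * 0 ^ 2) + c0 * 0 ^ 2) / d"
      by (intro tendsto_intros v d)
    also have "(c2 * (1 + a * 0)^2 - c1 * (0 + a * 0 ^ 2) + c0 * 0 ^ 2) / d = c2 / d" by simp
    also have "(\<lambda>k. (c2 * (1 + a * v k)^2 - c1 * (v k + a * v k ^ 2) + c0 * v k ^ 2) / d) = (\<lambda>k. Np a (of_nat k) / (of_nat k - a)\<^sup>2)"
    proof
      fix k :: nat
      define m where "m = (of_nat k :: complex)"
      have ma: "m - a \<noteq> 0" using nzk[of k] by (simp add: m_def)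
      define u where "u = m - a"
      have u: "u \<noteq> 0" "m = u + a" "v k = 1 / u" using ma by (auto simp: u_def v_def m_def)
      have "(c2 * (1 + a * (1 / u))^2 - c1 * (1 / u + a * (1 / u) ^ 2) + c0 * (1 / u) ^ 2) = (c2 * (u + a)^2 - c1 * (u + a) + c0) / u^2"
        using u by (simp add: divide_simps) (simp add: power2_eq_square algebra_simps)
      thus "(c2 * (1 + a * v k)^2 - c1 * (v k + a * v k ^ 2) + c0 * v k ^ 2) / d = Np a (of_nat k) / (of_nat k - a)\<^sup>2"
        unfolding m_def[symmetric] u(3) by (simp add: Np_def u(2) c0_def c1_def c2_def d_def)
    qed
    finally show "(\<lambda>k. Np a (of_nat k) / (of_nat k - a)\<^sup>2) \<longlonglongrightarrow> (1 + 6 * a + 7 * a^2) / (4 * (1 + 2 * a)^3)"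
      by (simp add: c2_def d_def)
  qed
  have "(\<lambda>k. 2 * a ^ 3 * (Pp a k / of_nat (Suc k) ^ 3) - c * (2 * (a + 1) ^ 3) * (Pp (a + 1) k / of_nat (Suc k) ^ 3))
          sums (2 * a ^ 3 * V a - c * (2 * (a + 1) ^ 3) * V (a + 1))"
    unfolding V_def by (intro sums_diff sums_mult summable_sums summable_V)
  moreover have "(\<lambda>k. 2 * a ^ 3 * (Pp a k / of_nat (Suc k) ^ 3) - c * (2 * (a + 1) ^ 3) * (Pp (a + 1) k / of_nat (Suc k) ^ 3))
          sums (Pinf a * ((1 + 6 * a + 7 * a^2) / (4 * (1 + 2 * a)^3)) - G 0)"
    using telescope_sums[OF lim] by (simp only: step)
  ultimately have "2 * a ^ 3 * V a - c * (2 * (a + 1) ^ 3) * V (a + 1) = Pinf a * ((1 + 6 * a + 7 * a^2) / (4 * (1 + 2 * a)^3)) - G 0"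
    by (rule sums_unique2)
  moreover have "G 0 = 1 - c"
  proof -
    have "G 0 = (3+20*a+43*a^2+30*a^3) / (4*(1+2*a)^3)" using a0 by (simp add: G_def Np_def)
    also have "\<dots> = 1 - c" unfolding c_def using half
      by (simp add: divide_simps) (simp add: power2_eq_square power3_eq_cube algebra_simps)
    finally show ?thesis .
  qed
  ultimately show ?thesis unfolding c_def[symmetric] by (simp add: algebra_simps)
qed

section \<open>The complexified summand and its decay on vertical strips\<close>

text \<open>The Beta function B(x, x); its cube carries all Gamma factors of
  \<open>f7\<close>.\<close>

definition betaq :: "complex \<Rightarrow> complex" where
  "betaq x = Gamma x ^ 2 * rGamma (2 * x)"

definition fc :: "complex \<Rightarrow> complex" where
  "fc x = (21 * x - 8) / 8 * betaq x ^ 3"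

lemma bq_eq_betaq: "bq a = (1 + 2 * a) * betaq (1 + a)"
proof -
  have r: "rGamma (1 + 2 * a) = (1 + 2 * a) * rGamma (2 * (1 + a))"
    using rGamma_plus1[of "1 + 2 * a"] by (simp add: algebra_simps)
  show ?thesis unfolding bq_def betaq_def r by (simp only: mult_ac)
qed

lemma Gamma_plus1_complex: "a \<noteq> 0 \<Longrightarrow> Gamma (a + 1) = a * Gamma a" for a :: complex
proof -
  assume a: "a \<noteq> 0"
  have r: "rGamma a = a * rGamma (a + 1)" using rGamma_plus1[of a] by simp
  show "Gamma (a + 1) = a * Gamma a" using a by (simp add: Gamma_def r)
qed

lemma betaq_plus1:
  assumes "x \<noteq> 0" "2 * x + 1 \<noteq> 0"
  shows "betaq (x + 1) = betaq x * (x / (2 * (2 * x + 1)))"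
proof -
  have "2 * x * ((2 * x + 1) * rGamma (2 * x + 1 + 1)) = rGamma (2 * x)"
    unfolding rGamma_plus1 ..
  moreover have "2 * x + 1 + 1 = 2 * (x + 1)" by simp
  ultimately have "rGamma (2 * (x + 1)) * (2 * x * (2 * x + 1)) = rGamma (2 * x)"
    by (metis mult.assoc mult.commute)
  moreover have "2 * x * (2 * x + 1) \<noteq> 0" using assms by (simp only: mult_eq_0_iff) simp
  ultimately have r: "rGamma (2 * (x + 1)) = rGamma (2 * x) / (2 * x * (2 * x + 1))"
    by (metis nonzero_eq_divide_eq)
  show ?thesis unfolding betaq_def r Gamma_plus1_complex[OF assms(1)] using assms
    by (simp add: power2_eq_square)
qed

text \<open>A unit step multiplies by x / (2(2x + 1)), which has norm at most 1/4 because |2x| <=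
  |2x + 1| in the right half-plane.\<close>

lemma norm_betaq_add_nat:
  assumes "Re x > 0"
  shows "norm (betaq (x + of_nat k)) \<le> norm (betaq x) / 4 ^ k"
proof (induction k)
  case (Suc k)
  define y where "y = x + of_nat k"
  have y: "Re y > 0" using assms by (simp add: y_def)
  have y0: "y \<noteq> 0" "2 * y + 1 \<noteq> 0" using y by (auto simp: complex_eq_iff)
  have "Re (2 * y) \<ge> 0" using y by simp
  hence "norm (2 * y) \<le> norm (2 * y + 1)"
    by (simp add: cmod_def power2_eq_square algebra_simps)
  hence "norm (y / (2 * (2 * y + 1))) \<le> 1 / 4"
    using y0 unfolding norm_divide norm_mult by (simp add: divide_simps)
  hence "norm (betaq y) * norm (y / (2 * (2 * y + 1))) \<le> norm (betaq x) / 4 ^ k * (1 / 4)"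
    using Suc unfolding y_def[symmetric] by (intro mult_mono) auto
  moreover have "norm (betaq (x + of_nat (Suc k))) = norm (betaq y) * norm (y / (2 * (2 * y + 1)))"
  proof -
    have "x + of_nat (Suc k) = y + 1" by (simp add: y_def)
    thus ?thesis by (simp only: betaq_plus1[OF y0] norm_mult)
  qed
  ultimately show ?case by simp
qed auto

text \<open>Factor by factor in Gauss's limit, |x + m + 1/2| / |x + m| <= 1 + 1 / (2|x + m|), and |x
  + m| is at least its real part. This replaces Stirling estimates on vertical lines.\<close>

lemma norm_Gamma_ratio_le:
  fixes x :: complex
  assumes x: "Re x > 0"
  shows "norm (Gamma x / Gamma (x + 1/2)) \<le> Gamma (Re x) / Gamma (Re x + 1/2)"
proof -
  define s where "s = Re x"
  have s: "s > 0" using x by (simp add: s_def)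
  have poch: "norm (pochhammer (x + 1/2) m) * pochhammer s m \<le> pochhammer (s + 1/2) m * norm (pochhammer x m)" for m
  proof (induction m)
    case (Suc m)
    define u where "u = s + real m"
    have u: "u > 0" using s by (simp add: u_def)
    have "norm (x + 1/2 + of_nat m) \<le> norm (x + of_nat m) + 1/2"
      using norm_triangle_ineq[of "x + of_nat m" "1/2"] by (simp add: norm_divide add_ac)
    hence "norm (x + 1/2 + of_nat m) * u \<le> (norm (x + of_nat m) + 1/2) * u" using u by (intro mult_right_mono) auto
    moreover have "u \<le> norm (x + of_nat m)" using complex_Re_le_cmod[of "x + of_nat m"] by (simp add: u_def s_def)
    ultimately have 1: "norm (x + 1/2 + of_nat m) * u \<le> (u + 1/2) * norm (x + of_nat m)" by (simp add: algebra_simps)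
    have "norm (pochhammer (x + 1/2) (Suc m)) * pochhammer s (Suc m) =
      (norm (pochhammer (x + 1/2) m) * pochhammer s m) * (norm (x + 1/2 + of_nat m) * u)"
      by (simp add: pochhammer_Suc norm_mult u_def mult_ac)
    also have "\<dots> \<le> (pochhammer (s + 1/2) m * norm (pochhammer x m)) * ((u + 1/2) * norm (x + of_nat m))"
      by (rule mult_mono[OF Suc 1]) (use s u in \<open>auto intro!: mult_nonneg_nonneg less_imp_le[OF pochhammer_pos]\<close>)
    also have "\<dots> = pochhammer (s + 1/2) (Suc m) * norm (pochhammer x (Suc m))"
    proof -
      have "u + 1/2 = s + 1/2 + real m" by (simp add: u_def)
      thus ?thesis by (simp add: pochhammer_Suc norm_mult)
    qed
    finally show ?case .
  qed auto
  have xn: "x \<notin> \<int>\<^sub>\<le>\<^sub>0" "x + 1/2 \<notin> \<int>\<^sub>\<le>\<^sub>0" using x by (auto intro!: Re_pos_not_nonpos_Int)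
  have px: "norm (pochhammer x m) > 0" for m
    using xn(1) pochhammer_eq_0_imp_nonpos_Int[of x m] by auto
  have le: "norm (Gamma_series x n / Gamma_series (x + 1/2) n) \<le> Gamma_series s n / Gamma_series (s + 1/2) n" for n
  proof -
    define e where "e = exp (s * ln (real n)) / exp ((s + 1/2) * ln (real n))"
    have e: "e > 0" by (simp add: e_def)
    have "norm (Gamma_series x n / Gamma_series (x + 1/2) n) = e * (norm (pochhammer (x + 1/2) (n + 1)) / norm (pochhammer x (n + 1)))"
      by (simp add: Gamma_series_def norm_divide norm_mult e_def s_def del: pochhammer_Suc)
    also have "\<dots> \<le> e * (pochhammer (s + 1/2) (n + 1) / pochhammer s (n + 1))"
      using e px[of "n+1"] poch[of "n + 1"] pochhammer_pos[OF s, of "n + 1"]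
      by (intro mult_left_mono) (auto simp: divide_simps mult_ac)
    also have "\<dots> = Gamma_series s n / Gamma_series (s + 1/2) n"
      by (simp add: Gamma_series_def e_def)
    finally show ?thesis .
  qed
  have "(\<lambda>n. norm (Gamma_series x n / Gamma_series (x + 1/2) n)) \<longlonglongrightarrow> norm (Gamma x / Gamma (x + 1/2))"
    using xn by (intro tendsto_intros Gamma_series_LIMSEQ) (auto simp: Gamma_eq_zero_iff)
  moreover have "(\<lambda>n. Gamma_series s n / Gamma_series (s + 1/2) n) \<longlonglongrightarrow> Gamma s / Gamma (s + 1/2)"
    using s by (intro tendsto_intros Gamma_series_LIMSEQ) (auto simp: Gamma_eq_zero_iff elim!: nonpos_Ints_cases)
  ultimately show ?thesis unfolding s_def[symmetric]
    by (rule LIMSEQ_le) (use le in auto)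
qed

text \<open>Duplication gives B(x, x) = 2^(1-2x) sqrt(pi) Gamma(x) / Gamma(x + 1/2), and compactness
  bounds the ratio on the real interval. The range [1/2, 3] contains Re(1 + a) for |Re a| <= 1/2 and
  Re(2 + a) for |Re a| < 1.\<close>

lemma betaq_bounded: "\<exists>B\<ge>0. \<forall>x. 1/2 \<le> Re x \<and> Re x \<le> 3 \<longrightarrow> norm (betaq x) \<le> B"
proof -
  have "continuous_on {1/2..3} (\<lambda>s::real. Gamma s / Gamma (s + 1/2))"
    by (intro continuous_at_imp_continuous_on ballI continuous_intros) (auto simp: Gamma_eq_zero_iff elim!: nonpos_Ints_cases)
  hence "bounded ((\<lambda>s::real. Gamma s / Gamma (s + 1/2)) ` {1/2..3})"
    by (intro compact_imp_bounded compact_continuous_image) auto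
  then obtain C where "\<forall>y\<in>(\<lambda>s::real. Gamma s / Gamma (s + 1/2)) ` {1/2..3}. norm y \<le> C"
    unfolding bounded_iff by blast
  hence C: "\<And>s::real. s \<in> {1/2..3} \<Longrightarrow> \<bar>Gamma s / Gamma (s + 1/2)\<bar> \<le> C"
    unfolding real_norm_def by blast
  have C0: "C \<ge> 0" using order.trans[OF abs_ge_zero C[of 1]] by simp
  show ?thesis
  proof (intro exI[of _ "2 * sqrt pi * C"] conjI allI impI)
    fix x :: complex assume x: "1/2 \<le> Re x \<and> Re x \<le> 3"
    have xn: "x \<notin> \<int>\<^sub>\<le>\<^sub>0" "x + 1/2 \<notin> \<int>\<^sub>\<le>\<^sub>0" "2 * x \<notin> \<int>\<^sub>\<le>\<^sub>0" using x by (auto intro!: Re_pos_not_nonpos_Int)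
    have nz: "Gamma (x + 1/2) \<noteq> 0" "Gamma (2 * x) \<noteq> 0" using xn by (auto simp: Gamma_eq_zero_iff)
    have "Gamma x * Gamma (x + 1/2) = exp ((1 - 2 * x) * of_real (ln 2)) * of_real (sqrt pi) * Gamma (2 * x)"
      by (rule Gamma_legendre_duplication) (use xn in auto)
    hence H: "Gamma x / Gamma (2 * x) = exp ((1 - 2 * x) * of_real (ln 2)) * of_real (sqrt pi) / Gamma (x + 1/2)"
      using nz by (simp add: field_simps)
    have "betaq x = Gamma x / Gamma (2 * x) * Gamma x"
      by (simp only: betaq_def power2_eq_square rGamma_inverse_Gamma divide_inverse mult_ac)
    also have "\<dots> = exp ((1 - 2 * x) * of_real (ln 2)) * of_real (sqrt pi) * (Gamma x / Gamma (x + 1/2))"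
      unfolding H by simp
    finally have "norm (betaq x) = norm (exp ((1 - 2 * x) * of_real (ln 2))) * norm (of_real (sqrt pi) :: complex)
        * norm (Gamma x / Gamma (x + 1/2))"
      by (simp only: norm_mult)
    also have "norm (exp ((1 - 2 * x) * of_real (ln 2))) = exp ((1 - 2 * Re x) * ln 2)" by simp
    also have "norm (of_real (sqrt pi) :: complex) = sqrt pi" by simp
    also have "exp ((1 - 2 * Re x) * ln 2) * sqrt pi * norm (Gamma x / Gamma (x + 1/2)) \<le> 2 * sqrt pi * C"
    proof (intro mult_mono)
      have "(1 - 2 * Re x) * ln 2 \<le> 0" using x by (intro mult_nonpos_nonneg) auto
      hence "exp ((1 - 2 * Re x) * ln 2) \<le> exp 0" by (subst exp_le_cancel_iff)
      thus "exp ((1 - 2 * Re x) * ln 2) \<le> 2" unfolding exp_zero by linarith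
      have "norm (Gamma x / Gamma (x + 1/2)) \<le> Gamma (Re x) / Gamma (Re x + 1/2)"
        using x by (intro norm_Gamma_ratio_le) auto
      also have "\<dots> \<le> C" using C[of "Re x"] x by auto
      finally show "norm (Gamma x / Gamma (x + 1/2)) \<le> C" .
    qed (use C0 in auto)
    finally show "norm (betaq x) \<le> 2 * sqrt pi * C" .
  qed (use C0 in auto)
qed

text \<open>The cube of 4^(-k) is 64^(-k), and the linear factor 21x - 8 is paid for with 2^k. On
  the open strip the bound starts at k = 1, since fc(1 + a) is unbounded near a = -1.\<close>

lemma fc_bq_bounded: "\<exists>B\<ge>0. (\<forall>a. \<bar>Re a\<bar> \<le> 1/2 \<longrightarrow> norm (bq a) \<le> (1 + 2 * norm a) * B) \<and>
   (\<forall>a k. (\<bar>Re a\<bar> < 1 \<and> k \<ge> 1 \<or> \<bar>Re a\<bar> \<le> 1/2) \<longrightarrow> norm (fc (of_nat (Suc k) + a)) \<le> 8 * (1 + norm a) * B ^ 3 * (1/32) ^ k)"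
proof -
  obtain C where C: "C \<ge> 0" "\<And>x. 1/2 \<le> Re x \<Longrightarrow> Re x \<le> 3 \<Longrightarrow> norm (betaq x) \<le> C"
    using betaq_bounded by blast
  show ?thesis
  \<comment> \<open>The factor 4 allows the decay to start at 2 + a instead of 1 + a.\<close>
  proof (intro exI[of _ "4 * C"] conjI allI impI)
    fix a :: complex assume a: "\<bar>Re a\<bar> \<le> 1/2"
    have "norm (betaq (1 + a)) \<le> C" using a by (intro C) auto
    moreover have "norm (1 + 2 * a) \<le> 1 + 2 * norm a"
      using norm_triangle_ineq[of 1 "2 * a"] by (simp add: norm_mult)
    ultimately have "norm (bq a) \<le> (1 + 2 * norm a) * C"
      unfolding bq_eq_betaq norm_mult using C by (intro mult_mono) auto
    also have "\<dots> \<le> (1 + 2 * norm a) * (4 * C)" using C by (intro mult_left_mono) auto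
    finally show "norm (bq a) \<le> (1 + 2 * norm a) * (4 * C)" .
  next
    fix a :: complex and k :: nat
    assume a: "\<bar>Re a\<bar> < 1 \<and> k \<ge> 1 \<or> \<bar>Re a\<bar> \<le> 1/2"
    define x where "x = of_nat (Suc k) + a"
    define t where "t = norm a"
    have t: "t \<ge> 0" by (simp add: t_def)
    have b: "norm (betaq x) \<le> 4 * C / 4 ^ k"
    proof (cases "\<bar>Re a\<bar> \<le> 1/2")
      case True
      have "norm (betaq ((1 + a) + of_nat k)) \<le> norm (betaq (1 + a)) / 4 ^ k"
        using True by (intro norm_betaq_add_nat) auto
      also have "norm (betaq (1 + a)) \<le> C" using True by (intro C) auto
      hence "norm (betaq (1 + a)) / 4 ^ k \<le> 4 * C / 4 ^ k" using C(1) by (intro divide_right_mono) auto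
      finally show ?thesis by (simp add: x_def add_ac)
    next
      case False
      hence a': "\<bar>Re a\<bar> < 1" "k \<ge> 1" using a by auto
      then obtain j where j: "k = Suc j" by (cases k) auto
      have "norm (betaq ((2 + a) + of_nat j)) \<le> norm (betaq (2 + a)) / 4 ^ j"
        using a' by (intro norm_betaq_add_nat) auto
      also have "\<dots> \<le> C / 4 ^ j" using C(2)[of "2 + a"] a' C(1) by (intro divide_right_mono) auto
      also have "\<dots> = 4 * C / 4 ^ k" by (simp add: j)
      finally show ?thesis by (simp add: x_def add_ac j)
    qed
    have "norm (21 * x - 8) \<le> 21 * norm x + 8"
      using norm_triangle_ineq4[of "21 * x" 8] by (simp add: norm_mult)
    also have "norm x \<le> real (Suc k) + t"
      unfolding x_def t_def by (rule order.trans[OF norm_triangle_ineq]) (simp del: of_nat_Suc)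
    also have "21 * (real (Suc k) + t) + 8 \<le> 32 * ((real k + 2) * (1 + t))"
    proof -
      have "32 * ((real k + 2) * (1 + t)) = 32 * real k + 64 + 32 * (real k * t) + 64 * t"
        by (simp add: algebra_simps)
      moreover have "real k * t \<ge> 0" using t by simp
      ultimately show ?thesis using t by simp
    qed
    also have "\<dots> \<le> 32 * ((2 * 2 ^ k) * (1 + t))"
    proof (intro mult_left_mono mult_right_mono)
      show "real k + 2 \<le> 2 * 2 ^ k" by (induction k) auto
    qed (use t in auto)
    finally have "norm (21 * x - 8) \<le> 64 * ((1 + t) * 2 ^ k)" by (simp add: mult_ac)
    moreover have "norm ((21 * x - 8) / 8) = norm (21 * x - 8) / 8" by (simp only: norm_divide) simp
    ultimately have "norm ((21 * x - 8) / 8) \<le> 8 * (1 + t) * 2 ^ k" by linarith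
    hence "norm (fc x) \<le> 8 * (1 + t) * 2 ^ k * (4 * C / 4 ^ k) ^ 3"
      unfolding fc_def norm_mult norm_power using b t C by (intro mult_mono power_mono) auto
    also have "\<dots> = 8 * (1 + t) * (4 * C) ^ 3 * (2 ^ k / (4 ^ k) ^ 3)" by (simp add: power_divide)
    also have "(2::real) ^ k / (4 ^ k) ^ 3 = (1/32) ^ k"
      by (induction k) (simp_all add: power_mult_distrib field_simps)
    finally show "norm (fc (of_nat (Suc k) + a)) \<le> 8 * (1 + norm a) * (4 * C) ^ 3 * (1/32) ^ k"
      by (simp add: x_def t_def)
  qed (use C in auto)
qed

section \<open>Identification of the sum with a closed solution\<close>

definition Sf :: "complex \<Rightarrow> complex" where
  "Sf a = (\<Sum>k. fc (of_nat (Suc k) + a))"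

text \<open>A meromorphic solution of the difference equation of \<open>Sf\<close>; its double pole at \<open>0\<close> cancels, and
  \<open>Kf\<close> below is \<open>a\<^sup>2 Rf a\<close> written without division by \<open>a\<close>.\<close>

definition Rf :: "complex \<Rightarrow> complex" where
  "Rf a = bq a ^ 3 / (3 * a\<^sup>2) + (of_real pi / sin (of_real pi * a))\<^sup>2 * (1 - 4 / 3 * bq a ^ 2 * (1 + 2 * a ^ 3 * V a))"

text \<open>By reflection \<open>Pinf a\<close> is b / (a w)^2 with the periodic square w^2. Thus
  \<open>V_shift\<close> times b^2 w^2 has an elementary right side, b^3 times a rational
  function.\<close>

lemma Rf_shift:
  assumes a: "-1 < Re a" "Re a < 0" and half: "1 + 2 * a \<noteq> 0"
  shows "Rf a - Rf (a + 1) = fc (1 + a)"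
proof -
  have a0: "a \<noteq> 0" and a1: "1 + a \<noteq> 0" using a by (auto simp: complex_eq_iff)
  have strip: "\<bar>Re a\<bar> < 1" using a by auto
  define b where "b = bq a"
  define h where "h = 1 + 2 * a"
  define s where "s = 1 + a"
  define w where "w = pi / sin (pi * a)"
  have hs: "h \<noteq> 0" "s \<noteq> 0" using half a1 by (auto simp: h_def s_def)
  have G: "Gamma (1 + a) * Gamma (1 - a) = a * w"
    using Gamma_reflection_strip[OF a0] by (simp add: w_def)
  have Gnz: "Gamma (1 + a) \<noteq> 0" "Gamma (1 - a) \<noteq> 0"
    using strip_not_nonpos_Int[OF strip] by (auto simp: Gamma_eq_zero_iff)
  have w0: "w \<noteq> 0" using G Gnz by auto
  have P: "Pinf a = b / (a * w)\<^sup>2"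
    unfolding G[symmetric] b_def bq_def Pinf_def using Gnz
    by (simp add: rGamma_inverse_Gamma power_mult_distrib divide_inverse power_inverse)
  have b1: "bq (a + 1) = b * (s / (2 * h))"
  proof -
    define d where "d = 2 * (1 + a) + 1"
    have "Re d > 0" using a by (simp add: d_def)
    hence d: "d \<noteq> 0" by auto
    have e: "betaq (1 + (a + 1)) = betaq (1 + a) * (s / (2 * d))"
    proof -
      have "1 + (a + 1) = 1 + a + 1" by simp
      thus ?thesis using betaq_plus1[OF a1 d[unfolded d_def]] by (simp only: d_def s_def)
    qed
    have "bq (a + 1) = d * betaq (1 + (a + 1))" by (simp add: bq_eq_betaq d_def)
    also have "\<dots> = betaq (1 + a) * s / 2" unfolding e using d by simp
    also have "betaq (1 + a) = b / h" using hs unfolding b_def bq_eq_betaq h_def by simp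
    finally show ?thesis by simp
  qed
  have s': "sin (pi * (a + 1)) = - sin (pi * a)"
    by (simp add: distrib_left sin_add cos_of_real[of pi] sin_of_real[of pi])
  have w1: "(pi / sin (pi * (a + 1)))\<^sup>2 = w\<^sup>2" unfolding s' by (simp add: w_def power_divide)
  define W where "W = 1 + 2 * a ^ 3 * V a"
  define W1 where "W1 = 1 + 2 * (a + 1) ^ 3 * V (a + 1)"
  have "W - s\<^sup>2 / (4 * h\<^sup>2) * W1 = Pinf a * ((1 + 6 * a + 7 * a^2) / (4 * h ^ 3))"
    using V_shift[OF a half] by (simp only: W_def W1_def s_def h_def)
  hence WW: "b\<^sup>2 * W - (b * (s / (2 * h)))\<^sup>2 * W1 = b ^ 3 / (a * w)\<^sup>2 * ((1 + 6 * a + 7 * a^2) / (4 * h ^ 3))"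
  proof -
    assume *: "W - s\<^sup>2 / (4 * h\<^sup>2) * W1 = Pinf a * ((1 + 6 * a + 7 * a^2) / (4 * h ^ 3))"
    have "b\<^sup>2 * W - (b * (s / (2 * h)))\<^sup>2 * W1 = b\<^sup>2 * (W - s\<^sup>2 / (4 * h\<^sup>2) * W1)"
      by (simp add: right_diff_distrib power_mult_distrib power_divide)
    also have "\<dots> = b ^ 3 / (a * w)\<^sup>2 * ((1 + 6 * a + 7 * a^2) / (4 * h ^ 3))"
      unfolding * P by (simp add: power2_eq_square power3_eq_cube)
    finally show ?thesis .
  qed
  have "Rf a - Rf (a + 1) = b ^ 3 / (3 * a\<^sup>2) - (b * (s / (2 * h))) ^ 3 / (3 * s\<^sup>2)
           - 4 / 3 * w\<^sup>2 * (b\<^sup>2 * W - (b * (s / (2 * h)))\<^sup>2 * W1)"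
  proof -
    have s: "a + 1 = s" by (simp add: s_def)
    have lin: "p + w\<^sup>2 * (1 - 4 / 3 * x * y) - (q + w\<^sup>2 * (1 - 4 / 3 * x' * y')) = p - q - 4 / 3 * w\<^sup>2 * (x * y - x' * y')"
      for p q x y x' y' :: complex by (simp add: field_simps)
    show ?thesis
      unfolding Rf_def w1 b1 W_def[symmetric] W1_def[symmetric] b_def[symmetric] w_def[symmetric] lin
      unfolding s ..
  qed
  also have "\<dots> = b ^ 3 * (1 / (3 * a\<^sup>2) - s / (24 * h ^ 3) - (1 + 6 * a + 7 * a^2) / (3 * a\<^sup>2 * h ^ 3))"
    unfolding WW using hs w0 a0 by (simp add: divide_simps) (simp add: power2_eq_square power3_eq_cube algebra_simps)
  \<comment> \<open>This is where the linear factor of \<open>f7\<close> arises: 13 + 21a = 21(1 +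
    a) - 8.\<close>
  also have "1 / (3 * a\<^sup>2) - s / (24 * h ^ 3) - (1 + 6 * a + 7 * a^2) / (3 * a\<^sup>2 * h ^ 3) = (13 + 21 * a) / (8 * h ^ 3)"
  proof -
    have "8 * h ^ 3 - s * a\<^sup>2 - 8 * (1 + 6 * a + 7 * a^2) = 3 * a\<^sup>2 * (13 + 21 * a)"
      unfolding h_def s_def by algebra
    moreover have "1 / (3 * a\<^sup>2) - s / (24 * h ^ 3) - (1 + 6 * a + 7 * a^2) / (3 * a\<^sup>2 * h ^ 3)
       = (8 * h ^ 3 - s * a\<^sup>2 - 8 * (1 + 6 * a + 7 * a^2)) / (24 * a\<^sup>2 * h ^ 3)"
      using hs a0 by (simp add: divide_simps)
    moreover have "3 * a\<^sup>2 * (13 + 21 * a) / (24 * a\<^sup>2 * h ^ 3) = (13 + 21 * a) / (8 * h ^ 3)"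
      using hs a0 by (simp add: divide_simps)
    ultimately show ?thesis by (simp only:)
  qed
  also have "b ^ 3 * ((13 + 21 * a) / (8 * h ^ 3)) = fc (1 + a)"
  proof -
    have "betaq (1 + a) = b / h" using hs unfolding b_def bq_eq_betaq h_def by simp
    moreover have "21 * (1 + a) - 8 = 13 + 21 * a" by simp
    ultimately show ?thesis by (simp only: fc_def power_divide) simp
  qed
  finally show ?thesis .
qed

definition Kf :: "complex \<Rightarrow> complex" where
  "Kf a = bq a ^ 3 / 3 + (Gamma (1 + a) * Gamma (1 - a))\<^sup>2 * (1 - 4 / 3 * bq a ^ 2 * (1 + 2 * a ^ 3 * V a))"

lemma Kf_eq: "a \<noteq> 0 \<Longrightarrow> Kf a = a\<^sup>2 * Rf a"
  unfolding Kf_def Rf_def by (subst Gamma_reflection_strip) (simp_all add: field_simps power2_eq_square)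

lemma holomorphic_Kf: "Kf holomorphic_on {a. \<bar>Re a\<bar> < 1}"
  unfolding Kf_def[abs_def] using strip_not_nonpos_Int
  by (intro holomorphic_intros holomorphic_bq holomorphic_on_subset[OF holomorphic_V]) auto

lemma Kf_0: "Kf 0 = 0" by (simp add: Kf_def bq_def)

text \<open>\<open>bq\<close> has derivative 0 at the origin because its digamma contributions
  cancel, Gamma(1+a) Gamma(1-a) is even, and \<open>V\<close> enters with a^3. With
  \<open>Kf_0\<close> the zero is double, so \<open>Rf\<close> has no pole at 0.\<close>

lemma deriv_Kf_0: "deriv Kf 0 = 0"
proof -
  obtain V' where V': "(V has_field_derivative V') (at 0)"
    using holomorphic_V by (auto simp: holomorphic_on_def field_differentiable_def)
  have 1: "(1::complex) \<notin> \<int>\<^sub>\<le>\<^sub>0" by simp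
  have "(Kf has_field_derivative 0) (at 0)"
    unfolding Kf_def[abs_def] bq_def
    by (auto intro!: derivative_eq_intros V' simp: 1)
  thus ?thesis by (rule DERIV_imp_deriv)
qed

lemma Rf_extension:
  obtains r where "r holomorphic_on {a. \<bar>Re a\<bar> < 1}" "\<And>a. a \<noteq> 0 \<Longrightarrow> r a = Rf a"
proof -
  define k1 where "k1 = (\<lambda>z. if z = 0 then deriv Kf 0 else (Kf z - Kf 0) / (z - 0))"
  have k1: "k1 holomorphic_on {a. \<bar>Re a\<bar> < 1}"
    unfolding k1_def by (rule pole_lemma_open[OF holomorphic_Kf open_strip])
  define k2 where "k2 = (\<lambda>z. if z = 0 then deriv k1 0 else (k1 z - k1 0) / (z - 0))"
  have k2: "k2 holomorphic_on {a. \<bar>Re a\<bar> < 1}"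
    unfolding k2_def by (rule pole_lemma_open[OF k1 open_strip])
  have "k2 a = Rf a" if "a \<noteq> 0" for a
    using that by (simp add: k2_def k1_def Kf_0 deriv_Kf_0 Kf_eq power2_eq_square)
  thus ?thesis using k2 that by blast
qed

text \<open>|sin(pi a)| >= sinh(pi |Im a|), and sinh y >= exp(y) / 4 for y >= 1.\<close>

lemma norm_csc_le:
  fixes a :: complex
  assumes "\<bar>Im a\<bar> \<ge> 1"
  shows "norm (pi / sin (pi * a)) \<le> 4 * pi * exp (- pi * \<bar>Im a\<bar>)"
proof -
  define y where "y = pi * \<bar>Im a\<bar>"
  have y: "y \<ge> 1" using assms pi_gt3 mult_mono[of 1 pi 1 "\<bar>Im a\<bar>"] by (simp add: y_def)
  have "exp y / 2 - exp (-y) / 2 \<le> norm (sin (pi * a))"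
  proof -
    have e: "norm (exp (\<i> * (pi * a))) = exp (- (pi * Im a))" "norm (exp (- (\<i> * (pi * a)))) = exp (pi * Im a)"
      by simp_all
    have "exp y - exp (- y) \<le> \<bar>norm (exp (\<i> * (pi * a))) - norm (exp (- (\<i> * (pi * a))))\<bar>"
      unfolding e by (cases "Im a \<ge> 0") (auto simp: y_def abs_if)
    also have "\<dots> \<le> norm (exp (\<i> * (pi * a)) - exp (- (\<i> * (pi * a))))"
      by (rule norm_triangle_ineq3)
    also have "\<dots> = 2 * norm (sin (pi * a))"
      by (simp add: sin_exp_eq norm_divide norm_mult)
    finally show ?thesis by simp
  qed
  moreover have "exp (-y) \<le> exp y / 2"
  proof -
    have "2 * exp (-y) \<le> exp 1 * exp (-y)" using exp_ge_add_one_self[of 1] by (intro mult_right_mono) auto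
    also have "\<dots> = exp (1 - y)" by (simp add: exp_add[symmetric])
    also have "\<dots> \<le> exp y" using y by simp
    finally show ?thesis by simp
  qed
  ultimately have 1: "exp y / 4 \<le> norm (sin (pi * a))" by linarith
  have "norm (pi / sin (pi * a)) = pi / norm (sin (pi * a))" by (simp add: norm_divide)
  also have "\<dots> \<le> pi / (exp y / 4)"
    using 1 by (intro divide_left_mono mult_pos_pos) (auto intro: order.strict_trans2[OF _ 1])
  also have "\<dots> = 4 * pi * exp (-y)" by (simp add: exp_minus field_simps)
  finally show ?thesis by (simp add: y_def)
qed

lemma holomorphic_fc: "fc holomorphic_on {x. Re x > 0}"
  unfolding fc_def[abs_def] betaq_def
  by (intro holomorphic_intros) (auto dest: Re_pos_not_nonpos_Int)

lemma holomorphic_fc_shift: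
  assumes "\<And>a. a \<in> A \<Longrightarrow> -1 < Re a"
  shows "(\<lambda>a. fc (of_nat (Suc k) + a)) holomorphic_on A"
proof -
  have "(fc \<circ> (\<lambda>a. of_nat (Suc k) + a)) holomorphic_on A"
    by (rule holomorphic_on_compose_gen[OF _ holomorphic_fc]) (use assms in \<open>force intro!: holomorphic_intros\<close>)+
  thus ?thesis by (simp only: o_def)
qed

lemma holomorphic_Sf: "Sf holomorphic_on {a. \<bar>Re a\<bar> < 1}"
proof -
  obtain B where B: "B \<ge> 0" "\<And>a k. \<bar>Re a\<bar> < 1 \<and> k \<ge> 1 \<or> \<bar>Re a\<bar> \<le> 1/2 \<Longrightarrow>
     norm (fc (of_nat (Suc k) + a)) \<le> 8 * (1 + norm a) * B ^ 3 * (1/32) ^ k"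
    using fc_bq_bounded by blast
  show ?thesis unfolding Sf_def[abs_def]
  proof (rule holomorphic_on_suminf[OF open_strip])
    show "(\<lambda>z. fc (of_nat (Suc n) + z)) holomorphic_on {a. \<bar>Re a\<bar> < 1}" for n
      by (rule holomorphic_fc_shift) auto
    fix R :: real
    show "\<exists>M N. summable M \<and> (\<forall>n\<ge>N. \<forall>z\<in>{a. \<bar>Re a\<bar> < 1}. norm z < R \<longrightarrow> norm (fc (of_nat (Suc n) + z)) \<le> M n)"
    proof (intro exI[of _ "\<lambda>k. 8 * (1 + R) * B ^ 3 * (1/32) ^ k"] exI[of _ 1] conjI allI impI ballI)
      fix n :: nat and z :: complex assume *: "1 \<le> n" "z \<in> {a. \<bar>Re a\<bar> < 1}" "norm z < R"
      have "norm (fc (of_nat (Suc n) + z)) \<le> 8 * (1 + norm z) * B ^ 3 * (1/32) ^ n"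
        using * by (intro B(2)) auto
      also have "\<dots> \<le> 8 * (1 + R) * B ^ 3 * (1/32) ^ n"
        using * B(1) by (intro mult_right_mono) auto
      finally show "norm (fc (of_nat (Suc n) + z)) \<le> 8 * (1 + R) * B ^ 3 * (1/32) ^ n" .
    qed (auto intro!: summable_mult summable_geometric)
  qed
qed

lemma summable_Sf:
  assumes "\<bar>Re a\<bar> < 1" shows "summable (\<lambda>k. fc (of_nat (Suc k) + a))"
proof -
  obtain B where B: "B \<ge> 0" "\<And>a k. \<bar>Re a\<bar> < 1 \<and> k \<ge> 1 \<or> \<bar>Re a\<bar> \<le> 1/2 \<Longrightarrow>
     norm (fc (of_nat (Suc k) + a)) \<le> 8 * (1 + norm a) * B ^ 3 * (1/32) ^ k"
    using fc_bq_bounded by blast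
  show ?thesis
  proof (rule summable_comparison_test'[where N = 1])
    show "summable (\<lambda>k. 8 * (1 + norm a) * B ^ 3 * (1/32) ^ k)"
      by (auto intro!: summable_mult summable_geometric)
  qed (use assms B(2) in auto)
qed

lemma Sf_shift:
  assumes a: "-1 < Re a" "Re a < 0"
  shows "Sf a - Sf (a + 1) = fc (1 + a)"
proof -
  have "Sf a = fc (1 + a) + (\<Sum>k. fc (of_nat (Suc (Suc k)) + a))"
    unfolding Sf_def using a by (subst suminf_split_head[OF summable_Sf]) (auto simp: algebra_simps)
  also have "(\<Sum>k. fc (of_nat (Suc (Suc k)) + a)) = Sf (a + 1)"
    unfolding Sf_def by (simp add: add_ac)
  finally show ?thesis by simp
qed

text \<open>The balance: 3 pi for \<open>V\<close>, 3/2 for a^3, 1 for the square of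
  \<open>bq\<close>, and -2 pi for the squared cosecant. The sum pi + 5/2 is below 2 pi.\<close>

lemma strip_exp_bounded_Rf:
  assumes bq: "\<And>a. \<bar>Re a\<bar> \<le> 1/2 \<Longrightarrow> norm (bq a) \<le> (1 + 2 * norm a) * B" "B \<ge> 0"
  shows "strip_exp_bounded (pi + 5/2) Rf"
proof -
  note const = strip_exp_bounded_const and mono = strip_exp_bounded_mono and power = strip_exp_bounded_power
  have b: "strip_exp_bounded (1/2) bq" by (rule strip_exp_bounded_linear[OF bq]) auto
  have V: "strip_exp_bounded (3 * pi) V"
    by (rule strip_exp_bounded_exp_norm[OF norm_V_le]) simp
  have csc: "strip_exp_bounded (- pi) (\<lambda>a. of_real pi / sin (of_real pi * a))"
    using norm_csc_le by (rule strip_exp_boundedI)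
  have inv: "strip_exp_bounded 0 (\<lambda>a. 1 / (3 * a\<^sup>2))"
  proof (rule strip_exp_boundedI)
    fix a :: complex assume "\<bar>Im a\<bar> \<ge> 1"
    hence "1 \<le> norm a" using abs_Im_le_cmod[of a] by linarith
    hence "1 \<le> 3 * (norm a)\<^sup>2" using one_le_power[of "norm a" 2] by linarith
    hence "1 / (3 * (norm a)\<^sup>2) \<le> 1" by (subst divide_le_eq_1) linarith
    thus "norm (1 / (3 * a\<^sup>2)) \<le> 1 * exp (0 * \<bar>Im a\<bar>)" by (simp add: norm_divide norm_mult norm_power)
  qed
  have "strip_exp_bounded (3/2 + 3 * pi) (\<lambda>a. 2 * a ^ 3 * V a)"
    using strip_exp_bounded_mult[OF strip_exp_bounded_mult[OF const power[OF strip_exp_bounded_id[of "1/2"], of 3]] V] by simp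
  hence W: "strip_exp_bounded (3/2 + 3 * pi) (\<lambda>a. 1 + 2 * a ^ 3 * V a)"
    by (intro strip_exp_bounded_add mono[OF const]) auto
  have "strip_exp_bounded (5/2 + 3 * pi) (\<lambda>a. (- 4 / 3) * bq a ^ 2 * (1 + 2 * a ^ 3 * V a))"
    using strip_exp_bounded_mult[OF strip_exp_bounded_mult[OF const power[OF b, of 2]] W] by (rule mono) simp
  hence "strip_exp_bounded (5/2 + 3 * pi) (\<lambda>a. 1 + (- 4 / 3) * bq a ^ 2 * (1 + 2 * a ^ 3 * V a))"
    by (intro strip_exp_bounded_add mono[OF const]) auto
  from strip_exp_bounded_mult[OF power[OF csc, of 2] this]
  have "strip_exp_bounded (pi + 5/2) (\<lambda>a. (of_real pi / sin (of_real pi * a))\<^sup>2 * (1 + (- 4 / 3) * bq a ^ 2 * (1 + 2 * a ^ 3 * V a)))"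
    by (rule mono) simp
  moreover have "strip_exp_bounded (pi + 5/2) (\<lambda>a. bq a ^ 3 * (1 / (3 * a\<^sup>2)))"
    using strip_exp_bounded_mult[OF power[OF b, of 3] inv] by (rule mono) (use pi_gt3 in simp)
  ultimately have "strip_exp_bounded (pi + 5/2) (\<lambda>a. bq a ^ 3 * (1 / (3 * a\<^sup>2)) +
      (of_real pi / sin (of_real pi * a))\<^sup>2 * (1 + (- 4 / 3) * bq a ^ 2 * (1 + 2 * a ^ 3 * V a)))"
    by (rule strip_exp_bounded_add[rotated])
  thus ?thesis by (simp add: Rf_def[abs_def])
qed

theorem Sf_eq_Rf_plus_const:
  obtains c where "\<And>a. \<bar>Re a\<bar> < 1 \<Longrightarrow> a \<noteq> 0 \<Longrightarrow> Sf a = Rf a + c"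
proof -
  obtain r where r: "r holomorphic_on {a. \<bar>Re a\<bar> < 1}" "\<And>a. a \<noteq> 0 \<Longrightarrow> r a = Rf a"
    using Rf_extension by blast
  obtain B where B: "B \<ge> 0" "\<And>a. \<bar>Re a\<bar> \<le> 1/2 \<Longrightarrow> norm (bq a) \<le> (1 + 2 * norm a) * B"
     "\<And>a k. \<bar>Re a\<bar> \<le> 1/2 \<Longrightarrow> norm (fc (of_nat (Suc k) + a)) \<le> 8 * (1 + norm a) * B ^ 3 * (1/32) ^ k"
    using fc_bq_bounded by blast
  define D where "D = (\<lambda>a. Sf a - r a)"
  have D: "D holomorphic_on {a. \<bar>Re a\<bar> < 1}"
    unfolding D_def by (intro holomorphic_intros holomorphic_Sf r)
  have per1: "D (z + 1) = D z" if z: "-1 < Re z" "Re z < 0" and half: "1 + 2 * z \<noteq> 0" for z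
  proof -
    have "z \<noteq> 0" "z + 1 \<noteq> 0" using z by (auto simp: complex_eq_iff)
    thus ?thesis using Sf_shift[OF z] Rf_shift[OF z half] by (simp add: D_def r(2) algebra_simps)
  qed
  \<comment> \<open>The certificate divides by 1 + 2a; periodicity at -1/2 follows by
    continuity.\<close>
  have per: "D (z + 1) = D z" if z: "-1 < Re z" "Re z < 0" for z
  proof (cases "1 + 2 * z = 0")
    case True
    have cont: "isCont D w" if "\<bar>Re w\<bar> < 1" for w
      using holomorphic_on_imp_continuous_on[OF D] open_strip that by (simp add: continuous_on_eq_continuous_at)
    have "isCont (\<lambda>w. D (w + 1)) z"
      by (rule isCont_o2[where f = "\<lambda>w. w + 1" and g = D]) (use z in \<open>auto intro!: cont continuous_intros\<close>)
    moreover have "isCont D z" using z by (intro cont) auto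
    ultimately have lim: "((\<lambda>w. D (w + 1) - D w) \<longlongrightarrow> D (z + 1) - D z) (at z)"
      by (intro tendsto_diff) (auto simp: isCont_def)
    have "\<forall>\<^sub>F w in at z. w \<in> {w. \<bar>Re w\<bar> < 1} - {z}"
      using open_strip z by (intro eventually_at_in_open) auto
    moreover have "\<forall>\<^sub>F w in at z. w \<in> {w. Re w < 0} - {z}"
      using z by (intro eventually_at_in_open) (auto simp: open_halfspace_Re_lt)
    ultimately have "\<forall>\<^sub>F w in at z. D (w + 1) - D w = 0"
    proof eventually_elim
      case (elim w)
      have "1 + 2 * w \<noteq> 0"
      proof
        assume "1 + 2 * w = 0"
        hence "2 * w = 2 * z" using True by (metis add_left_cancel)
        thus False using elim by simp
      qed
      thus ?case using elim per1[of w] by auto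
    qed
    hence "((\<lambda>w. D (w + 1) - D w) \<longlongrightarrow> 0) (at z)" by (rule tendsto_eventually)
    from LIM_unique[OF lim this] show ?thesis by simp
  qed (use per1 z in blast)
  have "strip_exp_bounded (pi + 5/2) Sf"
  proof (rule strip_exp_bounded_linear[where B = "9 * B ^ 3"])
    fix w :: complex assume w: "\<bar>Re w\<bar> \<le> 1/2"
    have "norm (Sf w) \<le> (\<Sum>k. 8 * (1 + norm w) * B ^ 3 * (1/32) ^ k)"
      unfolding Sf_def by (intro norm_suminf_le B(3) w summable_mult summable_geometric) auto
    also have "\<dots> = (256/31 * (1 + norm w)) * B ^ 3"
      by (subst suminf_mult) (auto simp: suminf_geometric summable_geometric)
    also have "\<dots> \<le> (9 * (1 + 2 * norm w)) * B ^ 3" using B(1) by (intro mult_right_mono) auto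
    finally show "norm (Sf w) \<le> (1 + 2 * norm w) * (9 * B ^ 3)" by (simp add: algebra_simps)
  qed (use B(1) pi_gt3 in auto)
  from strip_exp_bounded_add[OF this strip_exp_bounded_mult[OF strip_exp_bounded_const[of "-1"] strip_exp_bounded_Rf[OF B(2,1)], simplified]]
  have S: "strip_exp_bounded (pi + 5/2) (\<lambda>a. Sf a + - Rf a)" by simp
  \<comment> \<open>\<open>r\<close> and \<open>Rf\<close> agree away from 0, and the filter does
    not see 0.\<close>
  have ev: "\<forall>\<^sub>F a in strip_at_infinity. D a = Sf a + - Rf a"
    unfolding eventually_strip_at_infinity by (intro exI[of _ 1] allI impI) (subst D_def, subst r(2), auto)
  have bound: "strip_exp_bounded (pi + 5/2) D"
    using S unfolding strip_exp_bounded_def landau_o.big.in_cong[OF ev] .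
  have const: "D a = D 0" if "\<bar>Re a\<bar> < 1" for a
    by (rule periodic_strip_exp_bounded_constant[OF D per bound]) (use that pi_gt3 in auto)
  show ?thesis
  proof (rule that[of "D 0"])
    fix a :: complex assume "\<bar>Re a\<bar> < 1" "a \<noteq> 0"
    hence "Sf a - Rf a = D 0" using const[of a] r(2)[of a] by (simp add: D_def)
    thus "Sf a = Rf a + D 0" by (metis add.commute diff_add_cancel)
  qed
qed

section \<open>Double shuffle relations\<close>

text \<open>All indices are shifted by one: \<open>Hp b k\<close> sums over \<open>1, \<dots>, k\<close>, that is, over the integers strictly below
  the base \<open>k + 1\<close> of \<open>rp a k\<close>, so \<open>dz a b\<close> is \<open>\<zeta>(a,b)\<close> with the larger index first.\<close>

definition rp :: "nat \<Rightarrow> nat \<Rightarrow> real" where "rp p k = 1 / real (Suc k) ^ p"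

definition zt :: "nat \<Rightarrow> real" where "zt p = (\<Sum>k. rp p k)"

definition Hp :: "nat \<Rightarrow> nat \<Rightarrow> real" where "Hp p n = (\<Sum>k<n. rp p k)"

definition dz :: "nat \<Rightarrow> nat \<Rightarrow> real" where "dz a b = (\<Sum>k. rp a k * Hp b k)"

lemma rp_nonneg [simp]: "rp p k \<ge> 0" by (simp add: rp_def)

lemma rp_mult: "rp p k * rp q k = rp (p + q) k" by (simp add: rp_def power_add)

lemma Hp_0 [simp]: "Hp p 0 = 0" and Hp_Suc: "Hp p (Suc n) = Hp p n + rp p n"
  by (simp_all add: Hp_def)

lemma Hp_nonneg [simp]: "Hp p n \<ge> 0" by (simp add: Hp_def sum_nonneg)

lemma summable_rp: "p \<ge> 2 \<Longrightarrow> summable (rp p)"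
  using summable_inverse_power_Suc[of p] by (simp add: rp_def[abs_def])

lemma zt_sums: "p \<ge> 2 \<Longrightarrow> rp p sums zt p"
  using summable_rp by (simp add: zt_def summable_sums)

lemma Hp_LIMSEQ: "p \<ge> 2 \<Longrightarrow> Hp p \<longlonglongrightarrow> zt p"
  using zt_sums by (simp add: sums_def Hp_def[abs_def])

lemma Hp_le_zt: "p \<ge> 2 \<Longrightarrow> Hp p n \<le> zt p"
  unfolding Hp_def zt_def by (intro sum_le_suminf summable_rp) auto

lemma zt_nonneg [simp]: "p \<ge> 2 \<Longrightarrow> zt p \<ge> 0"
  using Hp_le_zt[of p 0] by simp

lemma zeta_eq_zt: "zeta (real p) = zt p"
  by (simp add: zeta_def zt_def rp_def powr_minus powr_realpow inverse_eq_divide del: of_nat_Suc)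

lemma Hp_le_n: "Hp p n \<le> real n"
proof -
  have "Hp p n \<le> (\<Sum>k<n. 1)" unfolding Hp_def
    by (intro sum_mono) (simp add: rp_def)
  thus ?thesis by simp
qed

definition dz_ok :: "nat \<Rightarrow> nat \<Rightarrow> bool" where
  "dz_ok a b \<longleftrightarrow> a \<ge> 2 \<and> b \<ge> 2 \<or> a \<ge> 3"

text \<open>For b >= 2 the harmonic sums are bounded; otherwise \<open>Hp b k\<close> is at most k +
  1, which costs one power and requires a >= 3.\<close>

lemma summable_dz:
  assumes "dz_ok a b" shows "summable (\<lambda>k. rp a k * Hp b k)"
proof (cases "b \<ge> 2 \<and> a \<ge> 2")
  case True
  show ?thesis
  proof (rule summable_comparison_test'[where N = 0])
    show "summable (\<lambda>k. rp a k * zt b)" using True by (intro summable_mult2 summable_rp) auto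
  qed (use True in \<open>auto intro!: mult_left_mono Hp_le_zt simp: abs_mult\<close>)
next
  case False
  hence a: "a \<ge> 3" using assms by (auto simp: dz_ok_def)
  show ?thesis
  proof (rule summable_comparison_test'[where N = 0])
    show "summable (\<lambda>k. rp (a - 1) k)" using a by (intro summable_rp) auto
    fix k :: nat
    have "Hp b k \<le> real (Suc k)" using Hp_le_n[of b k] by simp
    hence "rp a k * Hp b k \<le> rp a k * real (Suc k)" by (intro mult_left_mono) auto
    also have "\<dots> = rp (a - 1) k" using a by (cases a) (auto simp: rp_def)
    finally show "norm (rp a k * Hp b k) \<le> rp (a - 1) k" by (simp add: abs_mult)
  qed
qed

lemma dz_sums: "dz_ok a b \<Longrightarrow> (\<lambda>k. rp a k * Hp b k) sums dz a b"
  using summable_dz by (simp add: dz_def summable_sums)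

text \<open>The increments of \<open>Hp a k * Hp b k\<close> split according to which of the two
  sums takes the new index; the third case is both.\<close>

lemma stuffle2:
  assumes "a \<ge> 2" "b \<ge> 2"
  shows "zt a * zt b = dz a b + dz b a + zt (a + b)"
proof -
  have "(\<lambda>k. Hp a k * Hp b k) \<longlonglongrightarrow> zt a * zt b" using assms by (intro tendsto_mult Hp_LIMSEQ)
  from telescope_sums[OF this] have "(\<lambda>k. Hp a (Suc k) * Hp b (Suc k) - Hp a k * Hp b k) sums (zt a * zt b)" by simp
  also have "(\<lambda>k. Hp a (Suc k) * Hp b (Suc k) - Hp a k * Hp b k) = (\<lambda>k. rp a k * Hp b k + rp b k * Hp a k + rp (a + b) k)"
    by (simp add: Hp_Suc rp_mult[symmetric] algebra_simps)
  finally have 1: "\<dots> sums (zt a * zt b)" .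
  have "(\<lambda>k. rp a k * Hp b k + rp b k * Hp a k + rp (a + b) k) sums (dz a b + dz b a + zt (a + b))"
    using assms by (intro sums_add dz_sums zt_sums) (auto simp: dz_ok_def)
  thus ?thesis using 1 sums_unique2 by blast
qed

lemma has_sum_zt: "p \<ge> 2 \<Longrightarrow> (rp p has_sum zt p) UNIV"
  using zt_sums by (intro sums_nonneg_imp_has_sum) auto

lemma has_sum_prod:
  fixes f g :: "'a \<Rightarrow> real"
  assumes "(f has_sum S) A" "(g has_sum T) B"
  shows "((\<lambda>(x, y). f x * g y) has_sum (S * T)) (A \<times> B)"
proof (rule has_sum_SigmaI)
  show "((\<lambda>y. case (x, y) of (x, y) \<Rightarrow> f x * g y) has_sum f x * T) B" for x
    using has_sum_cmult_right[OF assms(2), of "f x"] by simp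
  show "((\<lambda>x. f x * T) has_sum S * T) A" by (rule has_sum_cmult_left[OF assms(1)])
  have abs: "(\<lambda>x. norm (f x)) summable_on A" "(\<lambda>x. norm (g x)) summable_on B"
    using assms summable_on_iff_abs_summable_on_real has_sum_imp_summable by blast+
  have "(\<lambda>x. norm (case x of (x, y) \<Rightarrow> f x * g y)) summable_on (A \<times> B)"
    unfolding Infinite_Sum.abs_summable_on_Sigma_iff
  proof (intro conjI ballI)
    show "(\<lambda>y. norm (case (x, y) of (x, y) \<Rightarrow> f x * g y)) summable_on B" for x
      using summable_on_cmult_right[OF abs(2), of "norm (f x)"] by (simp add: abs_mult)
    show "(\<lambda>x. norm (\<Sum>\<^sub>\<infinity>y\<in>B. norm (case (x, y) of (x, y) \<Rightarrow> f x * g y))) summable_on A"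
      using summable_on_cmult_left[OF abs(1), of "\<Sum>\<^sub>\<infinity>y\<in>B. norm (g y)"]
      by (simp add: abs_mult infsum_cmult_right' infsum_nonneg)
  qed
  thus "(\<lambda>(x, y). f x * g y) summable_on (A \<times> B)"
    by (rule Infinite_Sum.abs_summable_summable)
qed

lemma has_sum_dz_Sigma:
  assumes "dz_ok a b"
  shows "((\<lambda>(k, d). rp a k * rp b d) has_sum dz a b) (Sigma UNIV (\<lambda>k. {..<k}))"
proof (rule has_sum_SigmaI)
  show 1: "((\<lambda>d. case (k, d) of (k, d) \<Rightarrow> rp a k * rp b d) has_sum rp a k * Hp b k) {..<k}" for k
    by (intro has_sum_finiteI) (auto simp: Hp_def sum_distrib_left)
  show "((\<lambda>k. rp a k * Hp b k) has_sum dz a b) UNIV"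
    using dz_sums[OF assms] by (intro sums_nonneg_imp_has_sum) auto
  hence "(\<lambda>k. rp a k * Hp b k) summable_on UNIV" by (rule has_sum_imp_summable)
  thus "(\<lambda>(k, d). rp a k * rp b d) summable_on Sigma UNIV (\<lambda>k. {..<k})"
    by (intro summable_on_SigmaI[OF 1]) auto
qed

text \<open>With x = d + 1 and y = j + 1 the shifted index d + j + 1 stands for x + y, so an ordered
  pair of indices becomes a free pair.\<close>

lemma has_sum_dz:
  assumes "dz_ok a b"
  shows "((\<lambda>(d, j). rp a (d + j + 1) * rp b d) has_sum dz a b) UNIV"
proof -
  have "((\<lambda>(d, j). rp a (d + j + 1) * rp b d) has_sum dz a b) UNIV \<longleftrightarrow>
        ((\<lambda>(k, d). rp a k * rp b d) has_sum dz a b) (Sigma UNIV (\<lambda>k. {..<k}))"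
    by (rule has_sum_reindex_bij_witness[of _ "\<lambda>(k, d). (d, k - d - 1)" "\<lambda>(d, j). (d + j + 1, d)"]) auto
  thus ?thesis using has_sum_dz_Sigma[OF assms] by simp
qed

lemma double_zeta_eq_dz:
  assumes "dz_ok a b" shows "double_zeta a b = dz a b"
proof -
  have "((\<lambda>(k1, k2). 1 / (real k1 ^ a * real k2 ^ b)) has_sum dz a b) {(k1, k2). k1 > k2 \<and> k2 > 0} \<longleftrightarrow>
        ((\<lambda>(k, d). rp a k * rp b d) has_sum dz a b) (Sigma UNIV (\<lambda>k. {..<k}))"
    by (rule has_sum_reindex_bij_witness[of _ "\<lambda>(k, d). (Suc k, Suc d)" "\<lambda>(k1, k2). (k1 - 1, k2 - 1)"])
       (auto simp: rp_def)
  thus ?thesis using has_sum_dz_Sigma[OF assms] unfolding double_zeta_def by (intro infsumI) simp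
qed

lemma has_sum_swap_dz:
  assumes "dz_ok a b"
  shows "((\<lambda>(d, j). rp a (d + j + 1) * rp b j) has_sum dz a b) UNIV"
proof -
  have "((\<lambda>(d, j). rp a (d + j + 1) * rp b j) has_sum dz a b) UNIV \<longleftrightarrow>
        ((\<lambda>(d, j). rp a (d + j + 1) * rp b d) has_sum dz a b) UNIV"
    by (rule has_sum_reindex_bij_witness[of _ prod.swap prod.swap]) (auto simp: add_ac)
  thus ?thesis using has_sum_dz[OF assms] by simp
qed

lemma has_sum_zt_zt:
  assumes "a \<ge> 2" "b \<ge> 2" shows "((\<lambda>(d, j). rp a d * rp b j) has_sum (zt a * zt b)) UNIV"
  using has_sum_prod[OF has_sum_zt[OF assms(1)] has_sum_zt[OF assms(2)]] by simp

text \<open>Tornheim's sum of x^(-a) y^(-b) (x + y)^(-c) over positive integers. For c = 0 it is a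
  product of zeta values, and unfolding the recursion gives the shuffle product.\<close>

fun tornheim :: "nat \<Rightarrow> nat \<Rightarrow> nat \<Rightarrow> real" where
  "tornheim 0 b c = dz c b"
| "tornheim (Suc a) 0 c = dz c (Suc a)"
| "tornheim (Suc a) (Suc b) c = tornheim a (Suc b) (Suc c) + tornheim (Suc a) b (Suc c)"

text \<open>The recursion is the partial fraction step \<open>1 / (x y) = (1 / x + 1 / y) / (x + y)\<close>.\<close>

lemma has_sum_tornheim_recursive:
  assumes "2 \<le> a + c" "2 \<le> b + c" "4 \<le> a + b + c"
  shows "((\<lambda>(d, j). rp a d * rp b j * rp c (d + j + 1)) has_sum tornheim a b c) UNIV"
  using assms
proof (induction a b c rule: tornheim.induct)
  case (1 b c)
  hence "dz_ok c b" by (auto simp: dz_ok_def)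
  from has_sum_swap_dz[OF this] show ?case by (simp add: rp_def case_prod_unfold mult.commute)
next
  case (2 a c)
  hence "dz_ok c (Suc a)" by (auto simp: dz_ok_def)
  from has_sum_dz[OF this] show ?case by (simp add: rp_def case_prod_unfold mult.commute)
next
  case (3 a b c)
  have "((\<lambda>x. (case x of (d, j) \<Rightarrow> rp a d * rp (Suc b) j * rp (Suc c) (d + j + 1)) +
      (case x of (d, j) \<Rightarrow> rp (Suc a) d * rp b j * rp (Suc c) (d + j + 1))) has_sum tornheim (Suc a) (Suc b) c) UNIV"
    unfolding tornheim.simps using 3 by (intro has_sum_add) auto
  moreover have "rp a d * rp (Suc b) j * rp (Suc c) (d + j + 1) + rp (Suc a) d * rp b j * rp (Suc c) (d + j + 1) =
      rp (Suc a) d * rp (Suc b) j * rp c (d + j + 1)" for d j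
  proof -
    have "1 / (x ^ a * y ^ Suc b * s ^ Suc c) + 1 / (x ^ Suc a * y ^ b * s ^ Suc c) = 1 / (x ^ Suc a * y ^ Suc b * s ^ c)"
      if "s = x + y" "x > 0" "y > 0" for x y s :: real
      using that by (simp add: divide_simps)
    from this[of "real (Suc (d + j + 1))" "real (Suc d)" "real (Suc j)"] show ?thesis by (simp add: rp_def)
  qed
  ultimately show ?case by (simp add: case_prod_unfold)
qed

lemma zt_mult_eq_tornheim:
  assumes "a \<ge> 2" "b \<ge> 2" shows "zt a * zt b = tornheim a b 0"
proof -
  have "((\<lambda>(d, j). rp a d * rp b j) has_sum tornheim a b 0) UNIV"
    using has_sum_tornheim_recursive[of a 0 b] assms by (simp add: rp_def case_prod_unfold)
  thus ?thesis using has_sum_unique has_sum_zt_zt[OF assms] by blast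
qed

text \<open>The weight 6 pair, with the stuffle relations, determines the double values occurring in
  \<open>Rv\<close>; the weight 8 pair serves to eliminate \<open>dz 7 1\<close>.\<close>

lemma shuffle:
  "zt 3 * zt 3 = 2 * dz 3 3 + 6 * dz 4 2 + 12 * dz 5 1"
  "zt 2 * zt 4 = dz 2 4 + 2 * dz 3 3 + 4 * dz 4 2 + 8 * dz 5 1"
  "zt 2 * zt 6 = dz 2 6 + 2 * dz 3 5 + 3 * dz 4 4 + 4 * dz 5 3 + 6 * dz 6 2 + 12 * dz 7 1"
  "zt 4 * zt 4 = 2 * dz 4 4 + 8 * dz 5 3 + 20 * dz 6 2 + 40 * dz 7 1"
proof -
  show "zt 3 * zt 3 = 2 * dz 3 3 + 6 * dz 4 2 + 12 * dz 5 1"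
    using zt_mult_eq_tornheim[of 3 3] by (simp add: eval_nat_numeral)
  show "zt 2 * zt 4 = dz 2 4 + 2 * dz 3 3 + 4 * dz 4 2 + 8 * dz 5 1"
    using zt_mult_eq_tornheim[of 2 4] by (simp add: eval_nat_numeral)
  show "zt 2 * zt 6 = dz 2 6 + 2 * dz 3 5 + 3 * dz 4 4 + 4 * dz 5 3 + 6 * dz 6 2 + 12 * dz 7 1"
    using zt_mult_eq_tornheim[of 2 6] by (simp add: eval_nat_numeral)
  show "zt 4 * zt 4 = 2 * dz 4 4 + 8 * dz 5 3 + 20 * dz 6 2 + 40 * dz 7 1"
    using zt_mult_eq_tornheim[of 4 4] by (simp add: eval_nat_numeral)
qed

section \<open>A parity relation in weight 8\<close>

text \<open>Since \<open>1 / 0 = 0\<close>, \<open>gd p a a = 0\<close> for \<open>p > 0\<close>, and sums over \<open>gd\<close> skip the singular index.\<close>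

definition gd :: "nat \<Rightarrow> nat \<Rightarrow> nat \<Rightarrow> real" where "gd p k a = 1 / (real k - real a) ^ p"

text \<open>With x = k + 1 and y = a + 1 this is 1/(x + y)^p. Up to the sign (-1)^p it is
  \<open>gd\<close> with x replaced by -x.\<close>

definition sd :: "nat \<Rightarrow> nat \<Rightarrow> nat \<Rightarrow> real" where "sd p k a = rp p (k + Suc a)"

lemma gd_shift: "gd p (k + Suc a) a = rp p k"
  by (simp add: gd_def rp_def add_ac)

lemma gd_initial: "p > 0 \<Longrightarrow> (\<Sum>k<Suc a. gd p k a) = (-1) ^ p * Hp p a"
proof -
  assume p: "p > 0"
  have "(\<Sum>k<Suc a. gd p k a) = (\<Sum>k<a. gd p k a)" using p by (simp add: gd_def)
  also have "\<dots> = (\<Sum>k<a. gd p (a - Suc k) a)" by (rule sum.nat_diff_reindex[symmetric])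
  also have "\<dots> = (\<Sum>k<a. (-1) ^ p * rp p k)"
  proof (rule sum.cong)
    fix k assume "k \<in> {..<a}"
    hence "real (a - Suc k) - real a = - real (Suc k)" by (simp add: of_nat_diff)
    hence "gd p (a - Suc k) a = 1 / (- 1 * real (Suc k)) ^ p" by (simp add: gd_def)
    also have "\<dots> = (-1) ^ p * rp p k" unfolding power_mult_distrib rp_def
      by (cases "even p") simp_all
    finally show "gd p (a - Suc k) a = (-1) ^ p * rp p k" .
  qed auto
  finally show ?thesis by (simp add: Hp_def sum_distrib_left)
qed

lemma gd_sums:
  assumes "p \<ge> 2" shows "(\<lambda>k. gd p k a) sums (zt p + (-1) ^ p * Hp p a)"
proof -
  have "(\<lambda>k. gd p (k + Suc a) a) sums zt p" unfolding gd_shift using zt_sums[OF assms] by simp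
  hence "(\<lambda>k. gd p k a) sums (zt p + (\<Sum>k<Suc a. gd p k a))" by (subst (asm) sums_iff_shift)
  thus ?thesis using gd_initial[of p a] assms by simp
qed

lemma abs_gd_sums:
  assumes "p \<ge> 2" shows "(\<lambda>k. \<bar>gd p k a\<bar>) sums (zt p + Hp p a)"
proof -
  have "(\<lambda>k. \<bar>gd p (k + Suc a) a\<bar>) sums zt p" unfolding gd_shift using zt_sums[OF assms] by simp
  hence "(\<lambda>k. \<bar>gd p k a\<bar>) sums (zt p + (\<Sum>k<Suc a. \<bar>gd p k a\<bar>))" by (subst (asm) sums_iff_shift)
  also have "(\<Sum>k<Suc a. \<bar>gd p k a\<bar>) = (\<Sum>k<a. \<bar>gd p k a\<bar>)" using assms by (simp add: gd_def)
  also have "\<dots> = (\<Sum>k<a. \<bar>gd p (a - Suc k) a\<bar>)" by (rule sum.nat_diff_reindex[symmetric])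
  also have "\<dots> = Hp p a" unfolding Hp_def
  proof (rule sum.cong)
    fix k assume "k \<in> {..<a}"
    hence e: "real (a - Suc k) - real a = - real (Suc k)" by (simp add: of_nat_diff)
    have "\<bar>gd p (a - Suc k) a\<bar> = 1 / \<bar>- real (Suc k)\<bar> ^ p"
      unfolding gd_def e by (simp only: abs_divide power_abs abs_one)
    thus "\<bar>gd p (a - Suc k) a\<bar> = rp p k" by (simp only: abs_minus_cancel rp_def abs_of_nat)
  qed auto
  finally show ?thesis .
qed

lemma sd_sums:
  assumes "p \<ge> 2" shows "(\<lambda>k. sd p k a) sums (zt p - Hp p (Suc a))"
  unfolding sd_def Hp_def using zt_sums[OF assms] by (subst sums_iff_shift')

lemma rp1_telescope: "(\<lambda>k. rp 1 k - rp 1 (k + m)) sums Hp 1 m"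
proof (induction m)
  case (Suc m)
  have "(\<lambda>k. rp 1 (k + m)) \<longlonglongrightarrow> 0"
    using LIMSEQ_ignore_initial_segment[OF LIMSEQ_inverse_real_of_nat, of m] by (simp add: rp_def[abs_def] inverse_eq_divide)
  from telescope_sums'[OF this] have "(\<lambda>k. rp 1 (k + m) - rp 1 (Suc k + m)) sums rp 1 m" by simp
  from sums_add[OF Suc this] show ?case by (simp add: Hp_Suc)
qed auto

lemma Hp_add: "Hp p (m + n) = Hp p m + (\<Sum>k<n. rp p (m + k))"
  by (induction n) (simp_all add: Hp_Suc)

text \<open>Together \<open>gd\<close> and \<open>sd\<close> run over all nonzero integers x with x
  distinct from y. The symmetric sum of 1/(x - y) over all x distinct from y is 0, so minus the
  missing term at x = 0 remains and all harmonic sums cancel. The exponents 2 and 3 behave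
  alike.\<close>

lemma gd1_sd1_sums: "(\<lambda>k. gd 1 k a - sd 1 k a) sums rp 1 a"
proof -
  have "(\<lambda>k. gd 1 (k + Suc a) a - sd 1 (k + Suc a) a) sums Hp 1 (2 * Suc a)"
    using rp1_telescope[of "2 * Suc a"] unfolding gd_shift sd_def by (simp add: add_ac mult_2)
  hence "(\<lambda>k. gd 1 k a - sd 1 k a) sums (Hp 1 (2 * Suc a) + (\<Sum>k<Suc a. gd 1 k a - sd 1 k a))"
    by (subst (asm) sums_iff_shift)
  also have "(\<Sum>k<Suc a. gd 1 k a - sd 1 k a) = - Hp 1 a - (\<Sum>k<Suc a. rp 1 (Suc a + k))"
    using gd_initial[of 1 a] by (simp add: sum_subtractf sd_def add_ac)
  also have "Hp 1 (2 * Suc a) = Hp 1 (Suc a) + (\<Sum>k<Suc a. rp 1 (Suc a + k))"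
    unfolding mult_2 by (rule Hp_add)
  finally show ?thesis by (simp add: Hp_Suc)
qed

lemma gd2_sd2_sums: "(\<lambda>k. gd 2 k a + sd 2 k a) sums (2 * zt 2 - rp 2 a)"
  using sums_add[OF gd_sums[of 2 a] sd_sums[of 2 a]] by (simp add: Hp_Suc)

lemma gd3_sd3_sums: "(\<lambda>k. gd 3 k a - sd 3 k a) sums rp 3 a"
  using sums_diff[OF gd_sums[of 3 a] sd_sums[of 3 a]] by (simp add: Hp_Suc)

lemma sums_if_single: "(\<lambda>k. if k = a then c else 0 :: real) sums c"
  using sums_single[of a "\<lambda>_. c"] by simp

text \<open>N, U, X play the roles of 1/x, 1/(x - y), 1/y, and the hypothesis is the elementary
  partial fraction.\<close>

lemma partial_fraction_pow:
  fixes N U X :: real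
  assumes "N * U = X * (U - N)"
  shows "N^2 * U = - (X * N^2) - X^2 * N + X^2 * U"
    and "N^2 * U^2 = X^2 * N^2 + 2 * X^3 * N + X^2 * U^2 - 2 * X^3 * U"
    and "N^2 * U^3 = - (X^3 * N^2) - 3 * X^4 * N + X^2 * U^3 - 2 * X^3 * U^2 + 3 * X^4 * U"
  using assms by algebra+

lemma rp_eq: "rp p k = rp 1 k ^ p" by (simp add: rp_def power_one_over)
lemma gd_eq: "gd p k a = gd 1 k a ^ p" by (simp add: gd_def power_one_over)
lemma sd_eq: "sd p k a = sd 1 k a ^ p" by (simp add: sd_def rp_def power_one_over)

text \<open>The second relation is the first at -x. The first fails at k = a, where
  \<open>gd\<close> has the value 0, so the sums below carry a correction there.\<close>

lemma gd_sd_rel: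
  shows "k \<noteq> a \<Longrightarrow> rp 1 k * gd 1 k a = rp 1 a * (gd 1 k a - rp 1 k)"
    and "(- rp 1 k) * (- sd 1 k a) = rp 1 a * ((- sd 1 k a) - (- rp 1 k))"
    and "gd 1 a a = 0" "sd 1 a a = rp 1 a / 2"
proof -
  define x y where "x = real (Suc k)" "y = real (Suc a)"
  have xy: "x > 0" "y > 0" by (simp_all add: x_y_def)
  have g: "gd 1 k a = 1 / (x - y)" by (simp add: gd_def x_y_def)
  have s: "sd 1 k a = 1 / (x + y)" by (simp add: sd_def rp_def x_y_def add_ac)
  show "rp 1 k * gd 1 k a = rp 1 a * (gd 1 k a - rp 1 k)" if "k \<noteq> a"
  proof -
    have "x - y \<noteq> 0" using that by (auto simp: x_y_def)
    thus ?thesis unfolding g unfolding rp_def x_y_def[symmetric] using xy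
      by (simp add: divide_simps)
  qed
  show "(- rp 1 k) * (- sd 1 k a) = rp 1 a * ((- sd 1 k a) - (- rp 1 k))"
  proof -
    have "x + y \<noteq> 0" using xy by auto
    thus ?thesis unfolding s unfolding rp_def x_y_def[symmetric] using xy
      by (simp add: divide_simps)
  qed
  show "gd 1 a a = 0" "sd 1 a a = rp 1 a / 2" by (simp_all add: gd_def sd_def rp_def)
qed

text \<open>Partial fractions for x and -x are added, which brings in only the paired sums of
  \<open>gd\<close> and \<open>sd\<close>; the conditional term repairs the index k = a.\<close>

lemma K1_sums: "(\<lambda>k. rp 2 k * (gd 1 k a - sd 1 k a)) sums (- 2 * zt 2 * rp 1 a + 3 * rp 3 a)"
proof -
  have "rp 2 k * (gd 1 k a - sd 1 k a) =
      - 2 * rp 1 a * rp 2 k + rp 2 a * (gd 1 k a - sd 1 k a) + (if k = a then 2 * rp 3 a else 0)" for k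
  proof (cases "k = a")
    case True
    thus ?thesis unfolding True gd_eq[of 2] gd_eq[of 3] sd_eq[of 2] sd_eq[of 3] gd_sd_rel(3,4) rp_eq[of 2] rp_eq[of 3] rp_eq[of 4] rp_eq[of 5]
      by (simp add: eval_nat_numeral field_simps)
  next
    case False
    thus ?thesis using partial_fraction_pow(1)[OF gd_sd_rel(1)[OF False]] partial_fraction_pow(1)[OF gd_sd_rel(2)[of k a]]
      unfolding rp_eq[of 2] rp_eq[of 3] by (simp add: algebra_simps)
  qed
  moreover have "(\<lambda>k. - 2 * rp 1 a * rp 2 k + rp 2 a * (gd 1 k a - sd 1 k a) + (if k = a then 2 * rp 3 a else 0)) sums
      (- 2 * rp 1 a * zt 2 + rp 2 a * rp 1 a + 2 * rp 3 a)"
    by (intro sums_add sums_mult gd1_sd1_sums zt_sums sums_if_single) auto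
  moreover have "- 2 * rp 1 a * zt 2 + rp 2 a * rp 1 a + 2 * rp 3 a = - 2 * zt 2 * rp 1 a + 3 * rp 3 a"
    unfolding rp_eq[of 2] rp_eq[of 3] rp_eq[of 4] rp_eq[of 5] by (simp add: eval_nat_numeral algebra_simps)
  ultimately show ?thesis by (simp only:)
qed

lemma K2_sums: "(\<lambda>k. rp 2 k * (gd 2 k a + sd 2 k a)) sums (4 * zt 2 * rp 2 a - 6 * rp 4 a)"
proof -
  have "rp 2 k * (gd 2 k a + sd 2 k a) =
      2 * rp 2 a * rp 2 k + rp 2 a * (gd 2 k a + sd 2 k a) + (- 2 * rp 3 a) * (gd 1 k a - sd 1 k a) + (if k = a then - 3 * rp 4 a else 0)" for k
  proof (cases "k = a")
    case True
    thus ?thesis unfolding True gd_eq[of 2] gd_eq[of 3] sd_eq[of 2] sd_eq[of 3] gd_sd_rel(3,4) rp_eq[of 2] rp_eq[of 3] rp_eq[of 4] rp_eq[of 5]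
      by (simp add: eval_nat_numeral field_simps)
  next
    case False
    thus ?thesis using partial_fraction_pow(2)[OF gd_sd_rel(1)[OF False]] partial_fraction_pow(2)[OF gd_sd_rel(2)[of k a]]
      unfolding rp_eq[of 2] rp_eq[of 3] rp_eq[of 4] gd_eq[of 2] sd_eq[of 2] by (simp add: algebra_simps)
  qed
  moreover have "(\<lambda>k. 2 * rp 2 a * rp 2 k + rp 2 a * (gd 2 k a + sd 2 k a) + (- 2 * rp 3 a) * (gd 1 k a - sd 1 k a) + (if k = a then - 3 * rp 4 a else 0)) sums
      (2 * rp 2 a * zt 2 + rp 2 a * (2 * zt 2 - rp 2 a) + (- 2 * rp 3 a) * rp 1 a + - 3 * rp 4 a)"
    by (intro sums_add sums_mult gd1_sd1_sums gd2_sd2_sums zt_sums sums_if_single) auto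
  moreover have "2 * rp 2 a * zt 2 + rp 2 a * (2 * zt 2 - rp 2 a) + (- 2 * rp 3 a) * rp 1 a + - 3 * rp 4 a = 4 * zt 2 * rp 2 a - 6 * rp 4 a"
    unfolding rp_eq[of 2] rp_eq[of 3] rp_eq[of 4] rp_eq[of 5] by (simp add: eval_nat_numeral algebra_simps)
  ultimately show ?thesis by (simp only:)
qed

lemma K3_sums: "(\<lambda>k. rp 2 k * (gd 3 k a - sd 3 k a)) sums (- 6 * zt 2 * rp 3 a + 10 * rp 5 a)"
proof -
  have "rp 2 k * (gd 3 k a - sd 3 k a) =
      - 2 * rp 3 a * rp 2 k + rp 2 a * (gd 3 k a - sd 3 k a) + (- 2 * rp 3 a) * (gd 2 k a + sd 2 k a) + 3 * rp 4 a * (gd 1 k a - sd 1 k a) + (if k = a then 4 * rp 5 a else 0)" for k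
  proof (cases "k = a")
    case True
    thus ?thesis unfolding True gd_eq[of 2] gd_eq[of 3] sd_eq[of 2] sd_eq[of 3] gd_sd_rel(3,4) rp_eq[of 2] rp_eq[of 3] rp_eq[of 4] rp_eq[of 5]
      by (simp add: eval_nat_numeral field_simps)
  next
    case False
    thus ?thesis using partial_fraction_pow(3)[OF gd_sd_rel(1)[OF False]] partial_fraction_pow(3)[OF gd_sd_rel(2)[of k a]]
      unfolding rp_eq[of 2] rp_eq[of 3] rp_eq[of 4] rp_eq[of 5] gd_eq[of 2] sd_eq[of 2] gd_eq[of 3] sd_eq[of 3] by (simp add: algebra_simps)
  qed
  moreover have "(\<lambda>k. - 2 * rp 3 a * rp 2 k + rp 2 a * (gd 3 k a - sd 3 k a) + (- 2 * rp 3 a) * (gd 2 k a + sd 2 k a) + 3 * rp 4 a * (gd 1 k a - sd 1 k a) + (if k = a then 4 * rp 5 a else 0)) sums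
      (- 2 * rp 3 a * zt 2 + rp 2 a * rp 3 a + (- 2 * rp 3 a) * (2 * zt 2 - rp 2 a) + 3 * rp 4 a * rp 1 a + 4 * rp 5 a)"
    by (intro sums_add sums_mult gd1_sd1_sums gd2_sd2_sums gd3_sd3_sums zt_sums sums_if_single) auto
  moreover have "- 2 * rp 3 a * zt 2 + rp 2 a * rp 3 a + (- 2 * rp 3 a) * (2 * zt 2 - rp 2 a) + 3 * rp 4 a * rp 1 a + 4 * rp 5 a = - 6 * zt 2 * rp 3 a + 10 * rp 5 a"
    unfolding rp_eq[of 2] rp_eq[of 3] rp_eq[of 4] rp_eq[of 5] by (simp add: eval_nat_numeral algebra_simps)
  ultimately show ?thesis by (simp only:)
qed

section \<open>The triple sum, evaluated over \<open>a\<close> and \<open>b\<close> first\<close>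

text \<open>Bounded absolute row sums \<open>Z\<close> give absolute convergence over the triples,
  which later permits the other order of summation.\<close>

lemma has_sum_weighted_square:
  fixes g :: "nat \<Rightarrow> nat \<Rightarrow> real"
  assumes c: "summable c" "\<And>k. c k \<ge> 0"
    and g: "\<And>k. (g k) sums X k" "\<And>k. (\<lambda>a. \<bar>g k a\<bar>) sums Z k" "\<And>k. Z k \<le> C"
    and S: "(\<lambda>k. c k * X k ^ 2) sums S"
  shows "((\<lambda>(k, a, b). c k * (g k a * g k b)) has_sum S) UNIV"
proof -
  have X: "(g k has_sum X k) UNIV" for k
    using g(1,2)[of k] by (intro norm_summable_imp_has_sum) (auto simp: sums_iff)
  have Z: "((\<lambda>a. \<bar>g k a\<bar>) has_sum Z k) UNIV" for k
    using g(2)[of k] by (intro sums_nonneg_imp_has_sum) auto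
  have Z0: "Z k \<ge> 0" for k using Z[of k] has_sum_nonneg by fastforce
  have 1: "((\<lambda>y. case (k, y) of (k, a, b) \<Rightarrow> c k * (g k a * g k b)) has_sum c k * X k ^ 2) UNIV" for k
    using has_sum_cmult_right[OF has_sum_prod[OF X[of k] X[of k]], of "c k"] by (simp add: power2_eq_square case_prod_unfold)
  have 2: "((\<lambda>y. norm (case (k, y) of (k, a, b) \<Rightarrow> c k * (g k a * g k b))) has_sum c k * Z k ^ 2) UNIV" for k
    using has_sum_cmult_right[OF has_sum_prod[OF Z[of k] Z[of k]], of "c k"] c(2)[of k]
    by (simp add: power2_eq_square case_prod_unfold abs_mult)
  have bd: "c k * Z k ^ 2 \<le> c k * C ^ 2" for k
    using c(2) Z0 g(3) by (intro mult_left_mono power_mono) auto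
  have sumZ: "summable (\<lambda>k. c k * Z k ^ 2)"
    by (rule summable_comparison_test'[OF summable_mult2[OF c(1), of "C ^ 2"], of 0]) (use bd c(2) Z0 in \<open>auto simp: abs_mult\<close>)
  have "((\<lambda>k. c k * X k ^ 2) has_sum S) UNIV"
    using S c(2) by (intro sums_nonneg_imp_has_sum) auto
  moreover have "(\<lambda>x. norm (case x of (k, a, b) \<Rightarrow> c k * (g k a * g k b))) summable_on Sigma UNIV (\<lambda>_. UNIV)"
  proof (rule summable_on_SigmaI[OF 2])
    show "(\<lambda>k. c k * Z k ^ 2) summable_on UNIV"
      using sumZ c(2) by (intro summable_nonneg_imp_summable_on) auto
  qed auto
  hence "(\<lambda>x. case x of (k, a, b) \<Rightarrow> c k * (g k a * g k b)) summable_on Sigma UNIV (\<lambda>_. UNIV)"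
    by (rule Infinite_Sum.abs_summable_summable)
  ultimately show ?thesis using has_sum_SigmaI[OF 1, of UNIV S] by simp
qed

lemma summable_rp_bounded:
  assumes "p \<ge> 2" "\<And>k. \<bar>u k\<bar> \<le> C" shows "summable (\<lambda>k. rp p k * u k)"
  by (rule summable_comparison_test'[OF summable_mult2[OF summable_rp[OF assms(1)], of C], of 0])
     (use assms(2) in \<open>auto simp: abs_mult intro!: mult_left_mono\<close>)

lemma gd_swap: "odd p \<Longrightarrow> gd p k a = - gd p a k"
proof -
  assume "odd p"
  hence "gd p k a = gd 1 k a ^ p" "gd p a k = gd 1 a k ^ p" using gd_eq[of p] by auto
  moreover have "gd 1 k a = - gd 1 a k"
    unfolding gd_def by (metis minus_diff_eq minus_divide_right power_one_right)
  ultimately show ?thesis using \<open>odd p\<close> by (simp add: power_minus_odd)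
qed

lemma sd_swap: "sd p k a = sd p a k" by (simp add: sd_def add_ac)

text \<open>In multiple zeta values this is 2 zeta(2,3,3) + zeta(2,6).\<close>

definition A33 :: real where "A33 = (\<Sum>k. rp 2 k * Hp 3 k ^ 2)"

lemma A33_sums: "(\<lambda>k. rp 2 k * Hp 3 k ^ 2) sums A33"
  unfolding A33_def
  by (intro summable_sums summable_rp_bounded[of 2 _ "zt 3 ^ 2"]) (auto intro!: power_mono Hp_le_zt)

text \<open>As 3 is odd, exchanging k and a changes the sign of \<open>gd\<close>, so the row sum is
  minus the one in \<open>gd_sums\<close>.\<close>

lemma sum_gd_part:
  "((\<lambda>(k, a, b). rp 2 k * (gd 3 k a * gd 3 k b)) has_sum (A33 - 2 * zt 3 * dz 2 3 + zt 3 ^ 2 * zt 2)) UNIV"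
proof (rule has_sum_weighted_square[where Z = "\<lambda>k. zt 3 + Hp 3 k" and X = "\<lambda>k. Hp 3 k - zt 3" and C = "2 * zt 3"])
  show "(gd 3 k) sums (Hp 3 k - zt 3)" for k
  proof -
    have "gd 3 k = (\<lambda>a. - gd 3 a k)" by (intro ext gd_swap) simp
    thus ?thesis using sums_minus[OF gd_sums[of 3 k]] by simp
  qed
  show "(\<lambda>a. \<bar>gd 3 k a\<bar>) sums (zt 3 + Hp 3 k)" for k
  proof -
    have "\<bar>gd 3 k a\<bar> = \<bar>gd 3 a k\<bar>" for a by (subst gd_swap) auto
    thus ?thesis using abs_gd_sums[of 3 k] by simp
  qed
  show "zt 3 + Hp 3 k \<le> 2 * zt 3" for k using Hp_le_zt[of 3 k] by simp
  have "(\<lambda>k. rp 2 k * Hp 3 k ^ 2 + (- 2 * zt 3) * (rp 2 k * Hp 3 k) + zt 3 ^ 2 * rp 2 k) sums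
          (A33 + (- 2 * zt 3) * dz 2 3 + zt 3 ^ 2 * zt 2)"
    by (intro sums_add sums_mult A33_sums dz_sums zt_sums) (auto simp: dz_ok_def)
  thus "(\<lambda>k. rp 2 k * (Hp 3 k - zt 3)\<^sup>2) sums (A33 - 2 * zt 3 * dz 2 3 + zt 3 ^ 2 * zt 2)"
    by (simp add: power2_eq_square algebra_simps)
qed (auto intro: summable_rp)

lemma sum_sd_part:
  "((\<lambda>(k, a, b). rp 2 k * (sd 3 k a * sd 3 k b)) has_sum
      (A33 - 2 * zt 3 * dz 2 3 + zt 3 ^ 2 * zt 2 + 2 * dz 5 3 - 2 * zt 3 * zt 5 + zt 8)) UNIV"
proof (rule has_sum_weighted_square[where Z = "\<lambda>k. zt 3 - Hp 3 (Suc k)" and X = "\<lambda>k. zt 3 - Hp 3 (Suc k)" and C = "zt 3"])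
  show *: "(sd 3 k) sums (zt 3 - Hp 3 (Suc k))" for k
  proof -
    have "sd 3 k = (\<lambda>a. sd 3 a k)" by (intro ext sd_swap)
    thus ?thesis using sd_sums[of 3 k] by simp
  qed
  show "(\<lambda>a. \<bar>sd 3 k a\<bar>) sums (zt 3 - Hp 3 (Suc k))" for k
  proof -
    have "(\<lambda>a. \<bar>sd 3 k a\<bar>) = sd 3 k" by (simp add: sd_def fun_eq_iff)
    thus ?thesis using *[of k] by simp
  qed
  have "(\<lambda>k. rp 2 k * Hp 3 k ^ 2 + (- 2 * zt 3) * (rp 2 k * Hp 3 k) + zt 3 ^ 2 * rp 2 k + 2 * (rp 5 k * Hp 3 k) + (- 2 * zt 3) * rp 5 k + rp 8 k) sums
          (A33 + (- 2 * zt 3) * dz 2 3 + zt 3 ^ 2 * zt 2 + 2 * dz 5 3 + (- 2 * zt 3) * zt 5 + zt 8)"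
    by (intro sums_add sums_mult A33_sums dz_sums zt_sums) (auto simp: dz_ok_def)
  also have "(\<lambda>k. rp 2 k * Hp 3 k ^ 2 + (- 2 * zt 3) * (rp 2 k * Hp 3 k) + zt 3 ^ 2 * rp 2 k + 2 * (rp 5 k * Hp 3 k) + (- 2 * zt 3) * rp 5 k + rp 8 k) =
    (\<lambda>k. rp 2 k * (zt 3 - Hp 3 (Suc k))\<^sup>2)"
  proof
    fix k show "rp 2 k * Hp 3 k ^ 2 + (- 2 * zt 3) * (rp 2 k * Hp 3 k) + zt 3 ^ 2 * rp 2 k + 2 * (rp 5 k * Hp 3 k) + (- 2 * zt 3) * rp 5 k + rp 8 k =
      rp 2 k * (zt 3 - Hp 3 (Suc k))\<^sup>2"
      unfolding Hp_Suc rp_eq[of 2] rp_eq[of 3] rp_eq[of 5] rp_eq[of 8] by (simp add: eval_nat_numeral algebra_simps)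
  qed
  finally show "(\<lambda>k. rp 2 k * (zt 3 - Hp 3 (Suc k))\<^sup>2) sums
      (A33 - 2 * zt 3 * dz 2 3 + zt 3 ^ 2 * zt 2 + 2 * dz 5 3 - 2 * zt 3 * zt 5 + zt 8)" by simp
qed (auto intro: summable_rp simp: )

section \<open>The triple sum, evaluated over \<open>k\<close> first\<close>

definition K1 :: "nat \<Rightarrow> real" where "K1 a = - 2 * zt 2 * rp 1 a + 3 * rp 3 a"
definition K2 :: "nat \<Rightarrow> real" where "K2 a = 4 * zt 2 * rp 2 a - 6 * rp 4 a"
definition K3 :: "nat \<Rightarrow> real" where "K3 a = - 6 * zt 2 * rp 3 a + 10 * rp 5 a"

text \<open>Off the diagonal this is the sum over k, obtained by partial fractions in D = 1/(a - b).
  The coefficients 1, 3, 6 are those of \<open>partial_fraction_cubes\<close>; 10 is their sum and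
  repairs k = a and k = b.\<close>

definition Mf :: "nat \<Rightarrow> nat \<Rightarrow> real" where
  "Mf a b = (let D = gd 1 a b in D ^ 3 * (K3 a - K3 b) - 3 * D ^ 4 * (K2 a + K2 b) + 6 * D ^ 5 * (K1 a - K1 b)
     + 10 * D ^ 6 * (rp 2 a + rp 2 b))"

lemma gd1_swap: "gd 1 a b = - gd 1 b a" by (rule gd_swap) simp

lemma Mf_swap: "Mf a b = Mf b a"
  unfolding Mf_def Let_def gd1_swap[of a b] by (simp add: algebra_simps)

lemma partial_fraction_cubes:
  fixes P Q D :: real
  assumes "P * Q = D * (P - Q)"
  shows "P ^ 3 * Q ^ 3 = D ^ 3 * P ^ 3 - 3 * D ^ 4 * P ^ 2 + 6 * D ^ 5 * P - D ^ 3 * Q ^ 3 - 3 * D ^ 4 * Q ^ 2 - 6 * D ^ 5 * Q"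
  using assms by algebra

lemma gd_gd_rel: "k \<noteq> a \<Longrightarrow> k \<noteq> b \<Longrightarrow> a \<noteq> b \<Longrightarrow> gd 1 k a * gd 1 k b = gd 1 a b * (gd 1 k a - gd 1 k b)"
  by (simp add: gd_def divide_simps)

lemma sd_sd_rel: "a \<noteq> b \<Longrightarrow> (- sd 1 k a) * (- sd 1 k b) = gd 1 a b * ((- sd 1 k a) - (- sd 1 k b))"
proof -
  assume ab: "a \<noteq> b"
  define n i j where "n = real (Suc k)" "i = real (Suc a)" "j = real (Suc b)"
  have s: "sd 1 k a = 1 / (n + i)" "sd 1 k b = 1 / (n + j)" "gd 1 a b = 1 / (i - j)"
    by (simp_all add: sd_def rp_def gd_def n_i_j_def add_ac)
  have "n + i > 0" "n + j > 0" "i - j \<noteq> 0" using ab by (auto simp: n_i_j_def)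
  thus ?thesis unfolding s by (simp add: divide_simps)
qed

lemma M_sums:
  assumes ab: "a \<noteq> b"
  shows "(\<lambda>k. rp 2 k * (gd 3 k a * gd 3 k b) + rp 2 k * (sd 3 k a * sd 3 k b)) sums Mf a b"
proof -
  define D where "D = gd 1 a b"
  define T where "T = (\<lambda>k. (D ^ 3 * (rp 2 k * (gd 3 k a - sd 3 k a)) - D ^ 3 * (rp 2 k * (gd 3 k b - sd 3 k b)))
     - (3 * D ^ 4 * (rp 2 k * (gd 2 k a + sd 2 k a)) + 3 * D ^ 4 * (rp 2 k * (gd 2 k b + sd 2 k b)))
     + (6 * D ^ 5 * (rp 2 k * (gd 1 k a - sd 1 k a)) - 6 * D ^ 5 * (rp 2 k * (gd 1 k b - sd 1 k b)))
     + ((if k = a then 10 * D ^ 6 * rp 2 a else 0) + (if k = b then 10 * D ^ 6 * rp 2 b else 0)))"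
  have "T sums ((D ^ 3 * K3 a - D ^ 3 * K3 b) - (3 * D ^ 4 * K2 a + 3 * D ^ 4 * K2 b) + (6 * D ^ 5 * K1 a - 6 * D ^ 5 * K1 b)
     + (10 * D ^ 6 * rp 2 a + 10 * D ^ 6 * rp 2 b))"
    unfolding T_def K1_def K2_def K3_def
    by (intro sums_add sums_diff sums_mult K1_sums K2_sums K3_sums sums_if_single)
  also have "(D ^ 3 * K3 a - D ^ 3 * K3 b) - (3 * D ^ 4 * K2 a + 3 * D ^ 4 * K2 b) + (6 * D ^ 5 * K1 a - 6 * D ^ 5 * K1 b)
     + (10 * D ^ 6 * rp 2 a + 10 * D ^ 6 * rp 2 b) = Mf a b"
    by (simp add: Mf_def D_def Let_def algebra_simps)
  also have "T = (\<lambda>k. rp 2 k * (gd 3 k a * gd 3 k b) + rp 2 k * (sd 3 k a * sd 3 k b))"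
  proof
    fix k
    define P Q s t where d: "P = gd 1 k a" "Q = gd 1 k b" "s = sd 1 k a" "t = sd 1 k b"
    have S: "s ^ 3 * t ^ 3 = - (D ^ 3 * s ^ 3) - 3 * D ^ 4 * s ^ 2 - 6 * D ^ 5 * s + D ^ 3 * t ^ 3 - 3 * D ^ 4 * t ^ 2 + 6 * D ^ 5 * t"
      using partial_fraction_cubes[OF sd_sd_rel[OF ab, of k]] by (simp add: d D_def)
    \<comment> \<open>At k = a one has P = 0 and Q = D, where the generic right side would be -10
      D^6; the case k = b is similar.\<close>
    have R: "P ^ 3 * Q ^ 3 = D ^ 3 * P ^ 3 - 3 * D ^ 4 * P ^ 2 + 6 * D ^ 5 * P - D ^ 3 * Q ^ 3 - 3 * D ^ 4 * Q ^ 2 - 6 * D ^ 5 * Q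
        + ((if k = a then 10 * D ^ 6 else 0) + (if k = b then 10 * D ^ 6 else 0))"
    proof -
      consider "k = a" | "k = b" | "k \<noteq> a" "k \<noteq> b" by blast
      thus ?thesis
      proof cases
        case 1
        hence "P = 0" "Q = D" using gd_sd_rel(3) by (auto simp: d D_def)
        thus ?thesis using 1 ab by (simp add: eval_nat_numeral)
      next
        case 2
        hence "Q = 0" "P = - D" using gd_sd_rel(3) gd1_swap[of b a] by (auto simp: d D_def)
        thus ?thesis using 2 ab by (simp add: eval_nat_numeral)
      next
        case 3
        thus ?thesis using partial_fraction_cubes[OF gd_gd_rel[OF 3 ab]] by (simp add: d D_def)
      qed
    qed
    have "rp 2 k * (P ^ 3 * Q ^ 3) + rp 2 k * (s ^ 3 * t ^ 3) = T k"
      unfolding T_def gd_eq[of 2] gd_eq[of 3] sd_eq[of 2] sd_eq[of 3] d[symmetric] R S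
      by (cases "k = a"; cases "k = b") (use ab in \<open>simp_all add: algebra_simps\<close>)
    thus "T k = rp 2 k * (gd 3 k a * gd 3 k b) + rp 2 k * (sd 3 k a * sd 3 k b)"
      unfolding gd_eq[of 3] sd_eq[of 3] d[symmetric] by simp
  qed
  finally show ?thesis .
qed

lemma abs_gd_le: "\<bar>gd p k a\<bar> \<le> 1"
proof (cases "k = a")
  case False
  hence "1 \<le> \<bar>real k - real a\<bar>" by linarith
  hence "1 \<le> \<bar>(real k - real a) ^ p\<bar>" unfolding power_abs by (rule one_le_power)
  thus ?thesis by (simp add: gd_def abs_divide divide_le_eq)
qed (cases p, auto simp: gd_def)

lemma abs_sd_le: "\<bar>sd p k a\<bar> \<le> 1"
  by (simp add: sd_def rp_def)

definition Md :: "nat \<Rightarrow> real" where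
  "Md a = (\<Sum>k. rp 2 k * (gd 3 k a * gd 3 k a) + rp 2 k * (sd 3 k a * sd 3 k a))"

lemma summable_M:
  "summable (\<lambda>k. \<bar>rp 2 k * (gd 3 k a * gd 3 k b) + rp 2 k * (sd 3 k a * sd 3 k b)\<bar>)"
proof -
  have "\<bar>\<bar>gd 3 k a * gd 3 k b + sd 3 k a * sd 3 k b\<bar>\<bar> \<le> 2" for k
  proof -
    have "\<bar>gd 3 k a\<bar> * \<bar>gd 3 k b\<bar> \<le> 1 * 1" "\<bar>sd 3 k a\<bar> * \<bar>sd 3 k b\<bar> \<le> 1 * 1"
      by (intro mult_mono abs_gd_le abs_sd_le; simp)+
    thus ?thesis using abs_triangle_ineq[of "gd 3 k a * gd 3 k b" "sd 3 k a * sd 3 k b"] by (simp add: abs_mult)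
  qed
  hence "summable (\<lambda>k. rp 2 k * \<bar>gd 3 k a * gd 3 k b + sd 3 k a * sd 3 k b\<bar>)"
    by (intro summable_rp_bounded[of 2 _ 2]) auto
  also have "(\<lambda>k. rp 2 k * \<bar>gd 3 k a * gd 3 k b + sd 3 k a * sd 3 k b\<bar>) =
     (\<lambda>k. \<bar>rp 2 k * (gd 3 k a * gd 3 k b) + rp 2 k * (sd 3 k a * sd 3 k b)\<bar>)"
    by (auto simp: distrib_left[symmetric] abs_mult simp del: distrib_left)
  finally show ?thesis .
qed

lemma Md_sums: "(\<lambda>k. rp 2 k * (gd 3 k a * gd 3 k a) + rp 2 k * (sd 3 k a * sd 3 k a)) sums Md a"
  unfolding Md_def by (intro summable_sums summable_rabs_cancel[OF summable_M])

text \<open>On the diagonal the cubes merge into sixth powers. Summed over a first, the harmonic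
  sums of \<open>gd 6\<close> and \<open>sd 6\<close> cancel except for one term.\<close>

lemma Md_has_sum: "(Md has_sum (2 * zt 2 * zt 6 - zt 8)) UNIV"
proof -
  define f where "f = (\<lambda>k a. rp 2 k * (gd 3 k a * gd 3 k a) + rp 2 k * (sd 3 k a * sd 3 k a))"
  have f0: "f k a \<ge> 0" for k a by (simp add: f_def)
  have 1: "((\<lambda>a. case (k, a) of (k, a) \<Rightarrow> f k a) has_sum rp 2 k * (2 * zt 6 - rp 6 k)) UNIV" for k
  proof -
    have g: "gd 3 k a * gd 3 k a = gd 6 a k" for a
      unfolding gd_eq[of 3] gd_eq[of 6] gd1_swap[of k] by (simp add: eval_nat_numeral)
    have s: "sd 3 k a * sd 3 k a = sd 6 a k" for a
      unfolding sd_eq[of 3] sd_eq[of 6] sd_swap[of 1 k] by (simp add: eval_nat_numeral)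
    have "(\<lambda>a. rp 2 k * gd 6 a k + rp 2 k * sd 6 a k) sums (rp 2 k * (zt 6 + (-1) ^ 6 * Hp 6 k) + rp 2 k * (zt 6 - Hp 6 (Suc k)))"
      by (intro sums_add sums_mult gd_sums sd_sums) auto
    also have "rp 2 k * (zt 6 + (-1) ^ 6 * Hp 6 k) + rp 2 k * (zt 6 - Hp 6 (Suc k)) = rp 2 k * (2 * zt 6 - rp 6 k)"
      by (simp add: Hp_Suc algebra_simps)
    finally have "(\<lambda>a. f k a) sums (rp 2 k * (2 * zt 6 - rp 6 k))" by (simp add: f_def g s)
    thus ?thesis using sums_nonneg_imp_has_sum[OF _ f0] by simp
  qed
  have "(\<lambda>k. 2 * zt 6 * rp 2 k - rp 8 k) sums (2 * zt 6 * zt 2 - zt 8)"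
    by (intro sums_diff sums_mult zt_sums) auto
  also have "(\<lambda>k. 2 * zt 6 * rp 2 k - rp 8 k) = (\<lambda>k. rp 2 k * (2 * zt 6 - rp 6 k))"
    using rp_mult[of 2 _ 6] by (simp add: fun_eq_iff algebra_simps)
  finally have s: "(\<lambda>k. rp 2 k * (2 * zt 6 - rp 6 k)) sums (2 * zt 6 * zt 2 - zt 8)" .
  have "rp 2 k * (2 * zt 6 - rp 6 k) \<ge> 0" for k
    using has_sum_nonneg[OF 1[of k]] f0 by simp
  hence 2: "((\<lambda>k. rp 2 k * (2 * zt 6 - rp 6 k)) has_sum (2 * zt 6 * zt 2 - zt 8)) UNIV"
    using s by (intro sums_nonneg_imp_has_sum)
  have "((\<lambda>(k, a). f k a) has_sum (2 * zt 6 * zt 2 - zt 8)) (UNIV \<times> UNIV)"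
    by (rule has_sum_SigmaI[OF 1 2]) (use summable_on_SigmaI[OF 1 has_sum_imp_summable[OF 2]] f0 in auto)
  hence 3: "((\<lambda>(a, k). f k a) has_sum (2 * zt 6 * zt 2 - zt 8)) (UNIV \<times> UNIV)"
    by (subst (asm) has_sum_swap) simp
  have "((\<lambda>k. f k a) has_sum Md a) UNIV" for a
    using Md_sums[of a] f0[of _ a] unfolding f_def by (intro sums_nonneg_imp_has_sum) auto
  with 3 have "(Md has_sum (2 * zt 6 * zt 2 - zt 8)) UNIV"
    by (intro has_sum_SigmaD[OF 3]) auto
  thus ?thesis by (simp add: mult_ac)
qed

lemma has_sum_diff_real:
  fixes f g :: "'a \<Rightarrow> real"
  assumes "(f has_sum S) A" "(g has_sum T) A" shows "((\<lambda>x. f x - g x) has_sum (S - T)) A"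
  using has_sum_add[OF assms(1) has_sum_cmult_right[OF assms(2), of "-1"]] by simp

text \<open>This comes from the part of \<open>K1\<close> with \<open>rp 1\<close>. Each half
  diverges in j on its own, so the difference is kept and telescoped.\<close>

lemma has_sum_tornheim:
  "((\<lambda>(d, j). rp 5 d * (rp 1 j - rp 1 (d + j + 1))) has_sum (dz 5 1 + zt 6)) UNIV"
proof -
  have 1: "((\<lambda>j. case (d, j) of (d, j) \<Rightarrow> rp 5 d * (rp 1 j - rp 1 (d + j + 1))) has_sum rp 5 d * Hp 1 (Suc d)) UNIV" for d
  proof -
    have "(\<lambda>j. rp 5 d * (rp 1 j - rp 1 (d + j + 1))) sums (rp 5 d * Hp 1 (Suc d))"
      using sums_mult[OF rp1_telescope[of "Suc d"]] by (simp add: add_ac)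
    thus ?thesis by (auto intro!: sums_nonneg_imp_has_sum mult_nonneg_nonneg simp: rp_def divide_simps)
  qed
  have "(\<lambda>d. rp 5 d * Hp 1 d + rp 6 d) sums (dz 5 1 + zt 6)"
    by (intro sums_add dz_sums zt_sums) (auto simp: dz_ok_def)
  also have "(\<lambda>d. rp 5 d * Hp 1 d + rp 6 d) = (\<lambda>d. rp 5 d * Hp 1 (Suc d))"
    using rp_mult[of 5 _ 1] by (simp add: Hp_Suc fun_eq_iff algebra_simps)
  finally have 2: "((\<lambda>d. rp 5 d * Hp 1 (Suc d)) has_sum (dz 5 1 + zt 6)) UNIV"
    by (rule sums_nonneg_imp_has_sum) auto
  have "(\<lambda>(d, j). rp 5 d * (rp 1 j - rp 1 (d + j + 1))) summable_on UNIV \<times> UNIV"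
    by (rule summable_on_SigmaI[OF 1 has_sum_imp_summable[OF 2]]) (auto simp: rp_def divide_simps)
  from has_sum_SigmaI[OF 1 2 this] show ?thesis by simp
qed

text \<open>The terms of \<open>Mf\<close> for b < a in order, with b = j, a = d + j + 1 and hence D
  = \<open>rp 1 d\<close>.\<close>

definition Rv :: real where
  "Rv = - 6 * zt 2 * dz 3 3 + 10 * dz 5 3 + 6 * zt 2 * (zt 3 * zt 3) - 10 * (zt 3 * zt 5)
     - 12 * zt 2 * dz 2 4 + 18 * dz 4 4 - 12 * zt 2 * (zt 4 * zt 2) + 18 * (zt 4 * zt 4)
     + 12 * zt 2 * (dz 5 1 + zt 6) + 18 * dz 3 5 - 18 * (zt 5 * zt 3) + 10 * dz 2 6 + 10 * (zt 6 * zt 2)"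

lemma Mf_has_sum_less: "((\<lambda>(a, b). Mf a b) has_sum Rv) {(a, b). b < a}"
proof -
  have dz: "((\<lambda>x. rp p (fst x + snd x + 1) * rp q (fst x)) has_sum dz p q) UNIV" if "dz_ok p q" for p q
    using has_sum_dz[OF that] by (simp add: case_prod_unfold)
  have zz: "((\<lambda>x. rp p (fst x) * rp q (snd x)) has_sum (zt p * zt q)) UNIV" if "p \<ge> 2" "q \<ge> 2" for p q
    using has_sum_zt_zt[OF that] by (simp add: case_prod_unfold)
  have to: "((\<lambda>x. rp 5 (fst x) * (rp 1 (snd x) - rp 1 (fst x + snd x + 1))) has_sum (dz 5 1 + zt 6)) UNIV"
    using has_sum_tornheim by (simp add: case_prod_unfold)
  have "((\<lambda>x::nat \<times> nat. (- 6 * zt 2) * (rp 3 (fst x + snd x + 1) * rp 3 (fst x)) + 10 * (rp 5 (fst x + snd x + 1) * rp 3 (fst x))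
     + 6 * zt 2 * (rp 3 (fst x) * rp 3 (snd x)) - 10 * (rp 3 (fst x) * rp 5 (snd x))
     - 12 * zt 2 * (rp 2 (fst x + snd x + 1) * rp 4 (fst x)) + 18 * (rp 4 (fst x + snd x + 1) * rp 4 (fst x))
     - 12 * zt 2 * (rp 4 (fst x) * rp 2 (snd x)) + 18 * (rp 4 (fst x) * rp 4 (snd x))
     + 12 * zt 2 * (rp 5 (fst x) * (rp 1 (snd x) - rp 1 (fst x + snd x + 1))) + 18 * (rp 3 (fst x + snd x + 1) * rp 5 (fst x))
     - 18 * (rp 5 (fst x) * rp 3 (snd x)) + 10 * (rp 2 (fst x + snd x + 1) * rp 6 (fst x)) + 10 * (rp 6 (fst x) * rp 2 (snd x))) has_sum Rv) UNIV"
    unfolding Rv_def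
    by (intro has_sum_add has_sum_diff_real has_sum_cmult_right dz zz to) (auto simp: dz_ok_def)
  also have "?this \<longleftrightarrow> ((\<lambda>(a, b). Mf a b) has_sum Rv) {(a, b). b < a}"
  proof (rule has_sum_reindex_bij_witness[of _ "\<lambda>(a, b). (a - b - 1, b)" "\<lambda>(d, j). (d + j + 1, j)"])
    fix x :: "nat \<times> nat"
    obtain d j where x: "x = (d, j)" by (cases x)
    define D i where "D = rp 1 d" "i = d + j + 1"
    have g: "gd 1 i j = D" by (simp add: gd_def rp_def D_i_def)
    have r: "rp 3 d = D ^ 3" "rp 4 d = D ^ 4" "rp 5 d = D ^ 5" "rp 6 d = D ^ 6"
      unfolding D_i_def by (rule rp_eq)+
    show "(case (case x of (d, j) \<Rightarrow> (d + j + 1, j)) of (a, b) \<Rightarrow> Mf a b) = (- 6 * zt 2) * (rp 3 (fst x + snd x + 1) * rp 3 (fst x)) + 10 * (rp 5 (fst x + snd x + 1) * rp 3 (fst x))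
     + 6 * zt 2 * (rp 3 (fst x) * rp 3 (snd x)) - 10 * (rp 3 (fst x) * rp 5 (snd x))
     - 12 * zt 2 * (rp 2 (fst x + snd x + 1) * rp 4 (fst x)) + 18 * (rp 4 (fst x + snd x + 1) * rp 4 (fst x))
     - 12 * zt 2 * (rp 4 (fst x) * rp 2 (snd x)) + 18 * (rp 4 (fst x) * rp 4 (snd x))
     + 12 * zt 2 * (rp 5 (fst x) * (rp 1 (snd x) - rp 1 (fst x + snd x + 1))) + 18 * (rp 3 (fst x + snd x + 1) * rp 5 (fst x))
     - 18 * (rp 5 (fst x) * rp 3 (snd x)) + 10 * (rp 2 (fst x + snd x + 1) * rp 6 (fst x)) + 10 * (rp 6 (fst x) * rp 2 (snd x))"
      unfolding x prod.case fst_conv snd_conv D_i_def(2)[symmetric] Mf_def g Let_def r K1_def K2_def K3_def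
      by (simp add: algebra_simps)
  qed auto
  finally show ?thesis .
qed

text \<open>The sum over \<open>k, a, b\<close> of \<open>k\<^sup>-\<^sup>2 ((k-a)\<^sup>-\<^sup>3 (k-b)\<^sup>-\<^sup>3 + (k+a)\<^sup>-\<^sup>3 (k+b)\<^sup>-\<^sup>3)\<close> is evaluated in two orders: first over
  \<open>a\<close> and \<open>b\<close>, which gives squares of harmonic sums, and first over \<open>k\<close> by partial fractions, which
  gives only double zeta values.\<close>

theorem A33_relation:
  "2 * A33 - 4 * zt 3 * dz 2 3 + 2 * zt 3 ^ 2 * zt 2 + 2 * dz 5 3 - 2 * zt 3 * zt 5 + zt 8
     = 2 * Rv + 2 * zt 2 * zt 6 - zt 8"
proof -
  define S where "S = 2 * A33 - 4 * zt 3 * dz 2 3 + 2 * zt 3 ^ 2 * zt 2 + 2 * dz 5 3 - 2 * zt 3 * zt 5 + zt 8"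
  define f where "f = (\<lambda>k a b. rp 2 k * (gd 3 k a * gd 3 k b) + rp 2 k * (sd 3 k a * sd 3 k b))"
  have "((\<lambda>x. (case x of (k, a, b) \<Rightarrow> rp 2 k * (gd 3 k a * gd 3 k b)) + (case x of (k, a, b) \<Rightarrow> rp 2 k * (sd 3 k a * sd 3 k b))) has_sum
     (A33 - 2 * zt 3 * dz 2 3 + zt 3 ^ 2 * zt 2) + (A33 - 2 * zt 3 * dz 2 3 + zt 3 ^ 2 * zt 2 + 2 * dz 5 3 - 2 * zt 3 * zt 5 + zt 8)) UNIV"
    by (intro has_sum_add sum_gd_part sum_sd_part)
  hence "((\<lambda>(k, ab). f k (fst ab) (snd ab)) has_sum S) (UNIV \<times> UNIV)"
    by (simp add: S_def f_def case_prod_unfold algebra_simps)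
  hence 3: "((\<lambda>(ab, k). f k (fst ab) (snd ab)) has_sum S) (UNIV \<times> UNIV)"
    by (subst (asm) has_sum_swap) simp
  have inner: "((\<lambda>k. f k a b) has_sum (if a = b then Md a else Mf a b)) UNIV" for a b
    using M_sums[of a b] Md_sums[of a] summable_M[of a b] unfolding f_def
    by (intro norm_summable_imp_has_sum) auto
  have tot: "((\<lambda>ab. if fst ab = snd ab then Md (fst ab) else Mf (fst ab) (snd ab)) has_sum S) UNIV"
    by (rule has_sum_SigmaD[OF 3]) (use inner in auto)
  have "((\<lambda>ab. Md (fst ab)) has_sum (2 * zt 2 * zt 6 - zt 8)) {ab. fst ab = (snd ab :: nat)} \<longleftrightarrow>
        (Md has_sum (2 * zt 2 * zt 6 - zt 8)) UNIV"
    by (rule has_sum_reindex_bij_witness[of _ "\<lambda>a. (a, a)" fst]) auto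
  hence "((\<lambda>ab. Md (fst ab)) has_sum (2 * zt 2 * zt 6 - zt 8)) {ab. fst ab = (snd ab :: nat)}"
    using Md_has_sum by simp
  also have "?this \<longleftrightarrow> ((\<lambda>ab. if fst ab = snd ab then Md (fst ab) else 0) has_sum (2 * zt 2 * zt 6 - zt 8)) (UNIV :: (nat \<times> nat) set)"
    by (rule has_sum_cong_neutral) auto
  finally have diag: "((\<lambda>ab. if fst ab = snd ab then Md (fst ab) else 0) has_sum (2 * zt 2 * zt 6 - zt 8)) (UNIV :: (nat \<times> nat) set)" .
  have "((\<lambda>ab. (if fst ab = snd ab then Md (fst ab) else Mf (fst ab) (snd ab)) - (if fst ab = snd ab then Md (fst ab) else 0)) has_sum
      (S - (2 * zt 2 * zt 6 - zt 8))) UNIV"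
    by (intro has_sum_diff_real tot diag)
  also have "(\<lambda>ab. (if fst ab = snd ab then Md (fst ab) else Mf (fst ab) (snd ab)) - (if fst ab = snd ab then Md (fst ab) else 0)) =
      (\<lambda>ab. if fst ab = snd ab then 0 else Mf (fst ab) (snd ab))" by auto
  finally have off: "((\<lambda>ab. if fst ab = snd ab then 0 else Mf (fst ab) (snd ab)) has_sum (S - (2 * zt 2 * zt 6 - zt 8))) UNIV" .
  have less: "((\<lambda>ab. Mf (fst ab) (snd ab)) has_sum Rv) {(a, b). b < a}"
    using Mf_has_sum_less by (simp add: case_prod_unfold)
  \<comment> \<open>The other half plane contributes the same amount because \<open>Mf\<close> is
    symmetric.\<close>
  have "((\<lambda>ab. Mf (fst ab) (snd ab)) has_sum Rv) {(a, b). a < b} \<longleftrightarrow> ((\<lambda>ab. Mf (fst ab) (snd ab)) has_sum Rv) {(a, b). b < a}"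
    by (rule has_sum_reindex_bij_witness[of _ prod.swap prod.swap]) (auto simp: Mf_swap)
  hence gr: "((\<lambda>ab. Mf (fst ab) (snd ab)) has_sum Rv) {(a, b). a < b}" using less by simp
  have "((\<lambda>ab. Mf (fst ab) (snd ab)) has_sum (Rv + Rv)) ({(a, b). b < a} \<union> {(a, b). a < b})"
    by (rule has_sum_Un_disjoint[OF less gr]) auto
  also have "?this \<longleftrightarrow> ((\<lambda>ab. if fst ab = snd ab then 0 else Mf (fst ab) (snd ab)) has_sum (Rv + Rv)) UNIV"
    by (rule has_sum_cong_neutral) auto
  finally have "Rv + Rv = S - (2 * zt 2 * zt 6 - zt 8)" using off has_sum_unique by blast
  thus ?thesis by (simp add: S_def)
qed

section \<open>Taylor coefficients\<close>

lemma Polygamma_1: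
  assumes "n > 0" shows "Polygamma n (1 :: complex) = (-1) ^ Suc n * fact n * of_real (zt (Suc n))"
proof -
  have "(\<lambda>k. of_real (rp (Suc n) k) :: complex) sums of_real (zt (Suc n))"
    using assms by (intro sums_of_real zt_sums) auto
  also have "(\<lambda>k. of_real (rp (Suc n) k) :: complex) = (\<lambda>k. inverse ((1 + of_nat k) ^ Suc n))"
    by (simp add: rp_def fun_eq_iff inverse_eq_divide)
  finally show ?thesis using assms by (simp add: Polygamma_def sums_iff)
qed

text \<open>The Taylor series of \<open>\<psi>(1 + cz)\<close>.\<close>

definition DG :: "complex \<Rightarrow> complex fps" where
  "DG c = Abs_fps (\<lambda>n. if n = 0 then - euler_mascheroni else c ^ n * ((-1) ^ Suc n * of_real (zt (Suc n))))"

lemma small_strip: "z \<in> ball 0 (1/2) \<Longrightarrow> norm c \<le> 2 \<Longrightarrow> \<bar>Re (c * z)\<bar> < 1" for z c :: complex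
proof -
  assume z: "z \<in> ball 0 (1/2)" "norm c \<le> 2"
  have "norm (c * z) \<le> 2 * norm z" using z by (simp add: norm_mult mult_right_mono)
  thus ?thesis using z abs_Re_le_cmod[of "c * z"] by simp
qed

lemma Digamma_has_fps:
  assumes "norm c \<le> 2"
  shows "(\<lambda>z. Digamma (1 + c * z)) has_fps_expansion DG c"
proof -
  have pos: "1 + c * z \<notin> \<int>\<^sub>\<le>\<^sub>0" if "z \<in> ball 0 (1/2)" for z
    by (rule strip_not_nonpos_Int(1)[OF small_strip[OF that assms]])
  have "(\<lambda>z. Digamma (1 + c * z)) holomorphic_on ball 0 (1/2)"
  proof -
    have "(Polygamma 0 \<circ> (\<lambda>z. 1 + c * z)) holomorphic_on ball 0 (1/2)"
      by (rule holomorphic_on_compose_gen[where t = "- \<int>\<^sub>\<le>\<^sub>0"]) (use pos in \<open>auto intro!: holomorphic_intros\<close>)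
    thus ?thesis by (simp add: o_def)
  qed
  hence 1: "(\<lambda>z. Digamma (1 + c * z)) has_fps_expansion fps_expansion (\<lambda>z. Digamma (1 + c * z)) 0"
    by (intro has_fps_expansion_fps_expansion[of "ball 0 (1/2)"]) auto
  have "fps_nth (fps_expansion (\<lambda>z. Digamma (1 + c * z)) 0) n = fps_nth (DG c) n" for n
  proof -
    have "(deriv ^^ n) (\<lambda>z. Digamma (c * z + 1)) 0 = c ^ n * (deriv ^^ n) Digamma (c * 0 + 1)"
      by (rule higher_deriv_compose_linear'[where S = "ball 0 (1/2)" and T = "- \<int>\<^sub>\<le>\<^sub>0"])
         (use pos in \<open>auto intro!: holomorphic_intros simp: add.commute\<close>)
    hence "(deriv ^^ n) (\<lambda>z. Digamma (1 + c * z)) 0 = c ^ n * (deriv ^^ n) Digamma (1 :: complex)"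
      by (simp add: add.commute)
    also have "(deriv ^^ n) Digamma (1 :: complex) = Polygamma n 1"
      using higher_deriv_Polygamma[of "1::complex" n 0] by simp
    finally have "(deriv ^^ n) (\<lambda>z. Digamma (1 + c * z)) 0 = c ^ n * Polygamma n 1" .
    thus ?thesis unfolding fps_nth_fps_expansion[OF 1] DG_def
      by (cases "n = 0") (simp_all add: Polygamma_1)
  qed
  thus ?thesis using 1 by (metis fps_ext)
qed

text \<open>f' = f l becomes F' = F L, a recursion that computes the coefficients of F one by one
  from those of the logarithmic derivative.\<close>

lemma has_fps_expansion_log_deriv:
  fixes f l :: "complex \<Rightarrow> complex"
  assumes A: "open A" "0 \<in> A" and f: "\<And>z. z \<in> A \<Longrightarrow> (f has_field_derivative f z * l z) (at z)"
    and L: "l has_fps_expansion L"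
  obtains F where "f has_fps_expansion F" "fps_deriv F = F * L" "fps_nth F 0 = f 0"
proof -
  have "f holomorphic_on A" using A f by (auto simp: holomorphic_on_open)
  hence F: "f has_fps_expansion fps_expansion f 0"
    using A by (intro has_fps_expansion_fps_expansion) auto
  have 1: "deriv f has_fps_expansion fps_deriv (fps_expansion f 0)"
    by (rule has_fps_expansion_deriv[OF F])
  have "eventually (\<lambda>z. z \<in> A) (nhds 0)" using A by (intro eventually_nhds_in_open)
  hence "eventually (\<lambda>z. deriv f z = f z * l z) (nhds 0)"
    by eventually_elim (use f in \<open>auto intro: DERIV_imp_deriv\<close>)
  hence "(\<lambda>z. f z * l z) has_fps_expansion fps_deriv (fps_expansion f 0)"
    using 1 has_fps_expansion_cong[of "deriv f" "\<lambda>z. f z * l z"] by blast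
  moreover have "(\<lambda>z. f z * l z) has_fps_expansion fps_expansion f 0 * L"
    by (intro has_fps_expansion_mult F L)
  ultimately have "fps_deriv (fps_expansion f 0) = fps_expansion f 0 * L"
    by (rule fps_expansion_unique_complex)
  moreover have "fps_nth (fps_expansion f 0) 0 = f 0" using has_fps_expansion_imp_0_eq_fps_nth_0[OF F] by simp
  ultimately show ?thesis using that[OF F] by blast
qed

lemma Gamma_has_deriv:
  fixes z c :: complex
  assumes "\<bar>Re (c * z)\<bar> < 1"
  shows "((\<lambda>z. Gamma (1 + c * z)) has_field_derivative Gamma (1 + c * z) * (c * Digamma (1 + c * z))) (at z)"
    and "((\<lambda>z. rGamma (1 + c * z)) has_field_derivative rGamma (1 + c * z) * (- c * Digamma (1 + c * z))) (at z)"
proof -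
  have "1 + c * z \<notin> \<int>\<^sub>\<le>\<^sub>0" using strip_not_nonpos_Int[OF assms] by simp
  thus "((\<lambda>z. Gamma (1 + c * z)) has_field_derivative Gamma (1 + c * z) * (c * Digamma (1 + c * z))) (at z)"
       "((\<lambda>z. rGamma (1 + c * z)) has_field_derivative rGamma (1 + c * z) * (- c * Digamma (1 + c * z))) (at z)"
    by (auto intro!: derivative_eq_intros)
qed

lemma has_field_derivative_log_power:
  assumes "(f has_field_derivative f z * l) (at z)"
  shows "((\<lambda>z. f z ^ n) has_field_derivative f z ^ n * (of_nat n * l)) (at z)"
  using DERIV_power[OF assms, of n] by (rule DERIV_cong) (cases n, simp_all add: mult_ac)

lemma has_field_derivative_log_mult:
  assumes "(f has_field_derivative f z * l) (at z)" "(g has_field_derivative g z * m) (at z)"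
  shows "((\<lambda>z. f z * g z) has_field_derivative f z * g z * (l + m)) (at z)"
  by (auto intro!: derivative_eq_intros assms simp: algebra_simps)

text \<open>The logarithmic derivative of \<open>\<Gamma>(1+a)\<^sup>i \<Gamma>(1-a)\<^sup>j / \<Gamma>(1+2a)\<^sup>k\<close>.\<close>

definition LG :: "nat \<Rightarrow> nat \<Rightarrow> nat \<Rightarrow> complex fps" where
  "LG i j k = fps_const (of_nat i) * (fps_const 1 * DG 1) + fps_const (of_nat j) * (fps_const (-1) * DG (-1))
     + fps_const (of_nat k) * (fps_const (-2) * DG 2)"

lemma LG_nth: "fps_nth (LG i j k) n = (of_nat i - of_nat j * (-1) ^ n - 2 * of_nat k * 2 ^ n) *
    (if n = 0 then - euler_mascheroni else (-1) ^ Suc n * of_real (zt (Suc n)))"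
  by (simp add: LG_def DG_def algebra_simps)

lemma Gamma_product_fps:
  obtains F where "(\<lambda>a. Gamma (1 + a) ^ i * Gamma (1 - a) ^ j * rGamma (1 + 2 * a) ^ k) has_fps_expansion F"
    "fps_deriv F = F * LG i j k" "fps_nth F 0 = 1"
proof (rule has_fps_expansion_log_deriv[where A = "ball 0 (1/2)" and L = "LG i j k"
     and f = "\<lambda>a. Gamma (1 + a) ^ i * Gamma (1 - a) ^ j * rGamma (1 + 2 * a) ^ k"
     and l = "\<lambda>z. of_nat i * (1 * Digamma (1 + 1 * z)) + of_nat j * (-1 * Digamma (1 + (-1) * z)) + of_nat k * (-2 * Digamma (1 + 2 * z))"])
  show "(\<lambda>z. of_nat i * (1 * Digamma (1 + 1 * z)) + of_nat j * (-1 * Digamma (1 + (-1) * z)) + of_nat k * (-2 * Digamma (1 + 2 * z)))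
      has_fps_expansion LG i j k"
    unfolding LG_def by (intro fps_expansion_intros Digamma_has_fps) auto
  fix z :: complex assume z: "z \<in> ball 0 (1/2)"
  have d: "((\<lambda>z. Gamma (1 + 1 * z)) has_field_derivative Gamma (1 + 1 * z) * (1 * Digamma (1 + 1 * z))) (at z)"
     "((\<lambda>z. Gamma (1 + (-1) * z)) has_field_derivative Gamma (1 + (-1) * z) * ((-1) * Digamma (1 + (-1) * z))) (at z)"
     "((\<lambda>z. rGamma (1 + 2 * z)) has_field_derivative rGamma (1 + 2 * z) * (- 2 * Digamma (1 + 2 * z))) (at z)"
    by (rule Gamma_has_deriv[OF small_strip[OF z]]; simp)+
  show "((\<lambda>a. Gamma (1 + a) ^ i * Gamma (1 - a) ^ j * rGamma (1 + 2 * a) ^ k) has_field_derivative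
      Gamma (1 + z) ^ i * Gamma (1 - z) ^ j * rGamma (1 + 2 * z) ^ k *
      (of_nat i * (1 * Digamma (1 + 1 * z)) + of_nat j * (-1 * Digamma (1 + (-1) * z)) + of_nat k * (-2 * Digamma (1 + 2 * z)))) (at z)"
    using has_field_derivative_log_mult[OF has_field_derivative_log_mult[OF d(1)[THEN has_field_derivative_log_power, of i]
        d(2)[THEN has_field_derivative_log_power, of j]] d(3)[THEN has_field_derivative_log_power, of k]] by simp
qed (auto intro: that)

text \<open>The values of zeta at even arguments come from comparing the expansion of
  \<open>\<Gamma>(1+a)\<Gamma>(1-a)\<close> with \<open>\<pi>a/sin(\<pi>a)\<close>.\<close>

lemma Q_sin_fps:
  fixes F :: "complex fps"
  assumes "(\<lambda>a. Gamma (1 + a) * Gamma (1 - a)) has_fps_expansion F"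
  shows "F * fps_sin (of_real pi) = fps_const (of_real pi) * fps_X"
proof -
  have "(\<lambda>a. Gamma (1 + a) * Gamma (1 - a) * sin (of_real pi * a)) has_fps_expansion F * fps_sin (of_real pi)"
    by (intro has_fps_expansion_mult assms has_fps_expansion_sin)
  moreover have ev: "\<forall>\<^sub>F a in nhds 0. Gamma (1 + a) * Gamma (1 - a) * sin (of_real pi * a) = of_real pi * (a :: complex)"
  proof -
    have "\<forall>\<^sub>F a in nhds 0. a \<in> ball (0 :: complex) 1" by (intro eventually_nhds_in_open) auto
    thus ?thesis
    proof eventually_elim
      case (elim a)
      hence "\<bar>Re a\<bar> < 1" using abs_Re_le_cmod[of a] by simp
      hence nz: "Gamma (1 + a) \<noteq> 0" "Gamma (1 - a) \<noteq> 0" using strip_not_nonpos_Int[of a] by (auto simp: Gamma_eq_zero_iff)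
      show ?case
      proof (cases "a = 0")
        case False
        have "sin (of_real pi * a) \<noteq> 0" using nz Gamma_reflection_strip[OF False] by auto
        thus ?thesis using Gamma_reflection_strip[OF False] by simp
      qed auto
    qed
  qed
  ultimately have "(\<lambda>a. of_real pi * a) has_fps_expansion F * fps_sin (of_real pi)"
    using has_fps_expansion_cong[OF ev refl] by simp
  moreover have "(\<lambda>a. of_real pi * a) has_fps_expansion fps_const (of_real pi :: complex) * fps_X"
    by (intro fps_expansion_intros)
  ultimately show ?thesis by (rule fps_expansion_unique_complex)
qed

text \<open>Order 9 is the last one used: the seventh derivative of \<open>Sf\<close> is read from
  a^9 in \<open>Kf\<close>, which carries an extra a^2.\<close>

lemma fps_mult_nths:
  fixes F G :: "'a :: comm_ring_1 fps"
  shows "fps_nth (F * G) 0 = fps_nth F 0 * fps_nth G 0"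
    "fps_nth (F * G) 1 = fps_nth F 0 * fps_nth G 1 + fps_nth F 1 * fps_nth G 0"
    "fps_nth (F * G) 2 = fps_nth F 0 * fps_nth G 2 + fps_nth F 1 * fps_nth G 1 + fps_nth F 2 * fps_nth G 0"
    "fps_nth (F * G) 3 = fps_nth F 0 * fps_nth G 3 + fps_nth F 1 * fps_nth G 2 + fps_nth F 2 * fps_nth G 1 + fps_nth F 3 * fps_nth G 0"
    "fps_nth (F * G) 4 = fps_nth F 0 * fps_nth G 4 + fps_nth F 1 * fps_nth G 3 + fps_nth F 2 * fps_nth G 2 + fps_nth F 3 * fps_nth G 1 + fps_nth F 4 * fps_nth G 0"
    "fps_nth (F * G) 5 = fps_nth F 0 * fps_nth G 5 + fps_nth F 1 * fps_nth G 4 + fps_nth F 2 * fps_nth G 3 + fps_nth F 3 * fps_nth G 2 + fps_nth F 4 * fps_nth G 1 + fps_nth F 5 * fps_nth G 0"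
    "fps_nth (F * G) 6 = fps_nth F 0 * fps_nth G 6 + fps_nth F 1 * fps_nth G 5 + fps_nth F 2 * fps_nth G 4 + fps_nth F 3 * fps_nth G 3 + fps_nth F 4 * fps_nth G 2 + fps_nth F 5 * fps_nth G 1 + fps_nth F 6 * fps_nth G 0"
    "fps_nth (F * G) 7 = fps_nth F 0 * fps_nth G 7 + fps_nth F 1 * fps_nth G 6 + fps_nth F 2 * fps_nth G 5 + fps_nth F 3 * fps_nth G 4 + fps_nth F 4 * fps_nth G 3 + fps_nth F 5 * fps_nth G 2 + fps_nth F 6 * fps_nth G 1 + fps_nth F 7 * fps_nth G 0"
    "fps_nth (F * G) 8 = fps_nth F 0 * fps_nth G 8 + fps_nth F 1 * fps_nth G 7 + fps_nth F 2 * fps_nth G 6 + fps_nth F 3 * fps_nth G 5 + fps_nth F 4 * fps_nth G 4 + fps_nth F 5 * fps_nth G 3 + fps_nth F 6 * fps_nth G 2 + fps_nth F 7 * fps_nth G 1 + fps_nth F 8 * fps_nth G 0"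
    "fps_nth (F * G) 9 = fps_nth F 0 * fps_nth G 9 + fps_nth F 1 * fps_nth G 8 + fps_nth F 2 * fps_nth G 7 + fps_nth F 3 * fps_nth G 6 + fps_nth F 4 * fps_nth G 5 + fps_nth F 5 * fps_nth G 4 + fps_nth F 6 * fps_nth G 3 + fps_nth F 7 * fps_nth G 2 + fps_nth F 8 * fps_nth G 1 + fps_nth F 9 * fps_nth G 0"
  by (simp_all add: fps_mult_nth eval_nat_numeral add_ac)

lemma fps_log_deriv_nths:
  fixes F L :: "complex fps"
  assumes "fps_deriv F = F * L"
  shows "fps_nth F 1 = fps_nth (F * L) 0" "fps_nth F 2 = fps_nth (F * L) 1 / 2"
    "fps_nth F 3 = fps_nth (F * L) 2 / 3"
    "fps_nth F 4 = fps_nth (F * L) 3 / 4"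
    "fps_nth F 5 = fps_nth (F * L) 4 / 5"
    "fps_nth F 6 = fps_nth (F * L) 5 / 6"
    "fps_nth F 7 = fps_nth (F * L) 6 / 7"
    "fps_nth F 8 = fps_nth (F * L) 7 / 8"
    "fps_nth F 9 = fps_nth (F * L) 8 / 9"
proof -
  have 1: "fps_nth F n = fps_nth (F * L) (n - 1) / of_nat n" if "n > 0" for n
    unfolding assms[symmetric] using that by simp
  show "fps_nth F 1 = fps_nth (F * L) 0" "fps_nth F 2 = fps_nth (F * L) 1 / 2"
    "fps_nth F 3 = fps_nth (F * L) 2 / 3"
    "fps_nth F 4 = fps_nth (F * L) 3 / 4"
    "fps_nth F 5 = fps_nth (F * L) 4 / 5"
    "fps_nth F 6 = fps_nth (F * L) 5 / 6"
    "fps_nth F 7 = fps_nth (F * L) 6 / 7"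
    "fps_nth F 8 = fps_nth (F * L) 7 / 8"
    "fps_nth F 9 = fps_nth (F * L) 8 / 9"
    by (simp_all add: 1)
qed

lemma fps_sin_nths:
  fixes c :: complex
  shows "fps_nth (fps_sin c) 0 = 0" "fps_nth (fps_sin c) 1 = c" "fps_nth (fps_sin c) 2 = 0" "fps_nth (fps_sin c) 3 = - (c ^ 3) / 6"
    "fps_nth (fps_sin c) 4 = 0" "fps_nth (fps_sin c) 5 = c ^ 5 / 120" "fps_nth (fps_sin c) 6 = 0"
    "fps_nth (fps_sin c) 7 = - (c ^ 7) / 5040" "fps_nth (fps_sin c) 8 = 0" "fps_nth (fps_sin c) 9 = c ^ 9 / 362880"
  by (simp_all add: fps_sin_def fact_numeral)

lemma zt_even:
  "zt 2 = pi ^ 2 / 6" "zt 4 = pi ^ 4 / 90" "zt 6 = pi ^ 6 / 945" "zt 8 = pi ^ 8 / 9450"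
proof -
  obtain F where F: "(\<lambda>a. Gamma (1 + a) * Gamma (1 - a)) has_fps_expansion F" "fps_deriv F = F * LG 1 1 0" "fps_nth F 0 = 1"
    using Gamma_product_fps[of 1 1 0] by auto
  have L: "fps_nth (LG 1 1 0) 0 = 0" "fps_nth (LG 1 1 0) 1 = 2 * of_real (zt 2)" "fps_nth (LG 1 1 0) 2 = 0"
    "fps_nth (LG 1 1 0) 3 = 2 * of_real (zt 4)" "fps_nth (LG 1 1 0) 4 = 0" "fps_nth (LG 1 1 0) 5 = 2 * of_real (zt 6)"
    "fps_nth (LG 1 1 0) 6 = 0" "fps_nth (LG 1 1 0) 7 = 2 * of_real (zt 8)" "fps_nth (LG 1 1 0) 8 = 0"
    by (simp_all add: LG_nth numeral_2_eq_2[symmetric])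
  define p where "p = complex_of_real pi"
  have p: "p \<noteq> 0" by (simp add: p_def)
  define x2 x4 x6 x8 where x: "x2 = complex_of_real (zt 2)" "x4 = complex_of_real (zt 4)" "x6 = complex_of_real (zt 6)" "x8 = complex_of_real (zt 8)"
  note nth = fps_log_deriv_nths[OF F(2), unfolded fps_mult_nths F(3) L, folded x]
  have f1: "fps_nth F 1 = 0" using nth(1) by simp
  have f2: "fps_nth F 2 = x2" using nth(2) f1 by simp
  have f3: "fps_nth F 3 = 0" using nth(3) f1 f2 by simp
  have f4: "fps_nth F 4 = (2 * x4 + 2 * x2 * x2) / 4" using nth(4) f1 f2 f3 by simp
  have f5: "fps_nth F 5 = 0" using nth(5) f1 f2 f3 f4 by simp
  have f6: "fps_nth F 6 = (2 * x6 + 2 * x2 * x4 + fps_nth F 4 * (2 * x2)) / 6" using nth(6) f1 f2 f3 f5 by simp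
  have f7: "fps_nth F 7 = 0" using nth(7) f1 f2 f3 f4 f5 f6 by simp
  have f8: "fps_nth F 8 = (2 * x8 + 2 * x2 * x6 + fps_nth F 4 * (2 * x4) + fps_nth F 6 * (2 * x2)) / 8"
    using nth(8) f1 f2 f3 f5 f7 by simp
  have eq: "fps_nth (F * fps_sin p) n = (if n = 1 then p else 0)" for n
    using Q_sin_fps[OF F(1)] by (simp add: p_def)
  have "p * (x2 - p ^ 2 / 6) = 0"
    using eq[of 3] unfolding fps_mult_nths fps_sin_nths F(3) f1 f2 f3 by (simp add: field_simps eval_nat_numeral)
  hence x2: "x2 = p ^ 2 / 6" using p by simp
  have "p * (x4 - p ^ 4 / 90) = 0"
    using eq[of 5] unfolding fps_mult_nths fps_sin_nths F(3) f1 f2 f3 f4 f5 x2 by (simp add: field_simps eval_nat_numeral)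
  hence x4: "x4 = p ^ 4 / 90" using p by simp
  have "p * (x6 - p ^ 6 / 945) = 0"
    using eq[of 7] unfolding fps_mult_nths fps_sin_nths F(3) f1 f2 f3 f6 f5 f7 f4 x4 x2 by (simp add: field_simps eval_nat_numeral)
  hence x6: "x6 = p ^ 6 / 945" using p by simp
  have "p * (x8 - p ^ 8 / 9450) = 0"
    using eq[of 9] unfolding fps_mult_nths fps_sin_nths F(3) f1 f2 f3 f8 f7 f6 f5 f4 x6 x4 x2 by (simp add: field_simps eval_nat_numeral)
  hence x8: "x8 = p ^ 8 / 9450" using p by simp
  have "complex_of_real (zt 2) = of_real (pi ^ 2 / 6)" "complex_of_real (zt 4) = of_real (pi ^ 4 / 90)"
    "complex_of_real (zt 6) = of_real (pi ^ 6 / 945)" "complex_of_real (zt 8) = of_real (pi ^ 8 / 9450)"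
    using x2 x4 x6 x8 by (simp_all add: x p_def)
  thus "zt 2 = pi ^ 2 / 6" "zt 4 = pi ^ 4 / 90" "zt 6 = pi ^ 6 / 945" "zt 8 = pi ^ 8 / 9450"
    unfolding of_real_eq_iff by blast+
qed

section \<open>Taylor coefficients of \<open>E0\<close>, \<open>g0\<close>, \<open>V0\<close> and of
  the products in \<open>V\<close>\<close>

text \<open>Negative signs occur at odd k, that is at even integers k + 1, whose share of the zeta
  value is 2^(-p).\<close>

lemma eta_sums:
  assumes "p \<ge> 2" shows "(\<lambda>k. (-1) ^ k * rp p k) sums ((1 - 2 / 2 ^ p) * zt p)"
proof -
  have e: "2 / 2 ^ p * rp p m = 2 * rp p (2 * m + 1)" for m
  proof -
    have "real (Suc (2 * m + 1)) = 2 * real (Suc m)" by simp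
    thus ?thesis unfolding rp_def by (simp only: power_mult_distrib) simp
  qed
  have "(\<lambda>m. 2 / 2 ^ p * rp p m) sums (2 / 2 ^ p * zt p)" by (intro sums_mult zt_sums assms)
  hence "(\<lambda>m. 2 * rp p (2 * m + 1)) sums (2 / 2 ^ p * zt p)" by (simp only: e)
  hence "(\<lambda>m. (\<lambda>k. if odd k then 2 * rp p k else 0) (2 * m + 1)) sums (2 / 2 ^ p * zt p)" by simp
  hence "(\<lambda>k. if odd k then 2 * rp p k else 0) sums (2 / 2 ^ p * zt p)"
    by (subst (asm) sums_mono_reindex) (auto simp: strict_mono_def elim!: oddE)
  from sums_diff[OF zt_sums[OF assms] this]
  have "(\<lambda>k. rp p k - (if odd k then 2 * rp p k else 0)) sums (zt p - 2 / 2 ^ p * zt p)" .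
  also have "(\<lambda>k. rp p k - (if odd k then 2 * rp p k else 0)) = (\<lambda>k. (-1) ^ k * rp p k)" by auto
  also have "zt p - 2 / 2 ^ p * zt p = (1 - 2 / 2 ^ p) * zt p" by (simp add: algebra_simps)
  finally show ?thesis .
qed

definition geom_fps :: "complex \<Rightarrow> complex fps" where
  "geom_fps c = Abs_fps (\<lambda>n. if even n then 1 / c ^ (n div 2 + 1) else 0)"

lemma geom_fps_eq:
  assumes "c \<noteq> 0" shows "inverse (fps_const c - fps_X ^ 2) = geom_fps c"
proof (rule fps_inverse_unique)
  show "(fps_const c - fps_X ^ 2) * geom_fps c = 1"
  proof (rule fps_ext)
    fix n show "fps_nth ((fps_const c - fps_X ^ 2) * geom_fps c) n = fps_nth 1 n"
    proof (cases "n < 2")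
      case True
      hence "n = 0 \<or> n = 1" by auto
      thus ?thesis using assms by (auto simp: left_diff_distrib fps_X_power_mult_nth geom_fps_def)
    next
      case False
      then obtain m where "n = Suc (Suc m)" by (metis Suc_1 add_2_eq_Suc le_Suc_ex not_le)
      thus ?thesis using assms by (auto simp: left_diff_distrib fps_X_power_mult_nth geom_fps_def)
    qed
  qed
qed

lemma has_fps_expansion_geom:
  assumes "c \<noteq> 0" shows "(\<lambda>z. inverse (c - z\<^sup>2)) has_fps_expansion geom_fps c"
proof -
  have "(\<lambda>z. inverse (c - z ^ 2)) has_fps_expansion inverse (fps_const c - fps_X ^ 2)"
    using assms by (intro fps_expansion_intros) auto
  thus ?thesis by (simp add: geom_fps_eq[OF assms])
qed

lemma geom_fps_nths:
  "fps_nth (geom_fps c) 0 = 1 / c" "fps_nth (geom_fps c) 1 = 0" "fps_nth (geom_fps c) 2 = 1 / c ^ 2"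
  "fps_nth (geom_fps c) 3 = 0" "fps_nth (geom_fps c) 4 = 1 / c ^ 3" "fps_nth (geom_fps c) 5 = 0"
  "fps_nth (geom_fps c) 6 = 1 / c ^ 4"
  by (simp_all add: geom_fps_def power2_eq_square)

lemma of_real_rp: "complex_of_real (rp p k) = 1 / of_nat (Suc k) ^ p"
  by (simp add: rp_def)

lemma ball_half_strip: "z \<in> ball 0 (1/2) \<Longrightarrow> 2 * \<bar>Re z\<bar> \<le> real (Suc k)"
  using abs_Re_le_cmod[of z] by simp

lemma E0_fps:
  obtains F where "E0 has_fps_expansion F" "fps_nth F 0 = 2 * of_real (zt 3)" "fps_nth F 2 = 2 * of_real (zt 5)"
    "fps_nth F 4 = 2 * of_real (zt 7)" "fps_nth F 6 = 2 * of_real (zt 9)"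
proof -
  define f where "f = (\<lambda>k (z::complex). 2 / (of_nat (Suc k) * (of_nat (Suc k) ^ 2 - z\<^sup>2)))"
  define T where "T = (\<lambda>k. fps_const (2 / of_nat (Suc k)) * geom_fps (of_nat (Suc k) ^ 2))"
  have c0: "of_nat (Suc k) ^ 2 \<noteq> (0::complex)" for k by (simp del: of_nat_Suc)
  have T: "f k has_fps_expansion T k" for k
  proof -
    have "(\<lambda>z. 2 / of_nat (Suc k) * inverse (of_nat (Suc k) ^ 2 - z\<^sup>2)) has_fps_expansion T k"
      unfolding T_def by (intro fps_expansion_intros has_fps_expansion_geom c0)
    thus ?thesis by (simp add: f_def divide_inverse mult.assoc del: of_nat_Suc)
  qed
  have hol: "f k holomorphic_on ball 0 (1/2)" for k
    unfolding f_def using strip_nz small_strip[of _ 1]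
    by (intro holomorphic_intros) (auto simp del: of_nat_Suc)
  have E: "E0 = (\<lambda>z. \<Sum>k. f k z)" by (simp add: E0_def f_def fun_eq_iff)
  have bd: "\<forall>k. \<forall>z\<in>ball 0 (1/2). norm (f k z) \<le> 8 * (1 / real (Suc k) ^ 3)"
    unfolding f_def by (intro allI ballI norm_E0_term ball_half_strip)
  have sm: "summable (\<lambda>k. 8 * (1 / real (Suc k) ^ 3))" by (intro summable_mult summable_inverse_power_Suc) auto
  have 0: "0 \<in> ball (0::complex) (1/2)" by simp
  note S = has_fps_expansion_suminf[OF open_ball 0 hol sm bd T, folded E]
  have s: "(\<lambda>k. complex_of_real (2 * rp p k)) sums (2 * of_real (zt p))" if "p \<ge> 2" for p
    using sums_of_real[OF sums_mult[OF zt_sums[OF that], of 2]] by simp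
  have n: "fps_nth (T k) 0 = of_real (2 * rp 3 k)" "fps_nth (T k) 2 = of_real (2 * rp 5 k)"
     "fps_nth (T k) 4 = of_real (2 * rp 7 k)" "fps_nth (T k) 6 = of_real (2 * rp 9 k)" for k
    unfolding T_def of_real_mult of_real_rp fps_mult_left_const_nth geom_fps_nths
    by (simp_all add: eval_nat_numeral del: of_nat_Suc)
  show ?thesis
  proof (rule that[OF S(2)])
    let ?F = "fps_expansion E0 0"
    show "fps_nth ?F 0 = 2 * of_real (zt 3)" using sums_unique2[OF S(1)[of 0, unfolded n] s[of 3]] by simp
    show "fps_nth ?F 2 = 2 * of_real (zt 5)" using sums_unique2[OF S(1)[of 2, unfolded n] s[of 5]] by simp
    show "fps_nth ?F 4 = 2 * of_real (zt 7)" using sums_unique2[OF S(1)[of 4, unfolded n] s[of 7]] by simp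
    show "fps_nth ?F 6 = 2 * of_real (zt 9)" using sums_unique2[OF S(1)[of 6, unfolded n] s[of 9]] by simp
  qed
qed

text \<open>At z^(2m) the squared geometric series contributes m + 1 and the alternating sum 1 - 2 /
  2^(2m+3); for instance 15/8 = 2 (1 - 2/32).\<close>

lemma g0_fps:
  obtains F where "g0 has_fps_expansion F" "fps_nth F 0 = 3 / 4 * of_real (zt 3)" "fps_nth F 2 = 15 / 8 * of_real (zt 5)"
    "fps_nth F 4 = 189 / 64 * of_real (zt 7)" "fps_nth F 6 = 255 / 64 * of_real (zt 9)"
    "fps_nth F 1 = 0" "fps_nth F 3 = 0" "fps_nth F 5 = 0"
proof -
  define f where "f = (\<lambda>k (z::complex). (-1) ^ k * of_nat (Suc k) / (of_nat (Suc k) ^ 2 - z\<^sup>2) ^ 2)"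
  define T where "T = (\<lambda>k. fps_const ((-1) ^ k * of_nat (Suc k)) * (geom_fps (of_nat (Suc k) ^ 2) * geom_fps (of_nat (Suc k) ^ 2)))"
  have c0: "of_nat (Suc k) ^ 2 \<noteq> (0::complex)" for k by (simp del: of_nat_Suc)
  have T: "f k has_fps_expansion T k" for k
  proof -
    have "(\<lambda>z. (-1) ^ k * of_nat (Suc k) * (inverse (of_nat (Suc k) ^ 2 - z\<^sup>2) * inverse (of_nat (Suc k) ^ 2 - z\<^sup>2))) has_fps_expansion T k"
      unfolding T_def by (intro fps_expansion_intros has_fps_expansion_geom c0)
    thus ?thesis by (simp add: f_def divide_inverse power2_eq_square del: of_nat_Suc)
  qed
  have hol: "f k holomorphic_on ball 0 (1/2)" for k
    unfolding f_def using strip_nz small_strip[of _ 1]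
    by (intro holomorphic_intros) (auto simp del: of_nat_Suc)
  have E: "g0 = (\<lambda>z. \<Sum>k. f k z)" by (simp add: g0_def f_def fun_eq_iff)
  have bd: "\<forall>k. \<forall>z\<in>ball 0 (1/2). norm (f k z) \<le> 16 * (1 / real (Suc k) ^ 3)"
    unfolding f_def by (intro allI ballI norm_g0_term ball_half_strip)
  have sm: "summable (\<lambda>k. 16 * (1 / real (Suc k) ^ 3))" by (intro summable_mult summable_inverse_power_Suc) auto
  have 0: "0 \<in> ball (0::complex) (1/2)" by simp
  note S = has_fps_expansion_suminf[OF open_ball 0 hol sm bd T, folded E]
  have s: "(\<lambda>k. complex_of_real (m * ((-1) ^ k * rp p k))) sums of_real (m * ((1 - 2 / 2 ^ p) * zt p))" if "p \<ge> 2" for m p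
    by (intro sums_of_real sums_mult eta_sums that)
  have n: "fps_nth (T k) 0 = of_real (1 * ((-1) ^ k * rp 3 k))" "fps_nth (T k) 2 = of_real (2 * ((-1) ^ k * rp 5 k))"
     "fps_nth (T k) 4 = of_real (3 * ((-1) ^ k * rp 7 k))" "fps_nth (T k) 6 = of_real (4 * ((-1) ^ k * rp 9 k))"
     "fps_nth (T k) 1 = 0" "fps_nth (T k) 3 = 0" "fps_nth (T k) 5 = 0" for k
    unfolding T_def of_real_mult of_real_rp fps_mult_left_const_nth fps_mult_nths geom_fps_nths
    by (simp_all add: eval_nat_numeral field_simps del: of_nat_Suc)
  show ?thesis
  proof (rule that[OF S(2)])
    let ?F = "fps_expansion g0 0"
    show "fps_nth ?F 0 = 3 / 4 * of_real (zt 3)" using sums_unique2[OF S(1)[of 0, unfolded n] s[of 3]] by simp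
    show "fps_nth ?F 2 = 15 / 8 * of_real (zt 5)" using sums_unique2[OF S(1)[of 2, unfolded n] s[of 5]] by simp
    show "fps_nth ?F 4 = 189 / 64 * of_real (zt 7)" using sums_unique2[OF S(1)[of 4, unfolded n] s[of 7]] by simp
    show "fps_nth ?F 6 = 255 / 64 * of_real (zt 9)" using sums_unique2[OF S(1)[of 6, unfolded n] s[of 9]] by simp
    show "fps_nth ?F 1 = 0" using sums_unique2[OF S(1)[of 1, unfolded n] sums_zero] by simp
    show "fps_nth ?F 3 = 0" using sums_unique2[OF S(1)[of 3, unfolded n] sums_zero] by simp
    show "fps_nth ?F 5 = 0" using sums_unique2[OF S(1)[of 5, unfolded n] sums_zero] by simp
  qed
qed

definition QF :: "nat \<Rightarrow> complex fps" where
  "QF n = (\<Prod>k<n. 1 - fps_const (of_real (rp 2 k)) * fps_X ^ 2)"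

definition PFs :: "nat \<Rightarrow> complex fps" where
  "PFs n = (\<Prod>k<n. 1 - fps_const (of_real (3 * rp 2 k)) * fps_X ^ 2 + fps_const (of_real (2 * rp 3 k)) * fps_X ^ 3)"

lemma Qp_has_fps: "(\<lambda>z. Qp z n) has_fps_expansion QF n"
proof (induction n)
  case (Suc n)
  have "(\<lambda>z. Qp z n * (1 - of_real (rp 2 n) * z ^ 2)) has_fps_expansion QF n * (1 - fps_const (of_real (rp 2 n)) * fps_X ^ 2)"
    by (intro fps_expansion_intros Suc)
  thus ?case by (simp add: Qp_Suc QF_def rp_def)
qed (simp add: QF_def)

lemma Pp_has_fps: "(\<lambda>z. Pp z n) has_fps_expansion PFs n"
proof (induction n)
  case (Suc n)
  have "(\<lambda>z. Pp z n * (1 - of_real (3 * rp 2 n) * z ^ 2 + of_real (2 * rp 3 n) * z ^ 3)) has_fps_expansion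
     PFs n * (1 - fps_const (of_real (3 * rp 2 n)) * fps_X ^ 2 + fps_const (of_real (2 * rp 3 n)) * fps_X ^ 3)"
    by (intro fps_expansion_intros Suc)
  moreover have "Pp z n * (1 - of_real (3 * rp 2 n) * z ^ 2 + of_real (2 * rp 3 n) * z ^ 3) = Pp z (Suc n)" for z
    unfolding Pp_Suc Pp_factor by (simp add: rp_def)
  ultimately show ?case by (simp only: PFs_def prod.lessThan_Suc)
qed (simp add: PFs_def)

lemma QF_Suc_nth: "fps_nth (QF (Suc k)) n = fps_nth (QF k) n - (if n < 2 then 0 else of_real (rp 2 k) * fps_nth (QF k) (n - 2))"
proof -
  have "QF (Suc k) = QF k - fps_const (of_real (rp 2 k)) * (fps_X ^ 2 * QF k)"
    by (simp add: QF_def algebra_simps)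
  thus ?thesis by (simp add: fps_X_power_mult_nth)
qed

lemma PFs_Suc_nth: "fps_nth (PFs (Suc k)) n = fps_nth (PFs k) n - (if n < 2 then 0 else of_real (3 * rp 2 k) * fps_nth (PFs k) (n - 2))
     + (if n < 3 then 0 else of_real (2 * rp 3 k) * fps_nth (PFs k) (n - 3))"
proof -
  have "PFs (Suc k) = PFs k - fps_const (of_real (3 * rp 2 k)) * (fps_X ^ 2 * PFs k) + fps_const (of_real (2 * rp 3 k)) * (fps_X ^ 3 * PFs k)"
    unfolding PFs_def by (simp add: algebra_simps)
  thus ?thesis by (simp only: fps_add_nth fps_sub_nth fps_mult_left_const_nth fps_X_power_mult_nth) auto
qed

text \<open>\<open>e2\<close> and \<open>e3\<close> are the elementary symmetric functions of 1/i^2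
  for i <= k, written in power sums by Newton's identities.\<close>

definition e2 :: "nat \<Rightarrow> real" where "e2 k = (Hp 2 k ^ 2 - Hp 4 k) / 2"
definition e3 :: "nat \<Rightarrow> real" where "e3 k = (Hp 2 k ^ 3 - 3 * Hp 2 k * Hp 4 k + 2 * Hp 6 k) / 6"

lemma e2_Suc: "e2 (Suc k) = e2 k + rp 2 k * Hp 2 k"
  unfolding e2_def Hp_Suc rp_mult[of 2 k 2, simplified, symmetric] by (simp add: power2_eq_square field_simps)

lemma e3_Suc: "e3 (Suc k) = e3 k + rp 2 k * e2 k"
  unfolding e3_def e2_def Hp_Suc rp_eq[of 2] rp_eq[of 4] rp_eq[of 6] by (simp add: eval_nat_numeral field_simps)

lemma QF_nths:
  "fps_nth (QF k) 0 = 1" "fps_nth (QF k) 2 = - of_real (Hp 2 k)" "fps_nth (QF k) 4 = of_real (e2 k)" "fps_nth (QF k) 6 = - of_real (e3 k)"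
  by (induction k) (simp_all add: QF_Suc_nth e2_Suc e3_Suc Hp_Suc QF_def[of 0] e2_def[of 0] e3_def[of 0])

text \<open>Coefficients pick terms -3/i^2 and 2/i^3 at distinct i; the subtracted
  \<open>Hp 5\<close> and \<open>Hp 6\<close> remove coinciding indices.\<close>

lemma PFs_nths:
  "fps_nth (PFs k) 0 = 1" "fps_nth (PFs k) 1 = 0" "fps_nth (PFs k) 2 = of_real (- 3 * Hp 2 k)" "fps_nth (PFs k) 3 = of_real (2 * Hp 3 k)"
  "fps_nth (PFs k) 4 = of_real (9 * e2 k)" "fps_nth (PFs k) 5 = of_real (- 6 * (Hp 2 k * Hp 3 k - Hp 5 k))"
  "fps_nth (PFs k) 6 = of_real (- 27 * e3 k + 2 * (Hp 3 k ^ 2 - Hp 6 k))"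
  by (induction k) (simp_all add: PFs_Suc_nth e2_Suc e3_Suc Hp_Suc PFs_def[of 0] e2_def[of 0] e3_def[of 0] rp_mult[of 2 _ 3, simplified, symmetric] rp_mult[of 3 _ 3, simplified, symmetric] power2_eq_square algebra_simps)

lemma V0_fps:
  obtains F where "V0 has_fps_expansion F" "\<And>n. (\<lambda>k. of_real (rp 3 k) * fps_nth (QF k) n) sums fps_nth F n"
proof (rule that)
  show "V0 has_fps_expansion fps_expansion V0 0"
    by (rule has_fps_expansion_fps_expansion[OF open_UNIV _ holomorphic_V0]) simp
  show "(\<lambda>k. of_real (rp 3 k) * fps_nth (QF k) n) sums fps_nth (fps_expansion V0 0) n" for n
    using series_over_cubes(4)[OF norm_Qp_le _ holomorphic_Qp Qp_has_fps, where n = n] by (simp add: V0_def[abs_def] rp_def)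
qed

lemma V_fps:
  obtains F where "V has_fps_expansion F" "\<And>n. (\<lambda>k. of_real (rp 3 k) * fps_nth (PFs k) n) sums fps_nth F n"
proof (rule that)
  show "V has_fps_expansion fps_expansion V 0"
    by (rule has_fps_expansion_fps_expansion[OF open_UNIV _ holomorphic_V]) simp
  show "(\<lambda>k. of_real (rp 3 k) * fps_nth (PFs k) n) sums fps_nth (fps_expansion V 0) n" for n
    using series_over_cubes(4)[OF norm_Pp_le _ holomorphic_Pp Pp_has_fps, where n = n] by (simp add: V_def[abs_def] rp_def)
qed

lemma V0_fps_equation:
  assumes "V0 has_fps_expansion F" "E0 has_fps_expansion E" "g0 has_fps_expansion G"
  shows "fps_X ^ 2 * F = fps_const (4 / of_real pi) * (fps_X * (fps_sin (of_real pi) * G)) - fps_X ^ 2 * E"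
proof -
  have "(\<lambda>z. z ^ 2 * V0 z) has_fps_expansion fps_X ^ 2 * F"
    by (intro fps_expansion_intros assms)
  moreover have ev: "\<forall>\<^sub>F z in nhds 0. z ^ 2 * V0 z = 4 / of_real pi * (z * (sin (of_real pi * z) * g0 z)) - z ^ 2 * E0 z"
  proof -
    have "\<forall>\<^sub>F a in nhds 0. a \<in> ball (0 :: complex) 1" by (intro eventually_nhds_in_open) auto
    thus ?thesis
    proof eventually_elim
      case (elim a)
      hence "\<bar>Re a\<bar> < 1" using abs_Re_le_cmod[of a] by simp
      thus ?case using V0_eq[of a] by simp
    qed
  qed
  ultimately have "(\<lambda>z. 4 / of_real pi * (z * (sin (of_real pi * z) * g0 z)) - z ^ 2 * E0 z) has_fps_expansion fps_X ^ 2 * F"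
    using has_fps_expansion_cong[OF ev refl] by simp
  moreover have "(\<lambda>z. 4 / of_real pi * (z * (sin (of_real pi * z) * g0 z)) - z ^ 2 * E0 z) has_fps_expansion
      fps_const (4 / of_real pi) * (fps_X * (fps_sin (of_real pi) * G)) - fps_X ^ 2 * E"
    by (intro fps_expansion_intros assms)
  ultimately show ?thesis by (rule fps_expansion_unique_complex)
qed

text \<open>By \<open>QF_nths\<close> these are, up to sign, zeta(3), zeta(3,2), zeta(3,2,2) and
  zeta(3,2,2,2).\<close>

lemma V0_coeffs:
  assumes "V0 has_fps_expansion F"
  defines "z n \<equiv> complex_of_real (zt n)"
  shows "fps_nth F 0 = z 3" "fps_nth F 2 = - (3 * z 2 * z 3 - 11 / 2 * z 5)"
    "fps_nth F 4 = 9 / 10 * z 2 ^ 2 * z 3 - 15 / 2 * z 2 * z 5 + 157 / 16 * z 7"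
    "fps_nth F 6 = - (9 / 70 * z 2 ^ 3 * z 3 - 9 / 4 * z 2 ^ 2 * z 5 + 189 / 16 * z 2 * z 7 - 223 / 16 * z 9)"
proof -
  obtain E where E: "E0 has_fps_expansion E" "fps_nth E 0 = 2 * z 3" "fps_nth E 2 = 2 * z 5"
    "fps_nth E 4 = 2 * z 7" "fps_nth E 6 = 2 * z 9" using E0_fps unfolding z_def by metis
  obtain G where G: "g0 has_fps_expansion G" "fps_nth G 0 = 3 / 4 * z 3" "fps_nth G 2 = 15 / 8 * z 5"
    "fps_nth G 4 = 189 / 64 * z 7" "fps_nth G 6 = 255 / 64 * z 9"
    "fps_nth G 1 = 0" "fps_nth G 3 = 0" "fps_nth G 5 = 0" using g0_fps unfolding z_def by metis
  define p where "p = complex_of_real pi"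
  have p: "p \<noteq> 0" by (simp add: p_def)
  have z2: "z 2 = p ^ 2 / 6" by (simp add: z_def p_def zt_even)
  have eq: "fps_nth F n = 4 / p * fps_nth (fps_sin p * G) (Suc n) - fps_nth E n" for n
    using arg_cong[OF V0_fps_equation[OF assms(1) E(1) G(1)], of "\<lambda>f. fps_nth f (n + 2)"]
    by (simp add: fps_X_power_mult_nth p_def)
  have n: "Suc 0 = 1" "Suc 2 = 3" "Suc 4 = 5" "Suc 6 = 7" by simp_all
  show "fps_nth F 0 = z 3"
    using p unfolding eq n fps_mult_nths fps_sin_nths G E by (simp add: field_simps)
  show "fps_nth F 2 = - (3 * z 2 * z 3 - 11 / 2 * z 5)"
    using p unfolding eq n fps_mult_nths fps_sin_nths G E z2 by (simp add: field_simps eval_nat_numeral)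
  show "fps_nth F 4 = 9 / 10 * z 2 ^ 2 * z 3 - 15 / 2 * z 2 * z 5 + 157 / 16 * z 7"
    using p unfolding eq n fps_mult_nths fps_sin_nths G E z2 by (simp add: field_simps eval_nat_numeral)
  show "fps_nth F 6 = - (9 / 70 * z 2 ^ 3 * z 3 - 9 / 4 * z 2 ^ 2 * z 5 + 189 / 16 * z 2 * z 7 - 223 / 16 * z 9)"
    using p unfolding eq n fps_mult_nths fps_sin_nths G E z2 by (simp add: field_simps eval_nat_numeral)
qed

section \<open>Multiple zeta values in the coefficients of \<open>V\<close>\<close>

text \<open>Equal to zeta(3,2,3) + zeta(3,3,2) + zeta(3,5); without the last summand it is the
  coefficient of a^5 in \<open>V\<close> up to the factor -6.\<close>

definition B23 :: real where "B23 = (\<Sum>k. rp 3 k * (Hp 2 k * Hp 3 k))"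

lemma B23_sums: "(\<lambda>k. rp 3 k * (Hp 2 k * Hp 3 k)) sums B23"
  unfolding B23_def
  by (intro summable_sums summable_rp_bounded[of 3 _ "zt 2 * zt 3"]) (auto simp: abs_mult intro!: mult_mono Hp_le_zt)

text \<open>Stuffle product by telescoping \<open>Hp 2 k * Hp 3 k ^ 2\<close>; it carries the parity
  relation from \<open>A33\<close> over to \<open>B23\<close>.\<close>

lemma A33_B23: "zt 2 * zt 3 ^ 2 = A33 + 2 * B23 + 2 * dz 5 3 + dz 6 2 + zt 8"
proof -
  have "(\<lambda>k. Hp 2 k * Hp 3 k ^ 2) \<longlonglongrightarrow> zt 2 * zt 3 ^ 2" by (intro tendsto_intros Hp_LIMSEQ) auto
  from telescope_sums[OF this] have "(\<lambda>k. Hp 2 (Suc k) * Hp 3 (Suc k) ^ 2 - Hp 2 k * Hp 3 k ^ 2) sums (zt 2 * zt 3 ^ 2)" by simp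
  also have "(\<lambda>k. Hp 2 (Suc k) * Hp 3 (Suc k) ^ 2 - Hp 2 k * Hp 3 k ^ 2) =
     (\<lambda>k. rp 2 k * Hp 3 k ^ 2 + 2 * (rp 3 k * (Hp 2 k * Hp 3 k)) + 2 * (rp 5 k * Hp 3 k) + rp 6 k * Hp 2 k + rp 8 k)"
    unfolding Hp_Suc rp_eq[of 2] rp_eq[of 3] rp_eq[of 5] rp_eq[of 6] rp_eq[of 8] by (simp add: eval_nat_numeral algebra_simps)
  finally have "(\<lambda>k. rp 2 k * Hp 3 k ^ 2 + 2 * (rp 3 k * (Hp 2 k * Hp 3 k)) + 2 * (rp 5 k * Hp 3 k) + rp 6 k * Hp 2 k + rp 8 k) sums (zt 2 * zt 3 ^ 2)" .
  moreover have "(\<lambda>k. rp 2 k * Hp 3 k ^ 2 + 2 * (rp 3 k * (Hp 2 k * Hp 3 k)) + 2 * (rp 5 k * Hp 3 k) + rp 6 k * Hp 2 k + rp 8 k) sums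
     (A33 + 2 * B23 + 2 * dz 5 3 + dz 6 2 + zt 8)"
    by (intro sums_add sums_mult A33_sums B23_sums dz_sums zt_sums) (auto simp: dz_ok_def)
  ultimately show ?thesis by (rule sums_unique2)
qed

text \<open>The sum is 2 zeta(3,3,3). With equal exponents it is symmetric, so power sums
  suffice.\<close>

lemma triple_zeta_333_sums: "(\<lambda>k. rp 3 k * (Hp 3 k ^ 2 - Hp 6 k)) sums ((zt 3 ^ 3 - 3 * zt 3 * zt 6 + 2 * zt 9) / 3)"
proof -
  have "(\<lambda>k. Hp 3 k ^ 3 - 3 * (Hp 3 k * Hp 6 k) + 2 * Hp 9 k) \<longlonglongrightarrow> zt 3 ^ 3 - 3 * (zt 3 * zt 6) + 2 * zt 9"
    by (intro tendsto_intros Hp_LIMSEQ) auto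
  from telescope_sums[OF this]
  have "(\<lambda>k. Hp 3 (Suc k) ^ 3 - 3 * (Hp 3 (Suc k) * Hp 6 (Suc k)) + 2 * Hp 9 (Suc k) - (Hp 3 k ^ 3 - 3 * (Hp 3 k * Hp 6 k) + 2 * Hp 9 k))
     sums (zt 3 ^ 3 - 3 * (zt 3 * zt 6) + 2 * zt 9)" by simp
  also have "(\<lambda>k. Hp 3 (Suc k) ^ 3 - 3 * (Hp 3 (Suc k) * Hp 6 (Suc k)) + 2 * Hp 9 (Suc k) - (Hp 3 k ^ 3 - 3 * (Hp 3 k * Hp 6 k) + 2 * Hp 9 k))
     = (\<lambda>k. 3 * (rp 3 k * (Hp 3 k ^ 2 - Hp 6 k)))"
    unfolding Hp_Suc rp_eq[of 3] rp_eq[of 6] rp_eq[of 9] by (simp add: eval_nat_numeral algebra_simps)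
  finally have "(\<lambda>k. 3 * (rp 3 k * (Hp 3 k ^ 2 - Hp 6 k)) / 3) sums ((zt 3 ^ 3 - 3 * (zt 3 * zt 6) + 2 * zt 9) / 3)"
    by (rule sums_divide)
  thus ?thesis by (simp add: mult.assoc)
qed

lemma zt_even_zt2: "zt 4 = 2 / 5 * zt 2 ^ 2" "zt 6 = 8 / 35 * zt 2 ^ 3" "zt 8 = 24 / 175 * zt 2 ^ 4"
  by (simp_all add: zt_even power_divide power_mult[symmetric])

text \<open>Together with stuffle this gives \<open>dz 2 3\<close>, which appears in
  \<open>A33_relation\<close>.\<close>

lemma dz_3_2: "dz 3 2 = 3 * zt 2 * zt 3 - 11 / 2 * zt 5"
proof -
  obtain F where F: "V0 has_fps_expansion F" "\<And>n. (\<lambda>k. of_real (rp 3 k) * fps_nth (QF k) n) sums fps_nth F n"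
    using V0_fps by blast
  have "(\<lambda>k. complex_of_real (- (rp 3 k * Hp 2 k))) sums of_real (- dz 3 2)"
    by (intro sums_of_real sums_minus dz_sums) (simp add: dz_ok_def)
  hence "fps_nth F 2 = of_real (- dz 3 2)"
    using F(2)[of 2] unfolding QF_nths by (intro sums_unique2[OF F(2)[of 2, unfolded QF_nths]]) simp
  hence "complex_of_real (- dz 3 2) = of_real (11 / 2 * zt 5 - 3 * zt 2 * zt 3)"
    using V0_coeffs(2)[OF F(1)] by simp
  thus ?thesis unfolding of_real_eq_iff by simp
qed

text \<open>In weight 8 the double shuffle relations determine every double zeta value that occurs up to
  \<open>\<zeta>(5,3)\<close>.\<close>

lemma B23_value:
  "B23 - dz 3 5 = - 3 / 2 * zt 2 * zt 3 ^ 2 - 773 / 875 * zt 2 ^ 4 + 27 / 10 * dz 5 3 + 8 * zt 3 * zt 5"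
proof -
  define x y u d where v: "x = zt 2" "y = zt 3" "u = zt 5" "d = dz 5 3"
  have z: "zt 4 = 2 / 5 * x ^ 2" "zt 6 = 8 / 35 * x ^ 3" "zt 8 = 24 / 175 * x ^ 4"
    unfolding v by (fact zt_even_zt2)+
  have e: "x * zt 4 = 2 / 5 * x ^ 3" "x * zt 6 = 8 / 35 * x ^ 4" "zt 4 * zt 4 = 4 / 25 * x ^ 4" "y * y = y ^ 2"
    unfolding z by (simp_all add: eval_nat_numeral)
  have s33: "y * y = dz 3 3 + dz 3 3 + zt 6" using stuffle2[of 3 3] by (simp add: v)
  have s24: "x * zt 4 = dz 2 4 + dz 4 2 + zt 6" using stuffle2[of 2 4] by (simp add: v)
  have s26: "x * zt 6 = dz 2 6 + dz 6 2 + zt 8" using stuffle2[of 2 6] by (simp add: v)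
  have s35: "y * u = dz 3 5 + d + zt 8" using stuffle2[of 3 5] by (simp add: v)
  have s44: "zt 4 * zt 4 = dz 4 4 + dz 4 4 + zt 8" using stuffle2[of 4 4] by simp
  have s23: "x * y = dz 2 3 + dz 3 2 + u" using stuffle2[of 2 3] by (simp add: v)
  have c1: "dz 3 2 = 3 * (x * y) - 11 / 2 * u" using dz_3_2 by (simp add: v)
  have d33: "dz 3 3 = 1 / 2 * y ^ 2 - 4 / 35 * x ^ 3" using s33 e z by linarith
  \<comment> \<open>Twice the difference of \<open>shuffle(2)\<close> and \<open>s24\<close>, minus
    \<open>shuffle(1)\<close>, cancels \<open>dz 4 2\<close>.\<close>
  have d51: "dz 5 1 = 6 / 35 * x ^ 3 - 1 / 2 * y ^ 2"
    using shuffle(1) shuffle(2) s24 d33 e z unfolding v[symmetric] by linarith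
  have d42: "dz 4 2 = y ^ 2 - 32 / 105 * x ^ 3"
    using shuffle(1) d51 d33 e unfolding v[symmetric] by linarith
  have d24: "dz 2 4 = 10 / 21 * x ^ 3 - y ^ 2" using s24 d42 e z by linarith
  have d35: "dz 3 5 = y * u - d - 24 / 175 * x ^ 4" using s35 z by linarith
  have d44: "dz 4 4 = 2 / 175 * x ^ 4" using s44 e z by linarith
  \<comment> \<open>10 times \<open>shuffle(3)\<close> minus 3 times \<open>shuffle(4)\<close>
    cancels both \<open>dz 7 1\<close> and \<open>dz 6 2\<close>.\<close>
  have d26: "dz 2 6 = 374 / 875 * x ^ 4 - 2 * (y * u) + 2 / 5 * d"
    using shuffle(3) shuffle(4) s26 d35 d44 e z unfolding v[symmetric] by linarith
  have d62: "dz 6 2 = - 294 / 875 * x ^ 4 + 2 * (y * u) - 2 / 5 * d" using s26 d26 e z by linarith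
  have d23: "dz 2 3 = 9 / 2 * u - 2 * (x * y)" using s23 c1 by linarith
  have A: "2 * A33 - 4 * (y * dz 2 3) + 2 * (x * y ^ 2) + 2 * d - 2 * (y * u) + zt 8 = 2 * Rv + 2 * (x * zt 6) - zt 8"
    using A33_relation unfolding v[symmetric] by (simp add: mult_ac)
  have R: "Rv = - 6 * (x * dz 3 3) + 10 * d + 6 * (x * y ^ 2) - 10 * (y * u) - 12 * (x * dz 2 4) + 18 * dz 4 4
     - 12 * (x * (zt 4 * x)) + 18 * (zt 4 * zt 4) + 12 * (x * (dz 5 1 + zt 6)) + 18 * dz 3 5 - 18 * (y * u)
     + 10 * dz 2 6 + 10 * (x * zt 6)"
    unfolding Rv_def v[symmetric] by (simp add: mult_ac power2_eq_square)
  \<comment> \<open>Linear arithmetic treats products as atoms, so those containing unknowns are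
    expanded beforehand.\<close>
  have p: "x * dz 3 3 = 1 / 2 * (x * y ^ 2) - 4 / 35 * x ^ 4" "x * dz 2 4 = 10 / 21 * x ^ 4 - x * y ^ 2"
    "x * (zt 4 * x) = 2 / 5 * x ^ 4" "x * (dz 5 1 + zt 6) = 2 / 5 * x ^ 4 - 1 / 2 * (x * y ^ 2)"
    "y * dz 2 3 = 9 / 2 * (y * u) - 2 * (x * y ^ 2)"
    unfolding d33 d24 d51 d23 z by (simp_all add: eval_nat_numeral field_simps)
  have "B23 - dz 3 5 = - 3 / 2 * (x * y ^ 2) - 773 / 875 * x ^ 4 + 27 / 10 * d + 8 * (y * u)"
  proof -
    have "x * y ^ 2 = A33 + 2 * B23 + 2 * d + dz 6 2 + zt 8" using A33_B23 by (simp add: v)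
    thus ?thesis using A R p d62 d26 d35 d44 e z by linarith
  qed
  thus ?thesis by (simp add: v)
qed

text \<open>The even coefficients are 3, 9 and 27 times those of \<open>V0\<close>, plus 4
  zeta(3,3,3) at a^6. The odd ones mix 2 and 3; a^5 is the one that needs
  \<open>B23_value\<close>.\<close>

lemma V_coeffs:
  assumes F: "V has_fps_expansion F"
  defines "z n \<equiv> complex_of_real (zt n)"
  shows "fps_nth F 0 = z 3" "fps_nth F 1 = 0" "fps_nth F 2 = - 9 * z 2 * z 3 + 33 / 2 * z 5"
    "fps_nth F 3 = z 3 ^ 2 - 8 / 35 * z 2 ^ 3"
    "fps_nth F 4 = 81 / 10 * z 2 ^ 2 * z 3 - 135 / 2 * z 2 * z 5 + 1413 / 16 * z 7"
    "fps_nth F 5 = 9 * z 2 * z 3 ^ 2 + 4638 / 875 * z 2 ^ 4 - 81 / 5 * of_real (dz 5 3) - 48 * z 3 * z 5"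
    "fps_nth F 6 = - 55 / 14 * z 2 ^ 3 * z 3 + 243 / 4 * z 2 ^ 2 * z 5 - 5103 / 16 * z 2 * z 7 + 18127 / 48 * z 9 + 2 / 3 * z 3 ^ 3"
proof -
  obtain F' where F': "V has_fps_expansion F'" "\<And>n. (\<lambda>k. of_real (rp 3 k) * fps_nth (PFs k) n) sums fps_nth F' n"
    using V_fps by blast
  have "F' = F" using F F'(1) by (rule fps_expansion_unique_complex[symmetric])
  note S = F'(2)[unfolded this]
  obtain F0 where F0: "V0 has_fps_expansion F0" "\<And>n. (\<lambda>k. of_real (rp 3 k) * fps_nth (QF k) n) sums fps_nth F0 n"
    using V0_fps by blast
  have "(\<lambda>k. of_real (rp 3 k) * fps_nth (PFs k) 0) sums of_real (zt 3)"
    unfolding PFs_nths using sums_of_real[OF zt_sums[of 3]] by simp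
  thus "fps_nth F 0 = z 3" unfolding z_def using S by (rule sums_unique2[rotated])
  show "fps_nth F 1 = 0" using S[of 1] unfolding PFs_nths by (simp add: sums_unique2[OF _ sums_zero])
  have "(\<lambda>k. of_real (rp 3 k) * fps_nth (PFs k) 2) sums (3 * fps_nth F0 2)"
    using sums_mult[OF F0(2)[of 2], of 3] unfolding QF_nths PFs_nths by (simp add: mult_ac)
  hence "fps_nth F 2 = 3 * fps_nth F0 2" using S by (rule sums_unique2[rotated])
  thus "fps_nth F 2 = - 9 * z 2 * z 3 + 33 / 2 * z 5" unfolding V0_coeffs[OF F0(1)] z_def by (simp add: algebra_simps)
  have "(\<lambda>k. complex_of_real (2 * (rp 3 k * Hp 3 k))) sums of_real (2 * dz 3 3)"
    by (intro sums_of_real sums_mult dz_sums) (simp add: dz_ok_def)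
  hence "(\<lambda>k. of_real (rp 3 k) * fps_nth (PFs k) 3) sums of_real (2 * dz 3 3)"
    unfolding PFs_nths by (simp add: mult_ac)
  hence "fps_nth F 3 = of_real (2 * dz 3 3)" using S by (rule sums_unique2[rotated])
  also have "2 * dz 3 3 = zt 3 ^ 2 - 8 / 35 * zt 2 ^ 3" using stuffle2[of 3 3] zt_even_zt2 by (simp add: power2_eq_square)
  finally show "fps_nth F 3 = z 3 ^ 2 - 8 / 35 * z 2 ^ 3" by (simp add: z_def)
  have "(\<lambda>k. of_real (rp 3 k) * fps_nth (PFs k) 4) sums (9 * fps_nth F0 4)"
    using sums_mult[OF F0(2)[of 4], of 9] unfolding QF_nths PFs_nths by (simp add: mult_ac)
  hence "fps_nth F 4 = 9 * fps_nth F0 4" using S by (rule sums_unique2[rotated])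
  thus "fps_nth F 4 = 81 / 10 * z 2 ^ 2 * z 3 - 135 / 2 * z 2 * z 5 + 1413 / 16 * z 7"
    unfolding V0_coeffs[OF F0(1)] z_def by (simp add: algebra_simps)
  have "(\<lambda>k. complex_of_real (- 6 * (rp 3 k * (Hp 2 k * Hp 3 k) - rp 3 k * Hp 5 k))) sums of_real (- 6 * (B23 - dz 3 5))"
    by (intro sums_of_real sums_mult sums_diff B23_sums dz_sums) (simp add: dz_ok_def)
  hence "(\<lambda>k. of_real (rp 3 k) * fps_nth (PFs k) 5) sums of_real (- 6 * (B23 - dz 3 5))"
    unfolding PFs_nths by (simp add: algebra_simps)
  hence "fps_nth F 5 = of_real (- 6 * (B23 - dz 3 5))" using S by (rule sums_unique2[rotated])
  also have "- 6 * (B23 - dz 3 5) = 9 * zt 2 * zt 3 ^ 2 + 4638 / 875 * zt 2 ^ 4 - 81 / 5 * dz 5 3 - 48 * zt 3 * zt 5"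
    unfolding B23_value by (simp add: algebra_simps)
  finally show "fps_nth F 5 = 9 * z 2 * z 3 ^ 2 + 4638 / 875 * z 2 ^ 4 - 81 / 5 * of_real (dz 5 3) - 48 * z 3 * z 5" by (simp add: z_def)
  have "(\<lambda>k. 27 * (of_real (rp 3 k) * fps_nth (QF k) 6) + of_real (2 * (rp 3 k * (Hp 3 k ^ 2 - Hp 6 k)))) sums
     (27 * fps_nth F0 6 + of_real (2 * ((zt 3 ^ 3 - 3 * zt 3 * zt 6 + 2 * zt 9) / 3)))"
    by (intro sums_add sums_mult F0(2) sums_of_real triple_zeta_333_sums)
  also have "(\<lambda>k. 27 * (of_real (rp 3 k) * fps_nth (QF k) 6) + of_real (2 * (rp 3 k * (Hp 3 k ^ 2 - Hp 6 k)))) =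
     (\<lambda>k. of_real (rp 3 k) * fps_nth (PFs k) 6)"
    unfolding QF_nths PFs_nths by (simp add: algebra_simps)
  finally have eq: "fps_nth F 6 = 27 * fps_nth F0 6 + of_real (2 * ((zt 3 ^ 3 - 3 * zt 3 * zt 6 + 2 * zt 9) / 3))"
    using S by (rule sums_unique2[rotated])
  show "fps_nth F 6 = - 55 / 14 * z 2 ^ 3 * z 3 + 243 / 4 * z 2 ^ 2 * z 5 - 5103 / 16 * z 2 * z 7 + 18127 / 48 * z 9 + 2 / 3 * z 3 ^ 3"
    unfolding eq V0_coeffs[OF F0(1)] zt_even_zt2(2) z_def by (simp add: field_simps)
qed

section \<open>Expansion of the Gamma products and of \<open>Kf\<close>\<close>

text \<open>This and the next two lemmas solve the recursion for the Gamma products of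
  \<open>Kf\<close>: the squared reflection product, \<open>bq ^ 3\<close>, and the former times
  \<open>bq ^ 2\<close>.\<close>

lemma LG_2_2_0_solution:
  assumes F: "fps_deriv F = F * LG 2 2 0" "fps_nth F 0 = 1"
    and z: "x = complex_of_real (zt 2)"
  shows "fps_nth F 1 = 0"
    "fps_nth F 2 = 2 * x"
    "fps_nth F 3 = 0"
    "fps_nth F 4 = 12 / 5 * x ^ 2"
    "fps_nth F 5 = 0"
    "fps_nth F 6 = 16 / 7 * x ^ 3"
    "fps_nth F 7 = 0"
    "fps_nth F 8 = 48 / 25 * x ^ 4"
    "fps_nth F 9 = 0"
proof -
  have ev: "complex_of_real (zt 4) = 2 / 5 * x ^ 2" "complex_of_real (zt 6) = 8 / 35 * x ^ 3" "complex_of_real (zt 8) = 24 / 175 * x ^ 4"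
    unfolding zt_even_zt2 z by simp_all
  have L: "fps_nth (LG 2 2 0) 0 = 0"
    "fps_nth (LG 2 2 0) 1 = 4 * of_real (zt 2)"
    "fps_nth (LG 2 2 0) 2 = 0"
    "fps_nth (LG 2 2 0) 3 = 4 * of_real (zt 4)"
    "fps_nth (LG 2 2 0) 4 = 0"
    "fps_nth (LG 2 2 0) 5 = 4 * of_real (zt 6)"
    "fps_nth (LG 2 2 0) 6 = 0"
    "fps_nth (LG 2 2 0) 7 = 4 * of_real (zt 8)"
    "fps_nth (LG 2 2 0) 8 = 0"
    by (simp_all add: LG_nth numeral_2_eq_2[symmetric])
  note nth = fps_log_deriv_nths[OF F(1), unfolded fps_mult_nths F(2) L ev, folded z]
  show f1: "fps_nth F 1 = 0"
    unfolding nth(1)  by (simp add: field_simps eval_nat_numeral)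
  show f2: "fps_nth F 2 = 2 * x"
    unfolding nth(2) f1 by (simp add: field_simps eval_nat_numeral)
  show f3: "fps_nth F 3 = 0"
    unfolding nth(3) f1 f2 by (simp add: field_simps eval_nat_numeral)
  show f4: "fps_nth F 4 = 12 / 5 * x ^ 2"
    unfolding nth(4) f1 f2 f3 by (simp add: field_simps eval_nat_numeral)
  show f5: "fps_nth F 5 = 0"
    unfolding nth(5) f1 f2 f3 f4 by (simp add: field_simps eval_nat_numeral)
  show f6: "fps_nth F 6 = 16 / 7 * x ^ 3"
    unfolding nth(6) f1 f2 f3 f4 f5 by (simp add: field_simps eval_nat_numeral)
  show f7: "fps_nth F 7 = 0"
    unfolding nth(7) f1 f2 f3 f4 f5 f6 by (simp add: field_simps eval_nat_numeral)
  show f8: "fps_nth F 8 = 48 / 25 * x ^ 4"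
    unfolding nth(8) f1 f2 f3 f4 f5 f6 f7 by (simp add: field_simps eval_nat_numeral)
  show "fps_nth F 9 = 0"
    unfolding nth(9) f1 f2 f3 f4 f5 f6 f7 f8 by (simp add: field_simps eval_nat_numeral)
qed

lemma LG_6_0_3_solution:
  assumes F: "fps_deriv F = F * LG 6 0 3" "fps_nth F 0 = 1"
    and z: "x = complex_of_real (zt 2)" "y = complex_of_real (zt 3)" "u = complex_of_real (zt 5)"
    "v = complex_of_real (zt 7)" "w = complex_of_real (zt 9)"
  shows "fps_nth F 1 = 0"
    "fps_nth F 2 = - 3 * x"
    "fps_nth F 3 = 6 * y"
    "fps_nth F 4 = 3 / 10 * x ^ 2"
    "fps_nth F 5 = 18 * u - 18 * x * y"
    "fps_nth F 6 = 71 / 70 * x ^ 3 + 18 * y ^ 2"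
    "fps_nth F 7 = 54 * v - 54 * x * u + 9 / 5 * x ^ 2 * y"
    "fps_nth F 8 = 417 / 280 * x ^ 4 + 108 * y * u - 54 * x * y ^ 2"
    "fps_nth F 9 = 170 * w - 162 * x * v + 213 / 35 * x ^ 3 * y + 27 / 5 * x ^ 2 * u + 36 * y ^ 3"
proof -
  have ev: "complex_of_real (zt 4) = 2 / 5 * x ^ 2" "complex_of_real (zt 6) = 8 / 35 * x ^ 3" "complex_of_real (zt 8) = 24 / 175 * x ^ 4"
    unfolding zt_even_zt2 z by simp_all
  have L: "fps_nth (LG 6 0 3) 0 = 0"
    "fps_nth (LG 6 0 3) 1 = -6 * of_real (zt 2)"
    "fps_nth (LG 6 0 3) 2 = 18 * of_real (zt 3)"
    "fps_nth (LG 6 0 3) 3 = -42 * of_real (zt 4)"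
    "fps_nth (LG 6 0 3) 4 = 90 * of_real (zt 5)"
    "fps_nth (LG 6 0 3) 5 = -186 * of_real (zt 6)"
    "fps_nth (LG 6 0 3) 6 = 378 * of_real (zt 7)"
    "fps_nth (LG 6 0 3) 7 = -762 * of_real (zt 8)"
    "fps_nth (LG 6 0 3) 8 = 1530 * of_real (zt 9)"
    by (simp_all add: LG_nth numeral_2_eq_2[symmetric])
  note nth = fps_log_deriv_nths[OF F(1), unfolded fps_mult_nths F(2) L ev, folded z]
  show f1: "fps_nth F 1 = 0"
    unfolding nth(1)  by (simp add: field_simps eval_nat_numeral)
  show f2: "fps_nth F 2 = - 3 * x"
    unfolding nth(2) f1 by (simp add: field_simps eval_nat_numeral)
  show f3: "fps_nth F 3 = 6 * y"
    unfolding nth(3) f1 f2 by (simp add: field_simps eval_nat_numeral)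
  show f4: "fps_nth F 4 = 3 / 10 * x ^ 2"
    unfolding nth(4) f1 f2 f3 by (simp add: field_simps eval_nat_numeral)
  show f5: "fps_nth F 5 = 18 * u - 18 * x * y"
    unfolding nth(5) f1 f2 f3 f4 by (simp add: field_simps eval_nat_numeral)
  show f6: "fps_nth F 6 = 71 / 70 * x ^ 3 + 18 * y ^ 2"
    unfolding nth(6) f1 f2 f3 f4 f5 by (simp add: field_simps eval_nat_numeral)
  show f7: "fps_nth F 7 = 54 * v - 54 * x * u + 9 / 5 * x ^ 2 * y"
    unfolding nth(7) f1 f2 f3 f4 f5 f6 by (simp add: field_simps eval_nat_numeral)
  show f8: "fps_nth F 8 = 417 / 280 * x ^ 4 + 108 * y * u - 54 * x * y ^ 2"
    unfolding nth(8) f1 f2 f3 f4 f5 f6 f7 by (simp add: field_simps eval_nat_numeral)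
  show "fps_nth F 9 = 170 * w - 162 * x * v + 213 / 35 * x ^ 3 * y + 27 / 5 * x ^ 2 * u + 36 * y ^ 3"
    unfolding nth(9) f1 f2 f3 f4 f5 f6 f7 f8 by (simp add: field_simps eval_nat_numeral)
qed

lemma LG_6_2_2_solution:
  assumes F: "fps_deriv F = F * LG 6 2 2" "fps_nth F 0 = 1"
    and z: "x = complex_of_real (zt 2)" "y = complex_of_real (zt 3)" "u = complex_of_real (zt 5)"
    "v = complex_of_real (zt 7)" "w = complex_of_real (zt 9)"
  shows "fps_nth F 1 = 0"
    "fps_nth F 2 = 0"
    "fps_nth F 3 = 4 * y"
    "fps_nth F 4 = - 12 / 5 * x ^ 2"
    "fps_nth F 5 = 12 * u"
    "fps_nth F 6 = - 32 / 7 * x ^ 3 + 8 * y ^ 2"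
    "fps_nth F 7 = 36 * v - 48 / 5 * x ^ 2 * y"
    "fps_nth F 8 = - 144 / 25 * x ^ 4 + 48 * y * u"
    "fps_nth F 9 = 340 / 3 * w - 128 / 7 * x ^ 3 * y - 144 / 5 * x ^ 2 * u + 32 / 3 * y ^ 3"
proof -
  have ev: "complex_of_real (zt 4) = 2 / 5 * x ^ 2" "complex_of_real (zt 6) = 8 / 35 * x ^ 3" "complex_of_real (zt 8) = 24 / 175 * x ^ 4"
    unfolding zt_even_zt2 z by simp_all
  have L: "fps_nth (LG 6 2 2) 0 = 0"
    "fps_nth (LG 6 2 2) 1 = 0"
    "fps_nth (LG 6 2 2) 2 = 12 * of_real (zt 3)"
    "fps_nth (LG 6 2 2) 3 = -24 * of_real (zt 4)"
    "fps_nth (LG 6 2 2) 4 = 60 * of_real (zt 5)"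
    "fps_nth (LG 6 2 2) 5 = -120 * of_real (zt 6)"
    "fps_nth (LG 6 2 2) 6 = 252 * of_real (zt 7)"
    "fps_nth (LG 6 2 2) 7 = -504 * of_real (zt 8)"
    "fps_nth (LG 6 2 2) 8 = 1020 * of_real (zt 9)"
    by (simp_all add: LG_nth numeral_2_eq_2[symmetric])
  note nth = fps_log_deriv_nths[OF F(1), unfolded fps_mult_nths F(2) L ev, folded z]
  show f1: "fps_nth F 1 = 0"
    unfolding nth(1)  by (simp add: field_simps eval_nat_numeral)
  show f2: "fps_nth F 2 = 0"
    unfolding nth(2) f1 by (simp add: field_simps eval_nat_numeral)
  show f3: "fps_nth F 3 = 4 * y"
    unfolding nth(3) f1 f2 by (simp add: field_simps eval_nat_numeral)
  show f4: "fps_nth F 4 = - 12 / 5 * x ^ 2"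
    unfolding nth(4) f1 f2 f3 by (simp add: field_simps eval_nat_numeral)
  show f5: "fps_nth F 5 = 12 * u"
    unfolding nth(5) f1 f2 f3 f4 by (simp add: field_simps eval_nat_numeral)
  show f6: "fps_nth F 6 = - 32 / 7 * x ^ 3 + 8 * y ^ 2"
    unfolding nth(6) f1 f2 f3 f4 f5 by (simp add: field_simps eval_nat_numeral)
  show f7: "fps_nth F 7 = 36 * v - 48 / 5 * x ^ 2 * y"
    unfolding nth(7) f1 f2 f3 f4 f5 f6 by (simp add: field_simps eval_nat_numeral)
  show f8: "fps_nth F 8 = - 144 / 25 * x ^ 4 + 48 * y * u"
    unfolding nth(8) f1 f2 f3 f4 f5 f6 f7 by (simp add: field_simps eval_nat_numeral)
  show "fps_nth F 9 = 340 / 3 * w - 128 / 7 * x ^ 3 * y - 144 / 5 * x ^ 2 * u + 32 / 3 * y ^ 3"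
    unfolding nth(9) f1 f2 f3 f4 f5 f6 f7 f8 by (simp add: field_simps eval_nat_numeral)
qed

text \<open>\<open>V\<close> enters with a^3, so order 9 uses it exactly up to a^6. In the second
  formula 108 zeta(2) stands for 18 pi^2.\<close>

lemma Kf_coeffs:
  assumes "Kf has_fps_expansion FK"
  shows "fps_nth FK 4 = 57 / 2 * of_real (zt 4) / fact 2"
    "fps_nth FK 5 = of_real (108 * zt 2 * zt 3 - 324 * zt 5) / fact 3"
    "fps_nth FK 6 = of_real (1959 / 2 * zt 6 - 432 * zt 3 ^ 2) / fact 4"
    "fps_nth FK 7 = of_real (19440 * zt 2 * zt 5 - 540 * zt 3 * zt 4 - 31860 * zt 7) / fact 5"
    "fps_nth FK 8 = of_real (31104 * dz 5 3 + 38880 * zt 2 * zt 3 ^ 2 - 77760 * zt 3 * zt 5 - 84807 / 4 * zt 8) / fact 6"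
    "fps_nth FK 9 = of_real (630 * (6372 * zt 2 * zt 7 - 213 * zt 3 * zt 6 - 324 * zt 4 * zt 5 - 288 * zt 3 ^ 3 - 8812 * zt 9)) / fact 7"
proof -
  have e: "(Gamma (1 + a) * Gamma (1 - a))\<^sup>2 = Gamma (1 + a) ^ 2 * Gamma (1 - a) ^ 2 * rGamma (1 + 2 * a) ^ 0"
    "bq a ^ 3 = Gamma (1 + a) ^ 6 * Gamma (1 - a) ^ 0 * rGamma (1 + 2 * a) ^ 3"
    "(Gamma (1 + a) * Gamma (1 - a))\<^sup>2 * bq a ^ 2 = Gamma (1 + a) ^ 6 * Gamma (1 - a) ^ 2 * rGamma (1 + 2 * a) ^ 2" for a :: complex
    by (simp_all add: bq_def power_mult_distrib power_mult[symmetric] power_add[symmetric] mult_ac)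
  obtain FQ where FQ: "(\<lambda>a. (Gamma (1 + a) * Gamma (1 - a))\<^sup>2) has_fps_expansion FQ" "fps_deriv FQ = FQ * LG 2 2 0" "fps_nth FQ 0 = 1"
    unfolding e(1) using Gamma_product_fps by blast
  obtain Fh where Fh: "(\<lambda>a. bq a ^ 3) has_fps_expansion Fh" "fps_deriv Fh = Fh * LG 6 0 3" "fps_nth Fh 0 = 1"
    unfolding e(2) using Gamma_product_fps by blast
  obtain Fp where Fp: "(\<lambda>a. (Gamma (1 + a) * Gamma (1 - a))\<^sup>2 * bq a ^ 2) has_fps_expansion Fp" "fps_deriv Fp = Fp * LG 6 2 2" "fps_nth Fp 0 = 1"
    unfolding e(3) using Gamma_product_fps by blast
  obtain FV where FV: "V has_fps_expansion FV"
    using V_fps by blast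
  define F where "F = fps_const (1/3) * Fh + FQ - fps_const (4/3) * (Fp + fps_const 2 * (fps_X ^ 3 * (Fp * FV)))"
  have "(\<lambda>a. 1/3 * bq a ^ 3 + (Gamma (1 + a) * Gamma (1 - a))\<^sup>2 - 4/3 * ((Gamma (1 + a) * Gamma (1 - a))\<^sup>2 * bq a ^ 2
      + 2 * (a ^ 3 * (((Gamma (1 + a) * Gamma (1 - a))\<^sup>2 * bq a ^ 2) * V a)))) has_fps_expansion F"
    unfolding F_def
    by (intro fps_expansion_intros
          FQ(1) has_fps_expansion_fps_X_power Fh(1) Fp(1) FV)
  also have "(\<lambda>a. 1/3 * bq a ^ 3 + (Gamma (1 + a) * Gamma (1 - a))\<^sup>2 - 4/3 * ((Gamma (1 + a) * Gamma (1 - a))\<^sup>2 * bq a ^ 2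
      + 2 * (a ^ 3 * (((Gamma (1 + a) * Gamma (1 - a))\<^sup>2 * bq a ^ 2) * V a)))) = Kf"
    by (simp add: Kf_def fun_eq_iff algebra_simps)
  finally have FK: "FK = F" using assms fps_expansion_unique_complex by blast
  define x y u v w d where xy: "x = complex_of_real (zt 2)" "y = complex_of_real (zt 3)" "u = complex_of_real (zt 5)"
     "v = complex_of_real (zt 7)" "w = complex_of_real (zt 9)" "d = complex_of_real (dz 5 3)"
  have ev: "complex_of_real (zt 4) = 2 / 5 * x ^ 2" "complex_of_real (zt 6) = 8 / 35 * x ^ 3" "complex_of_real (zt 8) = 24 / 175 * x ^ 4"
    unfolding zt_even_zt2 xy by simp_all
  note nth = LG_2_2_0_solution[OF FQ(2,3) xy(1)] LG_6_0_3_solution[OF Fh(2,3) xy(1-5)] LG_6_2_2_solution[OF Fp(2,3) xy(1-5)] V_coeffs[OF FV, folded xy] Fp(3)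
  note K_nths = FK F_def fps_add_nth fps_sub_nth fps_mult_left_const_nth fps_X_power_mult_nth nth
  have m: "4 - 3 = (1::nat)" "5 - 3 = (2::nat)" "6 - 3 = (3::nat)" "7 - 3 = (4::nat)" "8 - 3 = (5::nat)" "9 - 3 = (6::nat)" by simp_all
  have l: "\<not> 4 < (3::nat)" "\<not> 5 < (3::nat)" "\<not> 6 < (3::nat)" "\<not> 7 < (3::nat)" "\<not> 8 < (3::nat)" "\<not> 9 < (3::nat)" by simp_all
  show "fps_nth FK 4 = 57 / 2 * of_real (zt 4) / fact 2"
    unfolding K_nths m l if_False fps_mult_nths[of Fp FV] of_real_mult of_real_diff of_real_add of_real_power ev xy[symmetric]
    by (simp add: field_simps eval_nat_numeral)
  show "fps_nth FK 5 = of_real (108 * zt 2 * zt 3 - 324 * zt 5) / fact 3"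
    unfolding K_nths m l if_False fps_mult_nths[of Fp FV] of_real_mult of_real_diff of_real_add of_real_power ev xy[symmetric]
    by (simp add: field_simps eval_nat_numeral)
  show "fps_nth FK 6 = of_real (1959 / 2 * zt 6 - 432 * zt 3 ^ 2) / fact 4"
    unfolding K_nths m l if_False fps_mult_nths[of Fp FV] of_real_mult of_real_diff of_real_add of_real_power ev xy[symmetric]
    by (simp add: field_simps eval_nat_numeral)
  show "fps_nth FK 7 = of_real (19440 * zt 2 * zt 5 - 540 * zt 3 * zt 4 - 31860 * zt 7) / fact 5"
    unfolding K_nths m l if_False fps_mult_nths[of Fp FV] of_real_mult of_real_diff of_real_add of_real_power ev xy[symmetric]
    by (simp add: field_simps eval_nat_numeral)
  show "fps_nth FK 8 = of_real (31104 * dz 5 3 + 38880 * zt 2 * zt 3 ^ 2 - 77760 * zt 3 * zt 5 - 84807 / 4 * zt 8) / fact 6"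
    unfolding K_nths m l if_False fps_mult_nths[of Fp FV] of_real_mult of_real_diff of_real_add of_real_power ev xy[symmetric]
    by (simp add: field_simps eval_nat_numeral)
  show "fps_nth FK 9 = of_real (630 * (6372 * zt 2 * zt 7 - 213 * zt 3 * zt 6 - 324 * zt 4 * zt 5 - 288 * zt 3 ^ 3 - 8812 * zt 9)) / fact 7"
    unfolding K_nths m l if_False fps_mult_nths[of Fp FV] of_real_mult of_real_diff of_real_add of_real_power ev xy[symmetric]
    by (simp add: field_simps eval_nat_numeral)
qed

section \<open>The derivatives of \<open>f7\<close>\<close>

text \<open>The undetermined constant only contributes c a^2 to a^2 Sf(a), hence m >= 1.\<close>

lemma Sf_coeffs:
  assumes K: "Kf has_fps_expansion FK" and m: "m \<ge> 1"
  shows "(deriv ^^ m) Sf 0 = fact m * fps_nth FK (m + 2)"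
proof -
  obtain c where c: "\<And>a. \<bar>Re a\<bar> < 1 \<Longrightarrow> a \<noteq> 0 \<Longrightarrow> Sf a = Rf a + c"
    using Sf_eq_Rf_plus_const by blast
  have S: "Sf has_fps_expansion fps_expansion Sf 0"
    by (rule has_fps_expansion_fps_expansion[OF open_strip _ holomorphic_Sf]) simp
  have "eventually (\<lambda>a. a \<in> {a. \<bar>Re a\<bar> < 1}) (nhds 0)"
    by (intro eventually_nhds_in_open open_strip) auto
  hence "eventually (\<lambda>a. a ^ 2 * Sf a = Kf a + c * a ^ 2) (nhds 0)"
  proof eventually_elim
    case (elim a)
    show ?case
    proof (cases "a = 0")
      case False
      thus ?thesis using elim c[of a] Kf_eq[of a] by (simp add: algebra_simps)
    qed (simp add: Kf_0)
  qed
  moreover have "(\<lambda>a. a ^ 2 * Sf a) has_fps_expansion fps_X ^ 2 * fps_expansion Sf 0"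
    by (intro fps_expansion_intros S)
  ultimately have "(\<lambda>a. Kf a + c * a ^ 2) has_fps_expansion fps_X ^ 2 * fps_expansion Sf 0"
    using has_fps_expansion_cong[of "\<lambda>a. a ^ 2 * Sf a" "\<lambda>a. Kf a + c * a ^ 2"] by blast
  moreover have "(\<lambda>a. Kf a + c * a ^ 2) has_fps_expansion FK + fps_const c * fps_X ^ 2"
    by (intro fps_expansion_intros K)
  ultimately have "fps_X ^ 2 * fps_expansion Sf 0 = FK + fps_const c * fps_X ^ 2"
    by (rule fps_expansion_unique_complex)
  hence "fps_nth (fps_X ^ 2 * fps_expansion Sf 0) (m + 2) = fps_nth (FK + fps_const c * fps_X ^ 2) (m + 2)" by (rule arg_cong)
  hence "fps_nth (fps_expansion Sf 0) m = fps_nth FK (m + 2)"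
    using m by (simp add: fps_X_power_mult_nth fps_X_power_nth)
  thus ?thesis using fps_nth_fps_expansion[OF S, of m] by (simp add: field_simps)
qed

lemma fc_of_real: "x > 0 \<Longrightarrow> fc (of_real x) = of_real (f7 x)"
  using Gamma_complex_of_real[of x] Gamma_complex_of_real[of "2 * x"]
  by (simp add: fc_def betaq_def f7_def rGamma_inverse_Gamma power_divide field_simps)

text \<open>Along the real axis f has imaginary part 0, so its derivative is real and equals that of
  g.\<close>

lemma deriv_real_restriction:
  fixes f :: "complex \<Rightarrow> complex" and g :: "real \<Rightarrow> real"
  assumes f: "f holomorphic_on S" "open S" and A: "open A" "\<And>x. x \<in> A \<Longrightarrow> of_real x \<in> S"
    and eq: "\<And>x. x \<in> A \<Longrightarrow> f (of_real x) = of_real (g x)" and x: "x \<in> A"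
  shows "deriv f (of_real x) = of_real (deriv g x)"
proof -
  have d: "(f has_field_derivative deriv f (of_real x)) (at (of_real x))"
    using f A(2)[OF x] by (intro holomorphic_derivI)
  have 1: "((\<lambda>t. f (of_real t)) has_vector_derivative deriv f (of_real x)) (at x)"
    using has_vector_derivative_real_field[OF d] .
  have 2: "((\<lambda>t. of_real (g t)) has_vector_derivative deriv f (of_real x)) (at x)"
    by (rule has_vector_derivative_transform_within_open[OF 1 A(1) x]) (rule eq)
  have "(g has_real_derivative Re (deriv f (of_real x))) (at x)"
    using bounded_linear.has_vector_derivative[OF bounded_linear_Re 2] by (simp add: has_real_derivative_iff_has_vector_derivative)
  moreover have "((\<lambda>t. 0) has_vector_derivative Im (deriv f (of_real x))) (at x)"
    using bounded_linear.has_vector_derivative[OF bounded_linear_Im 2] by simp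
  hence "Im (deriv f (of_real x)) = 0"
    by (rule vector_derivative_unique_at[OF _ has_vector_derivative_const])
  ultimately show ?thesis by (simp add: complex_eq_iff DERIV_imp_deriv)
qed

lemma higher_deriv_real_restriction:
  fixes f :: "complex \<Rightarrow> complex" and g :: "real \<Rightarrow> real"
  assumes f: "f holomorphic_on S" "open S" and A: "open A" "\<And>x. x \<in> A \<Longrightarrow> of_real x \<in> S"
    and eq: "\<And>x. x \<in> A \<Longrightarrow> f (of_real x) = of_real (g x)" and x: "x \<in> A"
  shows "(deriv ^^ m) f (of_real x) = of_real ((deriv ^^ m) g x)"
  using x
proof (induction m arbitrary: x)
  case (Suc m)
  show ?case unfolding funpow.simps o_def
    by (rule deriv_real_restriction[OF holomorphic_higher_deriv[OF f] f(2) A Suc.IH Suc.prems])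
qed (simp add: eq)

text \<open>Termwise differentiation on a disc of radius 1/2, where the majorant holds from k = 0
  on, followed by restriction of \<open>fc\<close> to the positive reals.\<close>

lemma f7_sums:
  assumes "(deriv ^^ m) Sf 0 = of_real s"
  shows "(\<lambda>k. (deriv ^^ m) f7 (real (Suc k))) sums s"
proof -
  obtain B where B: "B \<ge> 0" "\<And>a k. \<bar>Re a\<bar> < 1 \<and> k \<ge> 1 \<or> \<bar>Re a\<bar> \<le> 1/2 \<Longrightarrow>
     norm (fc (of_nat (Suc k) + a)) \<le> 8 * (1 + norm a) * B ^ 3 * (1/32) ^ k"
    using fc_bq_bounded by blast
  have half: "\<bar>Re a\<bar> \<le> 1/2" if "a \<in> ball 0 (1/2)" for a :: complex
    using that abs_Re_le_cmod[of a] by simp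
  have "(\<lambda>k. (deriv ^^ m) (\<lambda>a. fc (of_nat (Suc k) + a)) 0) sums (deriv ^^ m) (\<lambda>a. \<Sum>k. fc (of_nat (Suc k) + a)) 0"
  proof (rule sums_higher_deriv[where A = "ball 0 (1/2)" and M = "\<lambda>k. 8 * 2 * B ^ 3 * (1/32) ^ k" and N = 0])
    show "(\<lambda>a. fc (of_nat (Suc k) + a)) holomorphic_on ball 0 (1/2)" for k
    proof (rule holomorphic_fc_shift)
      fix a :: complex assume "a \<in> ball 0 (1/2)"
      thus "-1 < Re a" using half[of a] by linarith
    qed
    show "norm (fc (of_nat (Suc k) + a)) \<le> 8 * 2 * B ^ 3 * (1/32) ^ k" if "a \<in> ball 0 (1/2)" for k a
    proof -
      have "norm (fc (of_nat (Suc k) + a)) \<le> 8 * (1 + norm a) * B ^ 3 * (1/32) ^ k"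
        using half[OF that] by (intro B(2)) auto
      also have "\<dots> \<le> 8 * 2 * B ^ 3 * (1/32) ^ k"
        using B(1) that by (intro mult_right_mono mult_left_mono) auto
      finally show ?thesis .
    qed
  qed (auto intro!: summable_mult summable_geometric)
  also have "(\<lambda>a. \<Sum>k. fc (of_nat (Suc k) + a)) = Sf" by (simp add: Sf_def fun_eq_iff)
  also have "(\<lambda>k. (deriv ^^ m) (\<lambda>a. fc (of_nat (Suc k) + a)) 0) = (\<lambda>k. of_real ((deriv ^^ m) f7 (real (Suc k))))"
  proof
    fix k
    have "(deriv ^^ m) (\<lambda>a. fc (of_nat (Suc k) + a)) 0 = (deriv ^^ m) fc (of_nat (Suc k))"
      using higher_deriv_shift_0[of m fc "of_nat (Suc k)"] by (simp only: o_def)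
    also have "\<dots> = (deriv ^^ m) fc (of_real (real (Suc k)))" by simp
    also have "\<dots> = of_real ((deriv ^^ m) f7 (real (Suc k)))"
      by (rule higher_deriv_real_restriction[OF holomorphic_fc open_halfspace_Re_gt, of "{0<..}"])
         (auto simp: fc_of_real)
    finally show "(deriv ^^ m) (\<lambda>a. fc (of_nat (Suc k) + a)) 0 = of_real ((deriv ^^ m) f7 (real (Suc k)))" .
  qed
  finally show ?thesis unfolding assms sums_of_real_iff .
qed

theorem theorem1p9:
  shows "(\<lambda>k. (deriv ^^ 2) f7 (real (Suc k))) sums (57 / 2 * zeta 4) \<and>
    (\<lambda>k. (deriv ^^ 3) f7 (real (Suc k))) sums (18 * pi ^ 2 * zeta 3 - 324 * zeta 5) \<and>
    (\<lambda>k. (deriv ^^ 4) f7 (real (Suc k))) sums (1959 / 2 * zeta 6 - 432 * zeta 3 ^ 2) \<and>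
    (\<lambda>k. (deriv ^^ 5) f7 (real (Suc k))) sums
      (19440 * zeta 2 * zeta 5 - 540 * zeta 3 * zeta 4 - 31860 * zeta 7) \<and>
    (\<lambda>k. (deriv ^^ 6) f7 (real (Suc k))) sums
      (31104 * double_zeta 5 3 + 38880 * zeta 2 * zeta 3 ^ 2 - 77760 * zeta 3 * zeta 5
        - 84807 / 4 * zeta 8) \<and>
    summable (\<lambda>k. (deriv ^^ 7) f7 (real (Suc k))) \<and>
    1 / 630 * (\<Sum>k. (deriv ^^ 7) f7 (real (Suc k))) =
      6372 * zeta 2 * zeta 7 - 213 * zeta 3 * zeta 6 - 324 * zeta 4 * zeta 5
        - 288 * zeta 3 ^ 3 - 8812 * zeta 9"
proof -
  have z: "zeta (numeral p) = zt (numeral p)" for p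
    using zeta_eq_zt[of "numeral p"] by simp
  have d: "double_zeta 5 3 = dz 5 3" by (rule double_zeta_eq_dz) (simp add: dz_ok_def)
  have p: "18 * pi ^ 2 * zt 3 = 108 * zt 2 * zt 3" by (simp add: zt_even(1))
  have FK: "Kf has_fps_expansion fps_expansion Kf 0"
    by (rule has_fps_expansion_fps_expansion[OF open_strip _ holomorphic_Kf]) simp
  note K = Kf_coeffs[OF FK]
  have S: "(\<lambda>k. (deriv ^^ m) f7 (real (Suc k))) sums s"
    if "fps_nth (fps_expansion Kf 0) (m + 2) = of_real s / fact m" "m \<ge> 1" for m s
    by (rule f7_sums) (use Sf_coeffs[OF FK that(2)] that(1) in simp)
  have 7: "(\<lambda>k. (deriv ^^ 7) f7 (real (Suc k))) sums
    (630 * (6372 * zt 2 * zt 7 - 213 * zt 3 * zt 6 - 324 * zt 4 * zt 5 - 288 * zt 3 ^ 3 - 8812 * zt 9))"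
    by (rule S) (use K in simp_all)
  show ?thesis unfolding z d p
    by (intro conjI S sums_summable[OF 7]) (use K sums_unique[OF 7] in simp_all)
qed

end
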